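(* Let $(M,\langle\cdot,\cdot\rangle)$ be a Riemannian manifold, let $k\ge1$, and let $q$ be a curve on $M$. The $k$-jet $\Gamma=j^kq$ is a geodesic on $(T^{(k)}M,g^{(k)})$, where $g^{(k)}$ is the $k$-Sasaki metric, if and only if $q$ is a geodesic on $M$.
   Context: $\nabla$ is the Levi--Civita connection of $M$. $T^{(k)}M$ is the manifold of $k$-jets $u=j^k_0(q)$ at $0$ of smooth curves $q$ in $M$, with projection $\tau_k(j^k_0q)=q(0)$. The $k$-jet (lift) of a curve $q$ on $M$ is the curve $(j^kq)(t)=j^k_0(q_t)$ on $T^{(k)}M$, where $q_t(s)=q(t+s)$. For $W\in T_uT^{(k)}M$ choose a family of curves $\gamma_s(t)=\gamma(s,t)$ on $M$ such that $s\mapsto j^k_0(\gamma_s)$ passes through $u$ at $s=0$ with velocity $W$, and set $K_0(W)=\tau_{k*}W$ and $K_\alpha(W)=\frac1{\alpha!}\nabla^\alpha_{\partial\gamma/\partial t}\frac{\partial\gamma}{\partial s}\big|_{(s,t)=(0,0)}$ for $\alpha=1,\ldots,k$. These are well defined and $(K_0,\ldots,K_k):T_uT^{(k)}M\to(T_{\tau_k(u)}M)^{k+1}$ is a linear isomorphism. The $k$-Sasaki metric $g^{(k)}$ on $T^{(k)}M$ is $g^{(k)}_u(W,W')=\sum_{\alpha=0}^k\langle K_\alpha(W),K_\alpha(W')\rangle$. *)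

theory Defs
  imports "HOL-Analysis.Analysis"
begin

section \<open>Smooth maps between Euclidean spaces\<close>

text \<open>
  \<open>Ck_on n S f\<close> is meant for open \<open>S\<close>: all iterated directional derivatives of \<open>f\<close> up to order
  \<open>n\<close> exist (as Frechet derivatives) and are continuous on \<open>S\<close>.
\<close>

primrec Ck_on :: "nat \<Rightarrow> 'a::real_normed_vector set \<Rightarrow> ('a \<Rightarrow> 'b::real_normed_vector) \<Rightarrow> bool" where
  "Ck_on 0 S f \<longleftrightarrow> continuous_on S f"
| "Ck_on (Suc n) S f \<longleftrightarrow>
     (\<forall>x\<in>S. f differentiable (at x)) \<and> (\<forall>v. Ck_on n S (\<lambda>x. frechet_derivative f (at x) v))"

definition smooth_on :: "'a::real_normed_vector set \<Rightarrow> ('a \<Rightarrow> 'b::real_normed_vector) \<Rightarrow> bool" where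
  "smooth_on S f \<longleftrightarrow> (\<forall>n. Ck_on n S f)"

definition vderiv :: "nat \<Rightarrow> (real \<Rightarrow> 'a::real_normed_vector) \<Rightarrow> real \<Rightarrow> 'a" where
  "vderiv n f = ((\<lambda>h t. vector_derivative h (at t)) ^^ n) f"


section \<open>Manifolds\<close>

text \<open>
  A manifold is given by an atlas. Its underlying set is the union of the chart domains and its
  topology is the one induced by the charts. The points need not exhaust the type \<open>'p\<close>.
\<close>

type_synonym ('p, 'e) chart = "'p set \<times> ('p \<Rightarrow> 'e)"
type_synonym ('p, 'e) atlas = "('p, 'e) chart set"

abbreviation cdom :: "('p, 'e) chart \<Rightarrow> 'p set" where "cdom c \<equiv> fst c"
abbreviation cmap :: "('p, 'e) chart \<Rightarrow> 'p \<Rightarrow> 'e" where "cmap c \<equiv> snd c"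
abbreviation cinv :: "('p, 'e) chart \<Rightarrow> 'e \<Rightarrow> 'p" where "cinv c \<equiv> inv_into (fst c) (snd c)"

definition smooth_atlas :: "('p, 'e::euclidean_space) atlas \<Rightarrow> bool" where
  "smooth_atlas A \<longleftrightarrow>
     (\<forall>c\<in>A. inj_on (cmap c) (cdom c) \<and> open (cmap c ` cdom c)) \<and>
     (\<forall>c\<in>A. \<forall>d\<in>A. open (cmap c ` (cdom c \<inter> cdom d)) \<and>
        smooth_on (cmap c ` (cdom c \<inter> cdom d)) (cmap d \<circ> cinv c))"

definition atlas_topology :: "('p, 'e::euclidean_space) atlas \<Rightarrow> 'p topology" where
  "atlas_topology A =
     topology_generated_by {{p \<in> cdom c. cmap c p \<in> V} | c V. c \<in> A \<and> open V}"

definition smooth_manifold :: "('p, 'e::euclidean_space) atlas \<Rightarrow> bool" where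
  "smooth_manifold A \<longleftrightarrow>
     smooth_atlas A \<and> Hausdorff_space (atlas_topology A) \<and> second_countable (atlas_topology A)"

text \<open>Smooth maps from an open set \<open>S\<close> of a Euclidean space into a manifold.\<close>

definition smooth_into :: "('p, 'e::euclidean_space) atlas \<Rightarrow> 'd::euclidean_space set \<Rightarrow> ('d \<Rightarrow> 'p) \<Rightarrow> bool" where
  "smooth_into A S f \<longleftrightarrow>
     (\<forall>x\<in>S. \<exists>c\<in>A. \<exists>N. open N \<and> x \<in> N \<and> N \<subseteq> S \<and> f ` N \<subseteq> cdom c \<and> smooth_on N (cmap c \<circ> f))"

definition smooth_near_0 :: "('p, 'e::euclidean_space) atlas \<Rightarrow> ('d::euclidean_space \<Rightarrow> 'p) \<Rightarrow> bool" where
  "smooth_near_0 A f \<longleftrightarrow> (\<exists>N. open N \<and> 0 \<in> N \<and> smooth_into A N f)"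

definition chart_at :: "('p, 'e) atlas \<Rightarrow> 'p \<Rightarrow> ('p, 'e) chart" where
  "chart_at A p = (SOME c. c \<in> A \<and> p \<in> cdom c)"


section \<open>Jets of curves\<close>

text \<open>
  A jet at \<open>0\<close> is an equivalence class of curves that are smooth near \<open>0\<close>. The values of a
  representative away from \<open>0\<close> are irrelevant.
\<close>

type_synonym 'p jet = "(real \<Rightarrow> 'p) set"

definition jet :: "('p, 'e::euclidean_space) atlas \<Rightarrow> nat \<Rightarrow> (real \<Rightarrow> 'p) \<Rightarrow> 'p jet" where
  "jet A k q = {r. smooth_near_0 A r \<and> r 0 = q 0 \<and>
     (\<forall>c\<in>A. q 0 \<in> cdom c \<longrightarrow> (\<forall>i\<le>k. vderiv i (cmap c \<circ> r) 0 = vderiv i (cmap c \<circ> q) 0))}"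

definition jets :: "('p, 'e::euclidean_space) atlas \<Rightarrow> nat \<Rightarrow> 'p jet set" where
  "jets A k = {jet A k q | q. smooth_near_0 A q}"

definition jrep :: "'p jet \<Rightarrow> real \<Rightarrow> 'p" where
  "jrep u = (SOME q. q \<in> u)"

definition jbase :: "'p jet \<Rightarrow> 'p" where
  "jbase u = jrep u 0"

definition jet_lift :: "('p, 'e::euclidean_space) atlas \<Rightarrow> nat \<Rightarrow> (real \<Rightarrow> 'p) \<Rightarrow> real \<Rightarrow> 'p jet" where
  "jet_lift A k q t = jet A k (\<lambda>s. q (t + s))"

text \<open>
  The manifold of \<open>k\<close>-jets: a chart of the base induces the chart whose coordinates are the
  derivatives of order \<open>0, \<dots>, k\<close> of the coordinate expression of a representative. The model
  space \<open>'e ^ 'k\<close> is the one intended when \<open>CARD('k) = k + 1\<close>; then \<open>to_nat_on UNIV\<close> is a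
  bijection from the index type onto \<open>{0..k}\<close>.
\<close>

definition jet_chart :: "('p, 'e::euclidean_space) atlas \<Rightarrow> nat \<Rightarrow> ('p, 'e) chart \<Rightarrow> ('p jet, 'e ^ 'k::finite) chart" where
  "jet_chart A k c =
     ({u \<in> jets A k. jbase u \<in> cdom c},
      \<lambda>u. \<chi> i. vderiv (to_nat_on (UNIV :: 'k set) i) (cmap c \<circ> jrep u) 0)"

definition jet_atlas :: "('p, 'e::euclidean_space) atlas \<Rightarrow> nat \<Rightarrow> ('p jet, 'e ^ 'k::finite) atlas" where
  "jet_atlas A k = jet_chart A k ` A"


section \<open>Tangent vectors\<close>

text \<open>
  Tangent vectors are \<open>1\<close>-jets of curves. \<open>tcoord\<close> gives the components of a tangent vector in a
  chart; \<open>tvec\<close> is the tangent vector with given components at the point with coordinates \<open>x\<close>.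
\<close>

definition velocity :: "('p, 'e::euclidean_space) atlas \<Rightarrow> (real \<Rightarrow> 'p) \<Rightarrow> real \<Rightarrow> 'p jet" where
  "velocity A q = jet_lift A 1 q"

definition tcoord :: "('p, 'e::euclidean_space) chart \<Rightarrow> 'p jet \<Rightarrow> 'e" where
  "tcoord c v = vector_derivative (cmap c \<circ> jrep v) (at 0)"

definition tvec :: "('p, 'e::euclidean_space) atlas \<Rightarrow> ('p, 'e) chart \<Rightarrow> 'e \<Rightarrow> 'e \<Rightarrow> 'p jet" where
  "tvec A c x a = jet A 1 (\<lambda>t. cinv c (x + t *\<^sub>R a))"

definition tzero :: "('p, 'e::euclidean_space) atlas \<Rightarrow> 'p \<Rightarrow> 'p jet" where
  "tzero A p = jet A 1 (\<lambda>_. p)"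

definition tscale :: "('p, 'e::euclidean_space) atlas \<Rightarrow> real \<Rightarrow> 'p jet \<Rightarrow> 'p jet" where
  "tscale A r v =
     (let c = chart_at A (jbase v) in tvec A c (cmap c (jbase v)) (r *\<^sub>R tcoord c v))"


section \<open>Riemannian metrics, the Levi-Civita connection, geodesics\<close>

type_synonym 'p metric = "'p jet \<Rightarrow> 'p jet \<Rightarrow> real"

text \<open>The coordinate expression of a metric in a chart.\<close>

definition metric_in :: "('p, 'e::euclidean_space) atlas \<Rightarrow> 'p metric \<Rightarrow> ('p, 'e) chart \<Rightarrow> 'e \<Rightarrow> 'e \<Rightarrow> 'e \<Rightarrow> real" where
  "metric_in A g c x a b = g (tvec A c x a) (tvec A c x b)"

definition riemannian_manifold :: "('p, 'e::euclidean_space) atlas \<Rightarrow> 'p metric \<Rightarrow> bool" where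
  "riemannian_manifold A g \<longleftrightarrow> smooth_manifold A \<and>
     (\<forall>c\<in>A.
        (\<forall>x \<in> cmap c ` cdom c.
           bilinear (metric_in A g c x) \<and>
           (\<forall>a b. metric_in A g c x a b = metric_in A g c x b a) \<and>
           (\<forall>a. a \<noteq> 0 \<longrightarrow> metric_in A g c x a a > 0)) \<and>
        (\<forall>a b. smooth_on (cmap c ` cdom c) (\<lambda>x. metric_in A g c x a b)))"

text \<open>
  In a chart a connection has the form \<open>\<nabla>\<^sub>a X = DX(a) + \<Gamma>\<^sub>x(a, X)\<close> with \<open>\<Gamma>\<^sub>x\<close> bilinear. It is
  torsion-free iff \<open>\<Gamma>\<^sub>x\<close> is symmetric, and metric iff the derivative of the metric coefficients
  satisfies the third condition below. These conditions determine the Levi-Civita connection.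
\<close>

definition christoffel :: "('p, 'e::euclidean_space) atlas \<Rightarrow> 'p metric \<Rightarrow> ('p, 'e) chart \<Rightarrow> 'e \<Rightarrow> 'e \<Rightarrow> 'e \<Rightarrow> 'e" where
  "christoffel A g c x = (THE \<Gamma>. bilinear \<Gamma> \<and> (\<forall>a b. \<Gamma> a b = \<Gamma> b a) \<and>
     (\<forall>u a b. frechet_derivative (\<lambda>y. metric_in A g c y a b) (at x) u =
        metric_in A g c x (\<Gamma> u a) b + metric_in A g c x a (\<Gamma> u b)))"

text \<open>
  The Levi-Civita covariant derivative of a vector field \<open>V\<close> along the curve \<open>t \<mapsto> jbase (V t)\<close>.
\<close>

definition nabla :: "('p, 'e::euclidean_space) atlas \<Rightarrow> 'p metric \<Rightarrow> (real \<Rightarrow> 'p jet) \<Rightarrow> real \<Rightarrow> 'p jet" where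
  "nabla A g V t =
     (let c = chart_at A (jbase (V t));
          x = (\<lambda>s. cmap c (jbase (V s)));
          v = (\<lambda>s. tcoord c (V s))
      in tvec A c (x t)
           (vector_derivative v (at t) +
            christoffel A g c (x t) (vector_derivative x (at t)) (v t)))"

definition geodesic :: "('p, 'e::euclidean_space) atlas \<Rightarrow> 'p metric \<Rightarrow> real set \<Rightarrow> (real \<Rightarrow> 'p) \<Rightarrow> bool" where
  "geodesic A g I q \<longleftrightarrow>
     smooth_into A I q \<and> (\<forall>t\<in>I. nabla A g (velocity A q) t = tzero A (q t))"


section \<open>The \<open>k\<close>-Sasaki metric\<close>

text \<open>
  A tangent vector \<open>W\<close> of the jet manifold is a class of curves of jets, so a curve of jets has
  velocity \<open>W\<close> at \<open>0\<close> (and passes through the base point of \<open>W\<close>) iff it is an element of \<open>W\<close>.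
\<close>

definition represents :: "('p, 'e::euclidean_space) atlas \<Rightarrow> nat \<Rightarrow> 'p jet jet \<Rightarrow> (real \<Rightarrow> real \<Rightarrow> 'p) \<Rightarrow> bool" where
  "represents A k W \<gamma> \<longleftrightarrow>
     smooth_near_0 A (\<lambda>(s, t). \<gamma> s t) \<and> (\<lambda>s. jet A k (\<gamma> s)) \<in> W"

definition K_map :: "('p, 'e::euclidean_space) atlas \<Rightarrow> 'p metric \<Rightarrow> nat \<Rightarrow> nat \<Rightarrow> 'p jet jet \<Rightarrow> 'p jet" where
  "K_map A g k \<alpha> W =
     (if \<alpha> = 0 then velocity A (jbase \<circ> jrep W) 0
      else let \<gamma> = (SOME \<gamma>. represents A k W \<gamma>)
           in tscale A (1 / fact \<alpha>) ((nabla A g ^^ \<alpha>) (\<lambda>t. velocity A (\<lambda>s. \<gamma> s t) 0) 0))"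

definition sasaki_metric :: "('p, 'e::euclidean_space) atlas \<Rightarrow> 'p metric \<Rightarrow> nat \<Rightarrow> 'p jet metric" where
  "sasaki_metric A g k W W' = (\<Sum>\<alpha>\<le>k. g (K_map A g k \<alpha> W) (K_map A g k \<alpha> W'))"

end

theory Submission
  imports Defs
begin

text \<open>
  Write \<open>w\<^sub>n\<close> for the \<open>n\<close>-th covariant derivative of \<open>q'\<close> along \<open>q\<close>, so that \<open>K\<^sub>n\<close> of the velocity of
  the lift is \<open>w\<^sub>n / n!\<close>. In jet coordinates \<open>K\<^sub>n\<close> is obtained by formally iterating the covariant
  derivative, and the geodesic equation of the lift is the Euler-Lagrange equation of the
  energy \<open>\<Sum>\<^sub>n |w\<^sub>n|\<^sup>2 / (n!)\<^sup>2\<close>. If \<open>w\<^sub>n = 0\<close> for \<open>n \<ge> 1\<close>, it reduces to that of \<open>q\<close>.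

  Conversely, varying only the highest derivative changes \<open>K\<^sub>k\<close> alone, up to one Christoffel term,
  and the corresponding component of the equation reads \<open>w\<^sub>k\<^sub>+\<^sub>1 = 0\<close>. Hence \<open>q'\<close> is polynomial of degree
  at most \<open>k\<close> in a parallel frame. The speed of a geodesic is constant, so
  \<open>\<Sum>\<^sub>n |w\<^sub>n|\<^sup>2 / (n!)\<^sup>2\<close> is constant. If the degree \<open>d\<close> were positive, then the \<open>2 d\<close>-th derivative
  of this sum would be a positive multiple of \<open>|w\<^sub>d|\<^sup>2\<close>, a contradiction; so \<open>w\<^sub>1 = 0\<close>.
\<close>

section \<open>Calculus of smooth maps\<close>

text \<open>\<open>nabla\<close> on the jet manifold is evaluated in the chart that
  \<open>chart_at\<close> picks, and this chart may change with the time. The geodesic equation of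
  the lift is therefore used at one time and in one chart. What it yields is restated at once
  through the covariant derivatives of \<open>q'\<close> on \<open>M\<close>, whose independence of
  charts is proved, and only these are differentiated further in time. The Christoffel symbols of
  the Sasaki metric stay implicit. Paired with a vector of constant components, an acceleration is
  the derivative of a momentum minus half the derivative of the squared speed at frozen velocity,
  and both come from the formal expression of \<open>K_n\<close>. This expression is triangular,
  with the n-th derivative of the components as leading part, whence the definiteness of the metric.
  With \<zeta> in the top slot, the derivative of the momentum contributes \<Gamma>(x', \<zeta>) and
  the variation of \<open>K_k\<close> contributes \<Gamma>(\<zeta>, x'); torsion-freeness makes them
  cancel. Metric compatibility acts as Leibniz' rule on the scalar products of the
  \<open>w_n\<close> and so takes the place of a parallel frame.\<close>

abbreviation FD :: "('a::real_normed_vector \<Rightarrow> 'b::real_normed_vector) \<Rightarrow> 'a \<Rightarrow> 'a \<Rightarrow> 'b" where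
  "FD f x \<equiv> frechet_derivative f (at x)"

lemma FD_I: "(f has_derivative f') (at x) \<Longrightarrow> FD f x = f'"
  using frechet_derivative_at by metis

lemma FD_cong:
  assumes "open S" "x \<in> S" "\<And>y. y \<in> S \<Longrightarrow> f y = g y"
  shows "FD f x = FD g x"
proof -
  have "(f has_derivative f') (at x) \<longleftrightarrow> (g has_derivative f') (at x)" for f'
    using has_derivative_transform_within_open[of _ _ x UNIV S] assms by (metis (no_types, lifting))
  then show ?thesis by (simp add: frechet_derivative_def)
qed

lemma differentiable_cong_open:
  assumes "open S" "x \<in> S" "\<And>y. y \<in> S \<Longrightarrow> f y = g y" "f differentiable (at x)"
  shows "g differentiable (at x)"
  using assms has_derivative_transform_within_open unfolding differentiable_def by (metis (no_types, lifting))

lemma Ck_on_cong: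
  assumes "open S" "\<And>x. x \<in> S \<Longrightarrow> f x = g x" "Ck_on n S f"
  shows "Ck_on n S g"
  using assms(2,3)
proof (induction n arbitrary: f g)
  case 0
  then show ?case by (simp cong: continuous_on_cong)
next
  case (Suc n)
  have "FD f x v = FD g x v" if "x \<in> S" for x v
    using FD_cong[OF assms(1) that Suc.prems(1)] by simp
  then show ?case
    using Suc.prems Suc.IH[of "\<lambda>x. FD f x _" "\<lambda>x. FD g x _"] differentiable_cong_open[OF assms(1) _ Suc.prems(1)]
    by auto
qed

lemma Ck_on_subset: "Ck_on n S f \<Longrightarrow> T \<subseteq> S \<Longrightarrow> Ck_on n T f"
proof (induction n arbitrary: f)
  case 0
  then show ?case using continuous_on_subset by auto
qed auto

lemma Ck_on_imp_continuous_on: "Ck_on n S f \<Longrightarrow> continuous_on S f"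
  by (cases n) (auto intro!: continuous_at_imp_continuous_on differentiable_imp_continuous_within)

lemma Ck_on_SucD: "Ck_on (Suc n) S f \<Longrightarrow> Ck_on n S f"
proof (induction n arbitrary: f)
  case 0
  then show ?case using Ck_on_imp_continuous_on[of "Suc 0"] by auto
next
  case (Suc n)
  then show ?case by (metis Ck_on.simps(2))
qed

lemma Ck_on_local:
  assumes "\<And>x. x \<in> S \<Longrightarrow> \<exists>N. open N \<and> x \<in> N \<and> Ck_on n N f"
  shows "Ck_on n S f"
  using assms
proof (induction n arbitrary: f)
  case 0
  have "continuous (at x) f" if "x \<in> S" for x
    using 0[OF that] continuous_on_eq_continuous_at by auto
  then show ?case by (auto intro: continuous_at_imp_continuous_on)
next
  case (Suc n)
  then show ?case by (metis Ck_on.simps(2))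
qed

lemma Ck_on_const [simp]: "Ck_on n S (\<lambda>x. c)"
  by (induction n arbitrary: c) auto

lemma Ck_on_linear:
  assumes "bounded_linear L"
  shows "Ck_on n S L"
proof -
  have "FD L x = L" for x
    by (rule FD_I) (rule bounded_linear_imp_has_derivative[OF assms])
  moreover have "L differentiable at x" for x
    using bounded_linear_imp_has_derivative[OF assms] differentiable_def by blast
  ultimately show ?thesis
    by (cases n) (auto intro: linear_continuous_on[OF assms])
qed

lemma Ck_on_add:
  assumes "open S" "Ck_on n S f" "Ck_on n S g"
  shows "Ck_on n S (\<lambda>x. f x + g x)"
  using assms(2,3)
proof (induction n arbitrary: f g)
  case 0
  then show ?case by (auto intro: continuous_intros)
next
  case (Suc n)
  have d: "((\<lambda>x. f x + g x) has_derivative (\<lambda>v. FD f x v + FD g x v)) (at x)" if "x \<in> S" for x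
    using Suc.prems that by (auto intro!: has_derivative_add simp: frechet_derivative_works)
  have "Ck_on n S (\<lambda>x. FD (\<lambda>x. f x + g x) x v)" for v
    by (rule Ck_on_cong[OF assms(1), of "\<lambda>x. FD f x v + FD g x v"])
       (use FD_I[OF d] Suc in auto)
  then show ?case using differentiableI[OF d] by auto
qed

lemma Ck_on_sum:
  assumes "open S" "\<And>i. i \<in> I \<Longrightarrow> Ck_on n S (f i)"
  shows "Ck_on n S (\<lambda>x. \<Sum>i\<in>I. f i x)"
  using assms(2) by (induction I rule: infinite_finite_induct) (auto intro: Ck_on_add[OF assms(1)])

lemma Ck_on_bounded_linear:
  assumes "open S" "bounded_linear L" "Ck_on n S f"
  shows "Ck_on n S (\<lambda>x. L (f x))"
  using assms(3)
proof (induction n arbitrary: f)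
  case 0
  then show ?case using bounded_linear.continuous_on[OF assms(2)] by auto
next
  case (Suc n)
  have d: "((\<lambda>x. L (f x)) has_derivative (\<lambda>v. L (FD f x v))) (at x)" if "x \<in> S" for x
    using Suc.prems that by (auto intro!: bounded_linear.has_derivative[OF assms(2)] simp: frechet_derivative_works)
  have "Ck_on n S (\<lambda>x. FD (\<lambda>x. L (f x)) x v)" for v
    by (rule Ck_on_cong[OF assms(1), of "\<lambda>x. L (FD f x v)"])
       (use FD_I[OF d] Suc in auto)
  then show ?case using differentiableI[OF d] by auto
qed

lemma Ck_on_bounded_bilinear:
  assumes "open S" "bounded_bilinear P" "Ck_on n S f" "Ck_on n S g"
  shows "Ck_on n S (\<lambda>x. P (f x) (g x))"
  using assms(3,4)
proof (induction n arbitrary: f g)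
  case 0
  then show ?case using bounded_bilinear.continuous_on[OF assms(2)] by auto
next
  case (Suc n)
  have d: "((\<lambda>x. P (f x) (g x)) has_derivative (\<lambda>v. P (f x) (FD g x v) + P (FD f x v) (g x))) (at x)"
    if "x \<in> S" for x
    using Suc.prems that by (auto intro!: bounded_bilinear.FDERIV[OF assms(2)] simp: frechet_derivative_works)
  have "Ck_on n S (\<lambda>x. P (f x) (FD g x v) + P (FD f x v) (g x))" for v
    using Suc.prems Suc.prems[THEN Ck_on_SucD] by (intro Ck_on_add[OF assms(1)] Suc.IH) simp_all
  then have "Ck_on n S (\<lambda>x. FD (\<lambda>x. P (f x) (g x)) x v)" for v
    by (rule Ck_on_cong[OF assms(1), rotated]) (use FD_I[OF d] in auto)
  then show ?case using differentiableI[OF d] by auto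
qed

lemma FD_compose:
  assumes "f differentiable (at x)" "g differentiable (at (f x))"
  shows "((\<lambda>x. g (f x)) has_derivative (\<lambda>v. FD g (f x) (FD f x v))) (at x)"
  using assms has_derivative_compose[of f "FD f x" x UNIV g "FD g (f x)"]
  by (auto simp: frechet_derivative_works)

lemma FD_basis:
  fixes g :: "'b::euclidean_space \<Rightarrow> 'c::real_normed_vector"
  assumes "g differentiable (at y)"
  shows "FD g y v = (\<Sum>b\<in>Basis. (v \<bullet> b) *\<^sub>R FD g y b)"
proof -
  interpret linear "FD g y" using linear_frechet_derivative[OF assms] .
  have "FD g y v = FD g y (\<Sum>b\<in>Basis. (v \<bullet> b) *\<^sub>R b)" by (simp add: euclidean_representation)
  then show ?thesis by (simp only: sum scaleR)
qed

text \<open>The chain rule evaluates the derivative of \<open>g\<close> in the direction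
  \<open>FD f x v\<close>, which moves with \<open>x\<close>, while \<open>Ck_on\<close> controls
  fixed directions only. Expanding that direction in \<open>Basis\<close> leaves fixed directions
  with scalar coefficients, to which the induction hypothesis applies.\<close>

lemma Ck_on_compose:
  fixes g :: "'b::euclidean_space \<Rightarrow> 'c::real_normed_vector"
  assumes "open S" "open T" "Ck_on n S f" "Ck_on n T g" "f ` S \<subseteq> T"
  shows "Ck_on n S (\<lambda>x. g (f x))"
  using assms(3,4)
proof (induction n arbitrary: g)
  case 0
  then show ?case using continuous_on_compose2 assms(5) by (metis Ck_on.simps(1))
next
  case (Suc n)
  have T: "f x \<in> T" if "x \<in> S" for x using that assms(5) by auto
  have d: "((\<lambda>x. g (f x)) has_derivative (\<lambda>v. FD g (f x) (FD f x v))) (at x)" if "x \<in> S" for x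
    using Suc.prems that T by (auto intro!: FD_compose)
  have "Ck_on n S (\<lambda>x. \<Sum>b\<in>Basis. (FD f x v \<bullet> b) *\<^sub>R FD g (f x) b)" for v
  proof (intro Ck_on_sum[OF assms(1)])
    fix b :: 'b assume b: "b \<in> Basis"
    have "Ck_on n S (\<lambda>x. FD g (f x) b)"
      using Suc.prems Ck_on_SucD by (intro Suc.IH) auto
    moreover have "Ck_on n S (\<lambda>x. FD f x v \<bullet> b)"
      using Suc.prems by (intro Ck_on_bounded_linear[OF assms(1) bounded_linear_inner_left]) auto
    ultimately show "Ck_on n S (\<lambda>x. (FD f x v \<bullet> b) *\<^sub>R FD g (f x) b)"
      by (intro Ck_on_bounded_bilinear[OF assms(1) bounded_bilinear_scaleR])
  qed
  moreover have "(\<Sum>b\<in>Basis. (FD f x v \<bullet> b) *\<^sub>R FD g (f x) b) = FD (\<lambda>x. g (f x)) x v" if "x \<in> S" for x v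
    unfolding FD_I[OF d[OF that]]
    by (rule FD_basis[symmetric]) (use Suc.prems(2) T[OF that] in simp)
  ultimately have "Ck_on n S (\<lambda>x. FD (\<lambda>x. g (f x)) x v)" for v
    by (rule Ck_on_cong[OF assms(1), rotated])
  then show ?case using differentiableI[OF d] by auto
qed

section \<open>Closure properties of smooth maps\<close>

lemma smooth_on_cong: "open S \<Longrightarrow> (\<And>x. x \<in> S \<Longrightarrow> f x = g x) \<Longrightarrow> smooth_on S f \<Longrightarrow> smooth_on S g"
  unfolding smooth_on_def using Ck_on_cong by blast

lemma smooth_on_subset: "smooth_on S f \<Longrightarrow> T \<subseteq> S \<Longrightarrow> smooth_on T f"
  unfolding smooth_on_def using Ck_on_subset by blast

lemma smooth_on_local:
  "(\<And>x. x \<in> S \<Longrightarrow> \<exists>N. open N \<and> x \<in> N \<and> smooth_on N f) \<Longrightarrow> smooth_on S f"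
  unfolding smooth_on_def by (metis Ck_on_local)

lemma smooth_on_continuous_on: "smooth_on S f \<Longrightarrow> continuous_on S f"
  unfolding smooth_on_def using Ck_on_imp_continuous_on by blast

lemma smooth_on_differentiable: "smooth_on S f \<Longrightarrow> x \<in> S \<Longrightarrow> f differentiable (at x)"
  unfolding smooth_on_def by (metis Ck_on.simps(2))

lemma smooth_on_has_derivative: "smooth_on S f \<Longrightarrow> x \<in> S \<Longrightarrow> (f has_derivative FD f x) (at x)"
  using smooth_on_differentiable frechet_derivative_works by blast

lemma smooth_on_FD: "smooth_on S f \<Longrightarrow> smooth_on S (\<lambda>x. FD f x v)"
  unfolding smooth_on_def by (metis Ck_on.simps(2))

lemma smooth_on_const: "smooth_on S (\<lambda>x. c)"
  by (simp add: smooth_on_def)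

lemma smooth_on_linear: "bounded_linear L \<Longrightarrow> smooth_on S L"
  by (simp add: smooth_on_def Ck_on_linear)

lemma smooth_on_add: "open S \<Longrightarrow> smooth_on S f \<Longrightarrow> smooth_on S g \<Longrightarrow> smooth_on S (\<lambda>x. f x + g x)"
  by (simp add: smooth_on_def Ck_on_add)

lemma smooth_on_sum:
  "open S \<Longrightarrow> (\<And>i. i \<in> I \<Longrightarrow> smooth_on S (f i)) \<Longrightarrow> smooth_on S (\<lambda>x. \<Sum>i\<in>I. f i x)"
  by (simp add: smooth_on_def Ck_on_sum)

lemma smooth_on_bounded_linear:
  "open S \<Longrightarrow> bounded_linear L \<Longrightarrow> smooth_on S f \<Longrightarrow> smooth_on S (\<lambda>x. L (f x))"
  by (simp add: smooth_on_def Ck_on_bounded_linear)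

lemma smooth_on_bounded_bilinear:
  "open S \<Longrightarrow> bounded_bilinear P \<Longrightarrow> smooth_on S f \<Longrightarrow> smooth_on S g \<Longrightarrow> smooth_on S (\<lambda>x. P (f x) (g x))"
  by (simp add: smooth_on_def Ck_on_bounded_bilinear)

lemmas smooth_on_scaleR = smooth_on_bounded_bilinear[OF _ bounded_bilinear_scaleR]
lemmas smooth_on_mult = smooth_on_bounded_bilinear[OF _ bounded_bilinear_mult]
lemmas smooth_on_inner_left = smooth_on_bounded_linear[OF _ bounded_linear_inner_left]

lemma smooth_on_diff:
  assumes "open S" "smooth_on S f" "smooth_on S g"
  shows "smooth_on S (\<lambda>x. f x - g x)"
  using smooth_on_add[OF assms(1,2) smooth_on_bounded_linear[OF assms(1) bounded_linear_minus[OF bounded_linear_ident] assms(3)]]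
  by simp

lemma smooth_on_compose:
  fixes g :: "'b::euclidean_space \<Rightarrow> 'c::real_normed_vector"
  assumes "open S" "open T" "smooth_on S f" "smooth_on T g" "f ` S \<subseteq> T"
  shows "smooth_on S (\<lambda>x. g (f x))"
  using assms unfolding smooth_on_def by (auto intro: Ck_on_compose)

lemma smooth_on_Pair:
  assumes "open S" "smooth_on S f" "smooth_on S g"
  shows "smooth_on S (\<lambda>x. (f x, g x))"
  using smooth_on_add[OF assms(1)
      smooth_on_bounded_linear[OF assms(1) bounded_linear_Pair[OF bounded_linear_ident bounded_linear_zero] assms(2)]
      smooth_on_bounded_linear[OF assms(1) bounded_linear_Pair[OF bounded_linear_zero bounded_linear_ident] assms(3)]]
  by simp

lemma smooth_on_euclidean:
  fixes f :: "'a::real_normed_vector \<Rightarrow> 'b::euclidean_space"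
  assumes "open S" "\<And>b. b \<in> Basis \<Longrightarrow> smooth_on S (\<lambda>x. f x \<bullet> b)"
  shows "smooth_on S f"
proof -
  have "smooth_on S (\<lambda>x. \<Sum>b\<in>Basis. (f x \<bullet> b) *\<^sub>R b)"
    by (intro smooth_on_sum smooth_on_bounded_linear[OF _ bounded_linear_scaleR_left] assms)
  then show ?thesis by (simp add: euclidean_representation)
qed

lemma smooth_on_vec:
  fixes f :: "'a::real_normed_vector \<Rightarrow> 'b::euclidean_space ^ 'n"
  assumes "open S" "\<And>i. smooth_on S (\<lambda>x. f x $ i)"
  shows "smooth_on S f"
proof (rule smooth_on_euclidean[OF assms(1)])
  fix b :: "'b ^ 'n" assume "b \<in> Basis"
  then obtain i c where "b = axis i c" by (auto simp: Basis_vec_def)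
  then show "smooth_on S (\<lambda>x. f x \<bullet> b)"
    using smooth_on_inner_left[OF assms(1) assms(2)[of i], of c] by (simp add: inner_axis)
qed

lemma smooth_on_FD_apply:
  fixes f :: "'a::euclidean_space \<Rightarrow> 'b::real_normed_vector"
  assumes "open S" "smooth_on S f" "smooth_on S L"
  shows "smooth_on S (\<lambda>x. FD f x (L x))"
proof (rule smooth_on_cong[OF assms(1)])
  show "smooth_on S (\<lambda>x. \<Sum>b\<in>Basis. (L x \<bullet> b) *\<^sub>R FD f x b)"
    by (intro smooth_on_sum smooth_on_scaleR smooth_on_inner_left smooth_on_FD assms)
qed (use smooth_on_differentiable[OF assms(2)] FD_basis in metis)

lemma linear_basis_expand:
  fixes L :: "'a::euclidean_space \<Rightarrow> 'b::real_normed_vector"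
  assumes "linear L"
  shows "L v = (\<Sum>b\<in>Basis. (v \<bullet> b) *\<^sub>R L b)"
proof -
  interpret linear L by fact
  have "L v = L (\<Sum>b\<in>Basis. (v \<bullet> b) *\<^sub>R b)" by (simp add: euclidean_representation)
  then show ?thesis by (simp only: sum scaleR)
qed

text \<open>Smoothness of a family of linear maps is given for fixed arguments; the expansion in
  \<open>Basis\<close> transfers it to arguments that move. Metric coefficients and Christoffel
  symbols are handled in this form.\<close>

lemma smooth_on_linear_apply:
  fixes L :: "'a::real_normed_vector \<Rightarrow> 'b::euclidean_space \<Rightarrow> 'c::real_normed_vector"
  assumes "open S" "\<And>y. y \<in> S \<Longrightarrow> linear (L y)" "\<And>a. smooth_on S (\<lambda>y. L y a)" "smooth_on S u"
  shows "smooth_on S (\<lambda>y. L y (u y))"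
proof (rule smooth_on_cong[OF assms(1)])
  show "smooth_on S (\<lambda>y. \<Sum>b\<in>Basis. (u y \<bullet> b) *\<^sub>R L y b)"
    by (intro smooth_on_sum smooth_on_scaleR smooth_on_inner_left assms)
qed (simp add: linear_basis_expand[OF assms(2), symmetric])

lemma bilinearD:
  assumes "bilinear P"
  shows "linear (\<lambda>y. P x y)" "linear (\<lambda>x. P x y)"
  using assms unfolding bilinear_def by auto

lemma smooth_on_bilinear_apply:
  fixes P :: "'a::euclidean_space \<Rightarrow> 'b::euclidean_space \<Rightarrow> 'c::euclidean_space \<Rightarrow> 'd::real_normed_vector"
  assumes "open S" "open U" "f ` S \<subseteq> U" "smooth_on S f" "smooth_on S u" "smooth_on S v"
    and "\<And>y. y \<in> U \<Longrightarrow> bilinear (P y)" "\<And>a b. smooth_on U (\<lambda>y. P y a b)"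
  shows "smooth_on S (\<lambda>y. P (f y) (u y) (v y))"
proof (rule smooth_on_linear_apply[OF assms(1) _ _ assms(6)])
  show "linear (P (f y) (u y))" if "y \<in> S" for y
    using that assms(3,7) bilinearD by blast
  show "smooth_on S (\<lambda>y. P (f y) (u y) a)" for a
  proof (rule smooth_on_linear_apply[OF assms(1) _ _ assms(5)])
    show "linear (\<lambda>b. P (f y) b a)" if "y \<in> S" for y
      using that assms(3,7) bilinearD by blast
    show "smooth_on S (\<lambda>y. P (f y) b a)" for b
      using smooth_on_compose[OF assms(1,2,4,8,3)] .
  qed
qed

text \<open>Product rule with one term for the base point and one for each argument. On
  \<open>U\<close>, bilinearity turns the expression into a finite double sum over
  \<open>Basis\<close> with coefficients \<open>P (f y) i j\<close>, and this sum is
  differentiated.\<close>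

lemma has_derivative_bilinear_apply:
  fixes P :: "'a::euclidean_space \<Rightarrow> 'b::euclidean_space \<Rightarrow> 'c::euclidean_space \<Rightarrow> 'd::real_normed_vector"
  assumes "open S" "y \<in> S" "(f has_derivative f') (at y)" "(u has_derivative u') (at y)" "(v has_derivative v') (at y)"
    and "open U" "\<And>y. y \<in> S \<Longrightarrow> f y \<in> U" "\<And>z. z \<in> U \<Longrightarrow> bilinear (P z)"
    and "\<And>a b. (\<lambda>z. P z a b) differentiable (at (f y))"
  shows "((\<lambda>y. P (f y) (u y) (v y)) has_derivative
     (\<lambda>w. FD (\<lambda>z. P z (u y) (v y)) (f y) (f' w) + P (f y) (u' w) (v y) + P (f y) (u y) (v' w))) (at y)"
proof -
  have exp: "P z a b = (\<Sum>i\<in>Basis. \<Sum>j\<in>Basis. ((a \<bullet> i) * (b \<bullet> j)) *\<^sub>R P z i j)" if "z \<in> U" for z a b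
  proof -
    have "P z a b = (\<Sum>i\<in>Basis. (a \<bullet> i) *\<^sub>R P z i b)"
      using linear_basis_expand[OF bilinearD(2)[OF assms(8)[OF that]]] .
    also have "\<dots> = (\<Sum>i\<in>Basis. (a \<bullet> i) *\<^sub>R (\<Sum>j\<in>Basis. (b \<bullet> j) *\<^sub>R P z i j))"
      using linear_basis_expand[OF bilinearD(1)[OF assms(8)[OF that]]] by metis
    finally show ?thesis by (simp add: scaleR_sum_right)
  qed
  have U: "f y \<in> U" using assms(2,7) by blast
  let ?D = "\<lambda>a b. FD (\<lambda>z. P z a b) (f y)"
  have dP: "((\<lambda>z. P z a b) has_derivative ?D a b) (at (f y))" for a b
    using assms(9) frechet_derivative_works by blast
  have "((\<lambda>y. P (f y) a b) has_derivative (\<lambda>w. ?D a b (f' w))) (at y)" for a b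
    using has_derivative_compose[OF assms(3) dP] .
  then have "((\<lambda>y. \<Sum>i\<in>Basis. \<Sum>j\<in>Basis. ((u y \<bullet> i) * (v y \<bullet> j)) *\<^sub>R P (f y) i j) has_derivative
    (\<lambda>w. \<Sum>i\<in>Basis. \<Sum>j\<in>Basis. ((u y \<bullet> i) * (v y \<bullet> j)) *\<^sub>R ?D i j (f' w) +
       ((u y \<bullet> i) * (v' w \<bullet> j) + (u' w \<bullet> i) * (v y \<bullet> j)) *\<^sub>R P (f y) i j)) (at y)" (is "(?L has_derivative ?R) _")
    by (intro derivative_intros has_derivative_inner_left assms(4,5))
  then have "((\<lambda>y. P (f y) (u y) (v y)) has_derivative ?R) (at y)"
    by (rule has_derivative_transform_within_open[OF _ assms(1,2)]) (use exp assms(7) in \<open>simp\<close>)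
  moreover have "?R w = ?D (u y) (v y) (f' w) + P (f y) (u' w) (v y) + P (f y) (u y) (v' w)" for w
  proof -
    \<comment> \<open>The same expansion with frozen arguments: it identifies the terms in which
      only the base point moves with a derivative of \<open>P\<close> itself.\<close>
    have "((\<lambda>z. \<Sum>i\<in>Basis. \<Sum>j\<in>Basis. ((u y \<bullet> i) * (v y \<bullet> j)) *\<^sub>R P z i j) has_derivative
        (\<lambda>x. \<Sum>i\<in>Basis. \<Sum>j\<in>Basis. ((u y \<bullet> i) * (v y \<bullet> j)) *\<^sub>R ?D i j x)) (at (f y))"
      by (intro derivative_intros dP)
    then have "((\<lambda>z. P z (u y) (v y)) has_derivative
        (\<lambda>x. \<Sum>i\<in>Basis. \<Sum>j\<in>Basis. ((u y \<bullet> i) * (v y \<bullet> j)) *\<^sub>R ?D i j x)) (at (f y))"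
      by (rule has_derivative_transform_within_open[OF _ assms(6) U]) (use exp in simp)
    then have "?D (u y) (v y) = (\<lambda>x. \<Sum>i\<in>Basis. \<Sum>j\<in>Basis. ((u y \<bullet> i) * (v y \<bullet> j)) *\<^sub>R ?D i j x)"
      by (rule FD_I)
    then show ?thesis
      by (simp add: exp[OF U, of "u' w" "v y"] exp[OF U, of "u y" "v' w"] sum.distrib scaleR_add_left)
  qed
  ultimately show ?thesis by (simp add: fun_eq_iff)
qed

lemma has_vector_derivative_FD:
  assumes "(x has_vector_derivative w) (at t)" "f differentiable (at (x t))"
  shows "((\<lambda>s. f (x s)) has_vector_derivative FD f (x t) w) (at t)"
proof -
  have "((\<lambda>s. f (x s)) has_derivative (\<lambda>r. FD f (x t) (r *\<^sub>R w))) (at t)"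
    using has_derivative_compose[of x "\<lambda>r. r *\<^sub>R w" t UNIV f "FD f (x t)"] assms
    by (auto simp: has_vector_derivative_def frechet_derivative_works)
  then show ?thesis
    by (simp add: has_vector_derivative_def linear_scale[OF linear_frechet_derivative[OF assms(2)]])
qed

lemma has_vector_derivative_line:
  "((\<lambda>s. p + s *\<^sub>R u) has_vector_derivative u) (at t)"
  by (auto intro!: derivative_eq_intros simp: has_vector_derivative_def)

section \<open>Symmetry of second derivatives\<close>

text \<open>The mean value theorem is applied twice, in direction \<open>u\<close> to the difference
  of two parallel segments and then in direction \<open>v\<close> to the derivative. The left-hand
  side is symmetric in \<open>u\<close> and \<open>v\<close>, the right-hand side is not: that is
  the whole source of \<open>FD_commute\<close>.\<close>

lemma second_difference:
  fixes f :: "'a::real_normed_vector \<Rightarrow> real"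
  assumes "smooth_on S f" "ball x r \<subseteq> S" "0 < h" "h * (norm u + norm v) < r"
  shows "\<exists>\<xi> \<eta>. 0 < \<xi> \<and> \<xi> < h \<and> 0 < \<eta> \<and> \<eta> < h \<and>
    f (x + h *\<^sub>R u + h *\<^sub>R v) - f (x + h *\<^sub>R u) - f (x + h *\<^sub>R v) + f x
      = h * (h * FD (\<lambda>y. FD f y u) (x + \<xi> *\<^sub>R u + \<eta> *\<^sub>R v) v)"
proof -
  have inS: "x + s *\<^sub>R u + t *\<^sub>R v \<in> S" if "0 \<le> s" "s \<le> h" "0 \<le> t" "t \<le> h" for s t
  proof -
    have "norm (s *\<^sub>R u + t *\<^sub>R v) \<le> s * norm u + t * norm v"
      using norm_triangle_ineq[of "s *\<^sub>R u" "t *\<^sub>R v"] that by simp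
    also have "\<dots> \<le> h * (norm u + norm v)"
      unfolding distrib_left using that by (intro add_mono mult_right_mono) auto
    finally have "dist x (x + (s *\<^sub>R u + t *\<^sub>R v)) < r"
      using assms(4) by (simp only: dist_norm norm_minus_commute[of x] add_diff_cancel_left')
    then show ?thesis using assms(2) by (auto simp: add.assoc)
  qed
  have der: "((\<lambda>s. F (p + s *\<^sub>R w)) has_real_derivative FD F (p + s *\<^sub>R w) w) (at s)"
    if "smooth_on S F" "p + s *\<^sub>R w \<in> S" for F :: "'a \<Rightarrow> real" and p w s
    using has_vector_derivative_FD[OF has_vector_derivative_line smooth_on_differentiable[OF that]]
    by (simp add: has_real_derivative_iff_has_vector_derivative)
  have "((\<lambda>s. f ((x + h *\<^sub>R v) + s *\<^sub>R u) - f (x + s *\<^sub>R u)) has_real_derivative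
      FD f ((x + h *\<^sub>R v) + s *\<^sub>R u) u - FD f (x + s *\<^sub>R u) u) (at s)" if "0 \<le> s" "s \<le> h" for s
    by (intro derivative_intros der[OF assms(1)])
      (use inS[OF that, of h] inS[OF that, of 0] assms(3) in \<open>auto simp: algebra_simps\<close>)
  from MVT2[OF assms(3) this] obtain \<xi> where \<xi>: "0 < \<xi>" "\<xi> < h"
    "f ((x + h *\<^sub>R v) + h *\<^sub>R u) - f (x + h *\<^sub>R u) - (f (x + h *\<^sub>R v) - f x)
      = h * (FD f ((x + h *\<^sub>R v) + \<xi> *\<^sub>R u) u - FD f (x + \<xi> *\<^sub>R u) u)"
    by auto
  have "((\<lambda>t. FD f ((x + \<xi> *\<^sub>R u) + t *\<^sub>R v) u) has_real_derivative
      FD (\<lambda>y. FD f y u) ((x + \<xi> *\<^sub>R u) + t *\<^sub>R v) v) (at t)" if "0 \<le> t" "t \<le> h" for t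
    by (intro der smooth_on_FD[OF assms(1)]) (use inS[OF _ _ that, of \<xi>] \<xi> in auto)
  from MVT2[OF assms(3) this] obtain \<eta> where \<eta>: "0 < \<eta>" "\<eta> < h"
    "FD f ((x + \<xi> *\<^sub>R u) + h *\<^sub>R v) u - FD f (x + \<xi> *\<^sub>R u) u
      = h * FD (\<lambda>y. FD f y u) ((x + \<xi> *\<^sub>R u) + \<eta> *\<^sub>R v) v"
    by auto
  have "f (x + h *\<^sub>R u + h *\<^sub>R v) - f (x + h *\<^sub>R u) - f (x + h *\<^sub>R v) + f x
      = h * (h * FD (\<lambda>y. FD f y u) (x + \<xi> *\<^sub>R u + \<eta> *\<^sub>R v) v)"
    using \<xi>(3) \<eta>(3) by (simp add: algebra_simps)
  then show ?thesis using \<xi> \<eta> by blast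
qed

text \<open>Both mixed derivatives, taken at points near \<open>x\<close>, equal one and the same
  second difference quotient; by continuity they cannot differ at \<open>x\<close>.\<close>

lemma FD_commute_real:
  fixes f :: "'a::real_normed_vector \<Rightarrow> real"
  assumes "open S" "smooth_on S f" "x \<in> S"
  shows "FD (\<lambda>y. FD f y u) x v = FD (\<lambda>y. FD f y v) x u"
proof (rule ccontr)
  let ?A = "\<lambda>y. FD (\<lambda>y. FD f y u) y v" and ?B = "\<lambda>y. FD (\<lambda>y. FD f y v) y u"
  assume ne: "?A x \<noteq> ?B x"
  \<comment> \<open>Half of the supposed gap: two deviations below \<open>e\<close> from a common
    value would make the gap smaller than itself.\<close>
  define e where "e = \<bar>?A x - ?B x\<bar> / 2"
  have e: "e > 0" using ne by (simp add: e_def)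
  have "isCont ?A x" "isCont ?B x"
    using smooth_on_continuous_on[OF smooth_on_FD[OF smooth_on_FD[OF assms(2)]]] assms(1,3)
    by (auto simp: continuous_on_eq_continuous_at)
  then obtain d1 d2 where d: "d1 > 0" "d2 > 0"
    "\<And>y. dist y x < d1 \<Longrightarrow> \<bar>?A y - ?A x\<bar> < e" "\<And>y. dist y x < d2 \<Longrightarrow> \<bar>?B y - ?B x\<bar> < e"
    using e unfolding continuous_at_eps_delta dist_real_def by metis
  obtain d3 where d3: "d3 > 0" "ball x d3 \<subseteq> S" using assms open_contains_ball by blast
  define r where "r = min (min d1 d2) d3"
  \<comment> \<open>The step keeps the parallelogram inside the ball of radius \<open>r\<close>. The
    summand 1 keeps the denominator positive when \<open>u\<close> and \<open>v\<close> both
    vanish.\<close>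
  define h where "h = r / (2 * (norm u + norm v + 1))"
  have r: "r > 0" using d d3 by (simp add: r_def)
  have n: "0 < norm u + norm v + 1" by (simp add: add_nonneg_pos)
  have h: "h > 0" unfolding h_def using r n by simp
  have "h * (norm u + norm v) < h * (norm u + norm v + 1)" using h by simp
  also have "\<dots> = r / 2" using n by (simp add: h_def field_simps)
  also have "\<dots> < r" using r by simp
  finally have hr: "h * (norm u + norm v) < r" .
  have bS: "ball x r \<subseteq> S" using d3 by (auto simp: r_def)
  have near: "dist (x + s *\<^sub>R u + t *\<^sub>R v) x < r" if "0 < s" "s < h" "0 < t" "t < h" for s t
  proof -
    have "norm (s *\<^sub>R u + t *\<^sub>R v) \<le> s * norm u + t * norm v"
      using norm_triangle_ineq[of "s *\<^sub>R u" "t *\<^sub>R v"] that by simp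
    also have "\<dots> \<le> h * (norm u + norm v)"
      unfolding distrib_left using that by (intro add_mono mult_right_mono) auto
    finally show ?thesis
      using hr by (simp add: dist_norm add.assoc)
  qed
  obtain s t where st: "0 < s" "s < h" "0 < t" "t < h"
    "f (x + h *\<^sub>R u + h *\<^sub>R v) - f (x + h *\<^sub>R u) - f (x + h *\<^sub>R v) + f x = h * (h * ?A (x + s *\<^sub>R u + t *\<^sub>R v))"
    using second_difference[OF assms(2) bS h hr] by blast
  obtain s' t' where st': "0 < s'" "s' < h" "0 < t'" "t' < h"
    "f (x + h *\<^sub>R v + h *\<^sub>R u) - f (x + h *\<^sub>R v) - f (x + h *\<^sub>R u) + f x = h * (h * ?B (x + s' *\<^sub>R v + t' *\<^sub>R u))"
    using second_difference[OF assms(2) bS h, of v u] hr by (auto simp: add.commute)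
  have "h * (h * ?A (x + s *\<^sub>R u + t *\<^sub>R v)) = h * (h * ?B (x + s' *\<^sub>R v + t' *\<^sub>R u))"
    using st(5) st'(5) by (simp add: algebra_simps)
  then have eq: "?A (x + s *\<^sub>R u + t *\<^sub>R v) = ?B (x + t' *\<^sub>R u + s' *\<^sub>R v)"
    using h by (simp add: algebra_simps)
  have "\<bar>?A (x + s *\<^sub>R u + t *\<^sub>R v) - ?A x\<bar> < e"
    by (rule d(3)) (use near[OF st(1-4)] in \<open>simp add: r_def\<close>)
  moreover have "\<bar>?B (x + t' *\<^sub>R u + s' *\<^sub>R v) - ?B x\<bar> < e"
    by (rule d(4)) (use near[OF st'(3,4,1,2)] in \<open>simp add: r_def\<close>)
  moreover have "\<bar>a - b\<bar> \<le> \<bar>p - a\<bar> + \<bar>p - b\<bar>" for a b p :: real by arith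
  ultimately show False
    using eq unfolding e_def by (smt (verit) field_sum_of_halves)
qed

lemma FD_commute:
  fixes f :: "'a::real_normed_vector \<Rightarrow> 'b::euclidean_space"
  assumes "open S" "smooth_on S f" "x \<in> S"
  shows "FD (\<lambda>y. FD f y u) x v = FD (\<lambda>y. FD f y v) x u"
proof (rule euclidean_eqI)
  fix b :: 'b
  have *: "FD (\<lambda>y. F y \<bullet> b) y w = FD F y w \<bullet> b" if "y \<in> S" "smooth_on S F" for F :: "'a \<Rightarrow> 'b" and y w
    using FD_I[OF has_derivative_inner_left[OF smooth_on_has_derivative[OF that(2,1)]]] by metis
  have "FD (\<lambda>y. FD f y u) x v \<bullet> b = FD (\<lambda>y. FD (\<lambda>y. f y \<bullet> b) y u) x v" for u v
    using *[OF assms(3) smooth_on_FD[OF assms(2)]] FD_cong[OF assms(1,3), of "\<lambda>y. FD (\<lambda>y. f y \<bullet> b) y u" "\<lambda>y. FD f y u \<bullet> b"]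
      *[OF _ assms(2)] by simp
  then show "FD (\<lambda>y. FD f y u) x v \<bullet> b = FD (\<lambda>y. FD f y v) x u \<bullet> b"
    using FD_commute_real[OF assms(1) smooth_on_inner_left[OF assms(1,2)] assms(3)] by simp
qed

section \<open>Smooth dependence of the solution of a linear system on a parameter\<close>

text \<open>Where \<open>G\<close> vanishes, continuity of the other factor is enough for the
  product to be differentiable. This breaks the circle in differentiating an implicitly given
  solution, which at that stage is only known to be continuous.\<close>

lemma has_derivative_mult_vanishing:
  fixes f :: "'a::real_normed_vector \<Rightarrow> real" and G :: "'a \<Rightarrow> 'b::real_normed_vector"
  assumes "continuous (at x) f" "(G has_derivative G') (at x)" "G x = 0"
  shows "((\<lambda>y. f y *\<^sub>R G y) has_derivative (\<lambda>v. f x *\<^sub>R G' v)) (at x)"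
proof -
  have bl: "bounded_linear G'" using assms(2) has_derivative_bounded_linear by blast
  have lin: "(\<lambda>h. norm (G (x + h) - G x - G' h) / norm h) \<midarrow>0\<rightarrow> 0"
    using assms(2) by (simp add: has_derivative_at)
  obtain K where K: "\<And>h. norm (G' h) \<le> norm h * K" "K > 0"
    using bounded_linear.pos_bounded[OF bl] by blast
  have f0: "(\<lambda>h. f (x + h)) \<midarrow>0\<rightarrow> f x"
    using assms(1) by (simp add: continuous_at LIM_offset_zero_iff)
  have "(\<lambda>h. \<bar>f (x + h)\<bar> * (norm (G (x + h) - G x - G' h) / norm h) + \<bar>f (x + h) - f x\<bar> * K) \<midarrow>0\<rightarrow> \<bar>f x\<bar> * 0 + \<bar>f x - f x\<bar> * K"
    by (intro tendsto_intros f0 lin)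
  then have lim: "(\<lambda>h. \<bar>f (x + h)\<bar> * (norm (G (x + h) - G x - G' h) / norm h) + \<bar>f (x + h) - f x\<bar> * K) \<midarrow>0\<rightarrow> 0"
    by simp
  have "norm (f (x + h) *\<^sub>R G (x + h) - f x *\<^sub>R G x - f x *\<^sub>R G' h) / norm h
     \<le> \<bar>f (x + h)\<bar> * (norm (G (x + h) - G x - G' h) / norm h) + \<bar>f (x + h) - f x\<bar> * K" if "h \<noteq> 0" for h
  proof -
    have "f (x + h) *\<^sub>R G (x + h) - f x *\<^sub>R G x - f x *\<^sub>R G' h
        = f (x + h) *\<^sub>R (G (x + h) - G x - G' h) + (f (x + h) - f x) *\<^sub>R G' h"
      using assms(3) by (simp add: algebra_simps)
    then have "norm (f (x + h) *\<^sub>R G (x + h) - f x *\<^sub>R G x - f x *\<^sub>R G' h)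
        \<le> \<bar>f (x + h)\<bar> * norm (G (x + h) - G x - G' h) + \<bar>f (x + h) - f x\<bar> * norm (G' h)"
      using norm_triangle_ineq[of "f (x + h) *\<^sub>R (G (x + h) - G x - G' h)" "(f (x + h) - f x) *\<^sub>R G' h"]
      by (simp del: scaleR_right_diff_distrib)
    also have "\<dots> \<le> \<bar>f (x + h)\<bar> * norm (G (x + h) - G x - G' h) + \<bar>f (x + h) - f x\<bar> * (norm h * K)"
      using K by (intro add_left_mono mult_left_mono) auto
    finally show ?thesis using that by (simp add: field_simps)
  qed
  then have ev: "\<forall>\<^sub>F h in at 0. norm (norm (f (x + h) *\<^sub>R G (x + h) - f x *\<^sub>R G x - f x *\<^sub>R G' h) / norm h)
     \<le> \<bar>f (x + h)\<bar> * (norm (G (x + h) - G x - G' h) / norm h) + \<bar>f (x + h) - f x\<bar> * K"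
    by (auto simp: eventually_at_filter)
  have "(\<lambda>h. norm (f (x + h) *\<^sub>R G (x + h) - f x *\<^sub>R G x - f x *\<^sub>R G' h) / norm h) \<midarrow>0\<rightarrow> 0"
    by (rule Lim_null_comparison[OF ev lim])
  then show ?thesis
    using bounded_linear_compose[OF bounded_linear_scaleR_right bl]
    by (simp add: has_derivative_at o_def)
qed

text \<open>Write \<open>L y\<close> as \<open>L x\<close> plus a remainder and apply a left inverse
  \<open>M\<close> of \<open>L x\<close>. The inverse is frozen at \<open>x\<close>, so only the
  remainder depends on \<open>y\<close>, and it vanishes at \<open>y = x\<close>.\<close>

lemma linear_solution_split:
  fixes L :: "'a::real_normed_vector \<Rightarrow> 'b::euclidean_space \<Rightarrow> 'b"
  assumes "linear (L x)" "linear (L y)" "linear M" "M \<circ> L x = id" "L y w = k"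
  shows "w = M (k - (\<Sum>i\<in>Basis. (w \<bullet> i) *\<^sub>R (L y i - L x i)))"
proof -
  have "(\<Sum>i\<in>Basis. (w \<bullet> i) *\<^sub>R (L y i - L x i)) = L y w - L x w"
    using linear_basis_expand[OF assms(2), of w] linear_basis_expand[OF assms(1), of w]
    by (simp add: scaleR_diff_right sum_subtractf)
  moreover have "M (L x w) = w" using assms(4) by (metis comp_apply id_apply)
  ultimately show ?thesis using assms(5) by simp
qed

text \<open>In the split equation the unknown \<open>w y\<close> occurs on the right with a factor
  that tends to 0. First it is absorbed, which bounds \<open>w\<close> near \<open>x\<close>; then
  the whole remainder tends to 0.\<close>

lemma linear_solution_continuous:
  fixes L :: "'a::real_normed_vector \<Rightarrow> 'b::euclidean_space \<Rightarrow> 'b"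
  assumes "open U" "x \<in> U" "\<And>y. y \<in> U \<Longrightarrow> linear (L y)" "inj (L x)"
    and "\<And>b. continuous (at x) (\<lambda>y. L y b)" "continuous (at x) \<kappa>"
    and "\<And>y. y \<in> U \<Longrightarrow> L y (w y) = \<kappa> y"
  shows "continuous (at x) w"
proof -
  have linx: "linear (L x)" using assms(2,3) by blast
  obtain M where M: "linear M" "M \<circ> L x = id"
    using linear_injective_left_inverse[OF linx assms(4)] by blast
  have blM: "bounded_linear M" using M(1) linear_conv_bounded_linear by blast
  have eq: "w y = M (\<kappa> y - (\<Sum>i\<in>Basis. (w y \<bullet> i) *\<^sub>R (L y i - L x i)))" if "y \<in> U" for y
    using linear_solution_split[where L=L, OF linx assms(3)[OF that] M assms(7)[OF that]] .
  have evU: "\<forall>\<^sub>F y in at x. y \<in> U" using assms(1,2) eventually_at_topological by blast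
  have tL: "((\<lambda>y. L y i - L x i) \<longlongrightarrow> 0) (at x)" for i
    using assms(5)[of i] by (simp add: continuous_within LIM_zero)
  have t\<kappa>: "(\<kappa> \<longlongrightarrow> \<kappa> x) (at x)"
    using assms(6) by (simp add: continuous_within)
  obtain B where B: "\<And>b. norm (M b) \<le> norm b * B" "B > 0"
    using bounded_linear.pos_bounded[OF blM] by blast
  define e where "e y = (\<Sum>i\<in>Basis. norm (L y i - L x i))" for y
  have te: "(e \<longlongrightarrow> 0) (at x)"
  proof -
    have "(e \<longlongrightarrow> (\<Sum>i\<in>(Basis::'b set). norm (0::'b))) (at x)"
      unfolding e_def by (intro tendsto_intros tL)
    then show ?thesis by simp
  qed
  have S: "norm (\<Sum>i\<in>Basis. (w y \<bullet> i) *\<^sub>R (L y i - L x i)) \<le> norm (w y) * e y" for y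
  proof -
    have "norm (\<Sum>i\<in>Basis. (w y \<bullet> i) *\<^sub>R (L y i - L x i)) \<le> (\<Sum>i\<in>Basis. norm (w y) * norm (L y i - L x i))"
      by (rule sum_norm_le) (auto intro!: mult_right_mono Basis_le_norm)
    then show ?thesis by (simp add: e_def sum_distrib_left)
  qed
  \<comment> \<open>As soon as \<open>e y * B\<close> is below 1/2, half of
    \<open>norm (w y)\<close> can be moved to the left, which gives the factor 2.\<close>
  have bnd: "\<forall>\<^sub>F y in at x. norm (w y) \<le> 2 * (norm (\<kappa> y) * B)"
  proof -
    have "\<forall>\<^sub>F y in at x. e y < 1 / (2 * B)"
      using order_tendstoD(2)[OF te] B(2) by simp
    then show ?thesis using evU
    proof eventually_elim
      case (elim y)
      have "norm (w y) \<le> norm (\<kappa> y - (\<Sum>i\<in>Basis. (w y \<bullet> i) *\<^sub>R (L y i - L x i))) * B"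
        by (subst (1) eq[OF elim(2)]) (rule B(1))
      also have "\<dots> \<le> (norm (\<kappa> y) + norm (w y) * e y) * B"
        using norm_triangle_ineq4[of "\<kappa> y" "\<Sum>i\<in>Basis. (w y \<bullet> i) *\<^sub>R (L y i - L x i)"] S[of y] B(2)
        by (intro mult_right_mono) linarith+
      also have "\<dots> = norm (\<kappa> y) * B + norm (w y) * (e y * B)"
        by (simp add: algebra_simps)
      also have "\<dots> \<le> norm (\<kappa> y) * B + norm (w y) * (1 / 2)"
        using elim(1) B(2) by (intro add_left_mono mult_left_mono) (auto simp: field_simps)
      finally show ?case by simp
    qed
  qed
  have "\<forall>\<^sub>F y in at x. norm (\<Sum>i\<in>Basis. (w y \<bullet> i) *\<^sub>R (L y i - L x i)) \<le> (2 * (norm (\<kappa> y) * B)) * e y"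
    using bnd
  proof eventually_elim
    case (elim y)
    have "0 \<le> e y" by (simp add: e_def sum_nonneg)
    from mult_right_mono[OF elim this] show ?case using S[of y] by linarith
  qed
  moreover have "((\<lambda>y. (2 * (norm (\<kappa> y) * B)) * e y) \<longlongrightarrow> 0) (at x)"
  proof -
    have "((\<lambda>y. (2 * (norm (\<kappa> y) * B)) * e y) \<longlongrightarrow> (2 * (norm (\<kappa> x) * B)) * 0) (at x)"
      by (intro tendsto_intros t\<kappa> te)
    then show ?thesis by simp
  qed
  ultimately have "((\<lambda>y. \<Sum>i\<in>Basis. (w y \<bullet> i) *\<^sub>R (L y i - L x i)) \<longlongrightarrow> 0) (at x)"
    by (rule Lim_null_comparison)
  then have "((\<lambda>y. M (\<kappa> y - (\<Sum>i\<in>Basis. (w y \<bullet> i) *\<^sub>R (L y i - L x i)))) \<longlongrightarrow> M (\<kappa> x - 0)) (at x)"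
    by (intro bounded_linear.tendsto[OF blM] tendsto_diff t\<kappa>)
  moreover have "\<forall>\<^sub>F y in at x. M (\<kappa> y - (\<Sum>i\<in>Basis. (w y \<bullet> i) *\<^sub>R (L y i - L x i))) = w y"
    using evU by (rule eventually_mono) (rule eq[symmetric])
  ultimately have "(w \<longlongrightarrow> M (\<kappa> x - 0)) (at x)"
    by (rule Lim_transform_eventually)
  moreover have "M (\<kappa> x - 0) = w x"
    using assms(7)[OF assms(2)] M(2) by (metis comp_apply id_apply diff_zero)
  ultimately show ?thesis by (simp add: continuous_within)
qed

text \<open>In the split equation \<open>w\<close> is multiplied by \<open>L y i - L x i\<close>,
  which vanishes at \<open>x\<close>. Hence \<open>has_derivative_mult_vanishing\<close> makes the
  right-hand side differentiable from the continuity of \<open>w\<close> alone.\<close>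

lemma linear_solution_differentiable:
  fixes L :: "'a::real_normed_vector \<Rightarrow> 'b::euclidean_space \<Rightarrow> 'b"
  assumes "open U" "x \<in> U" "\<And>y. y \<in> U \<Longrightarrow> linear (L y)" "inj (L x)"
    and "\<And>b. (\<lambda>y. L y b) differentiable (at x)" "\<kappa> differentiable (at x)"
    and "\<And>y. y \<in> U \<Longrightarrow> L y (w y) = \<kappa> y"
  shows "w differentiable (at x)"
proof -
  have linx: "linear (L x)" using assms(2,3) by blast
  obtain M where M: "linear M" "M \<circ> L x = id"
    using linear_injective_left_inverse[OF linx assms(4)] by blast
  have blM: "bounded_linear M" using M(1) linear_conv_bounded_linear by blast
  have eq: "w y = M (\<kappa> y - (\<Sum>i\<in>Basis. (w y \<bullet> i) *\<^sub>R (L y i - L x i)))" if "y \<in> U" for y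
    using linear_solution_split[where L=L, OF linx assms(3)[OF that] M assms(7)[OF that]] .
  have cont: "continuous (at x) w"
    by (rule linear_solution_continuous[where L=L and \<kappa>=\<kappa>, OF assms(1-4) _ _ assms(7)])
       (assumption | rule differentiable_imp_continuous_within[OF assms(5)] differentiable_imp_continuous_within[OF assms(6)])+
  have "((\<lambda>y. L y i - L x i) has_derivative FD (\<lambda>y. L y i) x) (at x)" for i
  proof -
    have "((\<lambda>y. L y i) has_derivative FD (\<lambda>y. L y i) x) (at x)"
      using assms(5) by (simp add: frechet_derivative_works[symmetric])
    from has_derivative_diff[OF this has_derivative_const, of "L x i"] show ?thesis by simp
  qed
  then have "((\<lambda>y. (w y \<bullet> i) *\<^sub>R (L y i - L x i)) has_derivative (\<lambda>v. (w x \<bullet> i) *\<^sub>R FD (\<lambda>y. L y i) x v)) (at x)" for i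
    by (intro has_derivative_mult_vanishing continuous_intros cont) auto
  moreover have "(\<kappa> has_derivative FD \<kappa> x) (at x)"
    using assms(6) by (simp add: frechet_derivative_works[symmetric])
  ultimately have "((\<lambda>y. M (\<kappa> y - (\<Sum>i\<in>Basis. (w y \<bullet> i) *\<^sub>R (L y i - L x i)))) has_derivative
      (\<lambda>v. M (FD \<kappa> x v - (\<Sum>i\<in>Basis. (w x \<bullet> i) *\<^sub>R FD (\<lambda>y. L y i) x v)))) (at x)"
    by (intro bounded_linear.has_derivative[OF blM] has_derivative_diff has_derivative_sum) auto
  then have "(w has_derivative (\<lambda>v. M (FD \<kappa> x v - (\<Sum>i\<in>Basis. (w x \<bullet> i) *\<^sub>R FD (\<lambda>y. L y i) x v)))) (at x)"
    by (rule has_derivative_transform_within_open[OF _ assms(1,2)]) (rule eq[symmetric])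
  then show ?thesis by (rule differentiableI)
qed

text \<open>Differentiating \<open>L\<^sub>y (w y) = \<kappa> y\<close> shows that the derivative of \<open>w\<close> solves a system with the same \<open>L\<close>.\<close>

lemma smooth_on_linear_solution:
  fixes L :: "'a::real_normed_vector \<Rightarrow> 'b::euclidean_space \<Rightarrow> 'b"
  assumes "open U" "\<And>y. y \<in> U \<Longrightarrow> linear (L y)" "\<And>y. y \<in> U \<Longrightarrow> inj (L y)"
    and "\<And>b. smooth_on U (\<lambda>y. L y b)" "smooth_on U \<kappa>"
    and "\<And>y. y \<in> U \<Longrightarrow> L y (w y) = \<kappa> y"
  shows "smooth_on U w"
proof -
  have "Ck_on n U w"
    if "Ck_on n U \<kappa>" "\<And>y. y \<in> U \<Longrightarrow> L y (w y) = \<kappa> y" for n \<kappa> w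
    using that
  proof (induction n arbitrary: \<kappa> w)
    case 0
    have "continuous (at x) w" if x: "x \<in> U" for x
    proof (rule linear_solution_continuous[where L=L and \<kappa>=\<kappa>, OF assms(1) x assms(2) assms(3)[OF x] _ _ 0(2)])
      show "continuous (at x) (\<lambda>y. L y b)" for b
        using smooth_on_differentiable[OF assms(4) x] by (rule differentiable_imp_continuous_within)
      show "continuous (at x) \<kappa>"
        using 0(1) x assms(1) by (simp add: continuous_on_eq_continuous_at)
    qed
    then show ?case by (auto intro: continuous_at_imp_continuous_on)
  next
    case (Suc n)
    have w: "Ck_on n U w" using Suc.IH[OF Ck_on_SucD[OF Suc.prems(1)] Suc.prems(2)] .
    have diff: "w differentiable (at x)" if x: "x \<in> U" for x
    proof (rule linear_solution_differentiable[where L=L and \<kappa>=\<kappa>, OF assms(1) x assms(2) assms(3)[OF x] _ _ Suc.prems(2)])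
      show "(\<lambda>y. L y b) differentiable (at x)" for b using smooth_on_differentiable[OF assms(4) x] .
      show "\<kappa> differentiable (at x)" using Suc.prems(1) x by simp
    qed
    have "Ck_on n U (\<lambda>y. FD w y v)" for v
    proof (rule Suc.IH)
      let ?k = "\<lambda>y. FD \<kappa> y v + - (\<Sum>i\<in>Basis. (w y \<bullet> i) *\<^sub>R FD (\<lambda>y. L y i) y v)"
      have "Ck_on n U (\<lambda>y. FD (\<lambda>y. L y i) y v)" for i
        using smooth_on_FD[OF assms(4)] by (simp add: smooth_on_def)
      then show "Ck_on n U ?k"
        using Suc.prems(1) w
        by (intro Ck_on_add Ck_on_sum Ck_on_bounded_linear[OF _ bounded_linear_minus[OF bounded_linear_ident]]
              Ck_on_bounded_bilinear[OF _ bounded_bilinear_scaleR] Ck_on_bounded_linear[OF _ bounded_linear_inner_left] assms(1)) auto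
      show "L x (FD w x v) = ?k x" if x: "x \<in> U" for x
      proof -
        have dw: "(w has_derivative FD w x) (at x)"
          using diff[OF x] frechet_derivative_works by blast
        have "((\<lambda>y. \<Sum>i\<in>Basis. (w y \<bullet> i) *\<^sub>R L y i) has_derivative
           (\<lambda>v. \<Sum>i\<in>Basis. (w x \<bullet> i) *\<^sub>R FD (\<lambda>y. L y i) x v + (FD w x v \<bullet> i) *\<^sub>R L x i)) (at x)"
          by (intro has_derivative_sum has_derivative_scaleR has_derivative_inner_left dw
                smooth_on_has_derivative[OF assms(4) x])
        then have "(\<kappa> has_derivative
           (\<lambda>v. \<Sum>i\<in>Basis. (w x \<bullet> i) *\<^sub>R FD (\<lambda>y. L y i) x v + (FD w x v \<bullet> i) *\<^sub>R L x i)) (at x)"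
          by (rule has_derivative_transform_within_open[OF _ assms(1) x])
             (simp only: linear_basis_expand[OF assms(2), symmetric] Suc.prems(2))
        from FD_I[OF this] have "FD \<kappa> x v = (\<Sum>i\<in>Basis. (w x \<bullet> i) *\<^sub>R FD (\<lambda>y. L y i) x v) + L x (FD w x v)"
          using linear_basis_expand[OF assms(2)[OF x], of "FD w x v"] by (simp add: sum.distrib)
        then show ?thesis by simp
      qed
    qed
    then show ?case using diff by simp
  qed
  then show ?thesis using assms(5,6) unfolding smooth_on_def by blast
qed

section \<open>Iterated derivatives of curves\<close>

lemma vderiv_0 [simp]: "vderiv 0 f = f"
  by (simp add: vderiv_def)

lemma vderiv_Suc: "vderiv (Suc n) f t = vector_derivative (vderiv n f) (at t)"
  by (simp add: vderiv_def)

lemma vderiv_Suc_inner: "vderiv (Suc n) f = vderiv n (vderiv 1 f)"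
  unfolding vderiv_def by (simp add: funpow_Suc_right del: funpow.simps(2))

lemma vector_derivative_cong_open:
  assumes "open S" "t \<in> S" "\<And>s. s \<in> S \<Longrightarrow> f s = g s"
  shows "vector_derivative f (at t) = vector_derivative g (at t)"
  using assms by (intro vector_derivative_cong_eq) (auto simp: eventually_nhds)

lemma vderiv_cong:
  assumes "open S" "t \<in> S" "\<And>s. s \<in> S \<Longrightarrow> f s = g s"
  shows "vderiv n f t = vderiv n g t"
  using assms(2)
proof (induction n arbitrary: t)
  case (Suc n)
  then show ?case unfolding vderiv_Suc by (intro vector_derivative_cong_open[OF assms(1)]) auto
qed (simp add: assms(3))

lemma has_vector_derivative_shift_iff:
  "((\<lambda>s. f (a + s)) has_vector_derivative D) (at s) \<longleftrightarrow> (f has_vector_derivative D) (at (a + s))"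
proof -
  have *: "((\<lambda>s. f (a + s)) has_vector_derivative D) (at s)"
    if "(f has_vector_derivative D) (at (a + s))" for f :: "real \<Rightarrow> 'a" and a s
  proof -
    have "((\<lambda>s. a + s) has_vector_derivative 1) (at s)"
      by (auto intro!: derivative_eq_intros)
    from vector_diff_chain_at[OF this that] show ?thesis by (simp add: o_def)
  qed
  from *[of "\<lambda>s. f (a + s)" "- a" "a + s"] *[of f a s] show ?thesis by auto
qed

lemma vector_derivative_shift:
  "vector_derivative (\<lambda>s. f (a + s)) (at s) = vector_derivative f (at (a + s))"
  by (simp add: vector_derivative_def has_vector_derivative_shift_iff)

lemma vderiv_shift: "vderiv n (\<lambda>s. f (a + s)) s = vderiv n f (a + s)"
proof (induction n arbitrary: s)
  case (Suc n)
  have "vderiv n (\<lambda>s. f (a + s)) = (\<lambda>s. vderiv n f (a + s))" using Suc by auto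
  then show ?case by (simp add: vderiv_Suc vector_derivative_shift)
qed simp

lemma smooth_on_vector_derivative:
  assumes "open N" "smooth_on N x"
  shows "smooth_on N (\<lambda>t. vector_derivative x (at t))"
  by (rule smooth_on_cong[OF assms(1) _ smooth_on_FD[OF assms(2), of 1]])
     (use smooth_on_differentiable[OF assms(2)] frechet_derivative_eq_vector_derivative in fastforce)

lemma smooth_on_vderiv:
  assumes "open N" "smooth_on N x"
  shows "smooth_on N (vderiv n x)"
  by (induction n) (use smooth_on_vector_derivative assms in \<open>auto simp: vderiv_def\<close>)

lemma has_vector_derivative_smooth:
  assumes "smooth_on N x" "t \<in> N"
  shows "(x has_vector_derivative vderiv 1 x t) (at t)"
  using smooth_on_differentiable[OF assms] vector_derivative_works by (auto simp: vderiv_def)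

lemma has_vector_derivative_vderiv:
  assumes "open N" "smooth_on N x" "t \<in> N"
  shows "(vderiv n x has_vector_derivative vderiv (Suc n) x t) (at t)"
  using has_vector_derivative_smooth[OF smooth_on_vderiv[OF assms(1,2)] assms(3)] by (simp add: vderiv_def)

lemma vderiv_sum:
  assumes "open N" "t \<in> N" "\<And>i. i \<in> I \<Longrightarrow> smooth_on N (f i)"
  shows "vderiv n (\<lambda>t. \<Sum>i\<in>I. f i t) t = (\<Sum>i\<in>I. vderiv n (f i) t)"
  using assms(2)
proof (induction n arbitrary: t)
  case (Suc n)
  have "((\<lambda>t. \<Sum>i\<in>I. vderiv n (f i) t) has_vector_derivative (\<Sum>i\<in>I. vderiv (Suc n) (f i) t)) (at t)"
    by (intro has_vector_derivative_sum has_vector_derivative_vderiv[OF assms(1)] assms(3) Suc.prems)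
  then show ?case
    unfolding vderiv_Suc[of n "\<lambda>t. \<Sum>i\<in>I. f i t"]
    using vector_derivative_cong_open[OF assms(1) Suc.prems, of "vderiv n (\<lambda>t. \<Sum>i\<in>I. f i t)"] Suc.IH
    by (simp add: vector_derivative_at)
qed simp

text \<open>Division by the factorial makes this family closed under differentiation, and at 0 only
  \<open>n = m\<close> survives. This lets \<open>poly_curve\<close> realise prescribed
  derivatives.\<close>

lemma vderiv_monomial:
  "vderiv n (\<lambda>t. (t ^ m / fact m) *\<^sub>R b) = (\<lambda>t. if n \<le> m then (t ^ (m - n) / fact (m - n)) *\<^sub>R b else 0)"
proof (induction n)
  case (Suc n)
  have "vderiv (Suc n) (\<lambda>t. (t ^ m / fact m) *\<^sub>R b) t = (if Suc n \<le> m then (t ^ (m - Suc n) / fact (m - Suc n)) *\<^sub>R b else 0)" for t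
  proof (cases "Suc n \<le> m")
    case True
    then obtain j where j: "m - n = Suc j" by (metis Suc_diff_Suc Suc_le_eq)
    have "((\<lambda>t. (t ^ Suc j / fact (Suc j)) *\<^sub>R b) has_vector_derivative (t ^ j / fact j) *\<^sub>R b) (at t)"
    proof -
      have "((\<lambda>t::real. t ^ Suc j / fact (Suc j)) has_real_derivative (real (Suc j) * t ^ j) / fact (Suc j)) (at t)"
        by (rule DERIV_cdivide DERIV_power[THEN DERIV_cong] DERIV_ident)+ (simp del: of_nat_Suc)
      also have "real (Suc j) * t ^ j / fact (Suc j) = t ^ j / fact j"
        by (simp add: field_simps del: of_nat_Suc)
      finally have "((\<lambda>t::real. t ^ Suc j / fact (Suc j)) has_real_derivative t ^ j / fact j) (at t)" .
      from has_vector_derivative_scaleR[OF this has_vector_derivative_const[of b]] show ?thesis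
        by (simp del: power_Suc fact_Suc)
    qed
    moreover have "m - Suc n = j" using j by simp
    ultimately show ?thesis using True j unfolding vderiv_Suc Suc by (simp only: le_SucI Suc_leD if_True vector_derivative_at)
  next
    case False
    then show ?thesis unfolding vderiv_Suc Suc by (cases "n = m") auto
  qed
  then show ?case by blast
qed auto

section \<open>The Levi-Civita connection in coordinates\<close>

text \<open>The conditions in \<open>christoffel\<close>, freed from charts and manifolds, so that
  one theory serves the coefficients of the metric on \<open>M\<close> and those of the Sasaki
  metric.\<close>

definition is_lc :: "('a::real_normed_vector \<Rightarrow> 'a \<Rightarrow> 'a \<Rightarrow> real) \<Rightarrow> 'a \<Rightarrow> ('a \<Rightarrow> 'a \<Rightarrow> 'a) \<Rightarrow> bool" where
  "is_lc h x \<Gamma> \<longleftrightarrow> bilinear \<Gamma> \<and> (\<forall>a b. \<Gamma> a b = \<Gamma> b a) \<and>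
     (\<forall>u a b. FD (\<lambda>y. h y a b) x u = h x (\<Gamma> u a) b + h x a (\<Gamma> u b))"

definition levi_civita :: "('a::real_normed_vector \<Rightarrow> 'a \<Rightarrow> 'a \<Rightarrow> real) \<Rightarrow> 'a \<Rightarrow> 'a \<Rightarrow> 'a \<Rightarrow> 'a" where
  "levi_civita h x = (THE \<Gamma>. is_lc h x \<Gamma>)"

definition inner_coeff :: "('a::real_vector \<Rightarrow> 'a \<Rightarrow> real) \<Rightarrow> bool" where
  "inner_coeff h \<longleftrightarrow> bilinear h \<and> (\<forall>a b. h a b = h b a) \<and> (\<forall>a. a \<noteq> 0 \<longrightarrow> h a a > 0)"

lemma inner_coeffD:
  assumes "inner_coeff h"
  shows "bilinear h" "h a b = h b a" "a \<noteq> 0 \<Longrightarrow> h a a > 0"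
    "h (a + b) c = h a c + h b c" "h a (b + c) = h a b + h a c" "h (r *\<^sub>R a) c = r * h a c" "h a (r *\<^sub>R c) = r * h a c"
    "h (a - b) c = h a c - h b c" "h a (b - c) = h a b - h a c" "h 0 c = 0" "h a 0 = 0"
proof -
  have b: "bilinear h" using assms by (simp add: inner_coeff_def)
  show "bilinear h" "h a b = h b a" "a \<noteq> 0 \<Longrightarrow> h a a > 0" using assms by (auto simp: inner_coeff_def)
  show "h (a + b) c = h a c + h b c" "h a (b + c) = h a b + h a c" "h (r *\<^sub>R a) c = r * h a c" "h a (r *\<^sub>R c) = r * h a c"
    "h (a - b) c = h a c - h b c" "h a (b - c) = h a b - h a c" "h 0 c = 0" "h a 0 = 0"
    using b by (simp_all add: bilinear_ladd bilinear_radd bilinear_lmul bilinear_rmul bilinear_lsub bilinear_rsub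
        bilinear_lzero bilinear_rzero)
qed

lemma inner_coeff_nondegenerate:
  assumes "inner_coeff h" "\<And>c. h a c = h b c"
  shows "a = b"
proof (rule ccontr)
  assume "a \<noteq> b"
  then have "h (a - b) (a - b) > 0" using inner_coeffD(3)[OF assms(1), of "a - b"] by simp
  then show False using assms(2)[of "a - b"] by (simp add: inner_coeffD(8)[OF assms(1)])
qed

lemma is_lc_cong:
  assumes "open U" "x \<in> U" "\<And>y a b. y \<in> U \<Longrightarrow> h y a b = h' y a b"
  shows "is_lc h x = is_lc h' x"
proof -
  have "FD (\<lambda>y. h y a b) x = FD (\<lambda>y. h' y a b) x" for a b
    by (rule FD_cong[OF assms(1,2)]) (rule assms(3))
  then show ?thesis using assms(2,3) by (simp add: is_lc_def fun_eq_iff)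
qed

text \<open>The Christoffel symbol of the first kind.\<close>

definition koszul :: "('a::real_normed_vector \<Rightarrow> 'a \<Rightarrow> 'a \<Rightarrow> real) \<Rightarrow> 'a \<Rightarrow> 'a \<Rightarrow> 'a \<Rightarrow> 'a \<Rightarrow> real" where
  "koszul h x a b c = (FD (\<lambda>y. h y b c) x a + FD (\<lambda>y. h y a c) x b - FD (\<lambda>y. h y a b) x c) / 2"

lemma koszul_half:
  "koszul h x a b c = (1 / 2) *\<^sub>R (FD (\<lambda>y. h y b c) x a + FD (\<lambda>y. h y a c) x b - FD (\<lambda>y. h y a b) x c)"
  by (simp add: koszul_def)

text \<open>Each of the three derivatives splits by the metric condition into two terms. By the
  symmetry of \<open>\<Gamma>\<close> four of the six terms cancel in pairs and the other two
  coincide, which accounts for the division by 2.\<close>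

lemma is_lc_koszul:
  assumes "inner_coeff (h x)" "is_lc h x \<Gamma>"
  shows "h x (\<Gamma> a b) c = koszul h x a b c"
proof -
  have D: "FD (\<lambda>y. h y a b) x u = h x (\<Gamma> u a) b + h x a (\<Gamma> u b)" for u a b
    using assms(2) by (simp add: is_lc_def)
  have s: "\<Gamma> a b = \<Gamma> b a" for a b using assms(2) by (simp add: is_lc_def)
  show ?thesis
    unfolding koszul_def D
    using s[of c a] s[of c b] s[of b a] inner_coeffD(2)[OF assms(1)] by (simp add: field_simps)
qed

lemma is_lc_unique:
  assumes "inner_coeff (h x)" "is_lc h x \<Gamma>" "is_lc h x \<Gamma>'"
  shows "\<Gamma> = \<Gamma>'"
proof (intro ext)
  show "\<Gamma> a b = \<Gamma>' a b" for a b
    by (rule inner_coeff_nondegenerate[OF assms(1)])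
       (simp add: is_lc_koszul[OF assms(1,2)] is_lc_koszul[OF assms(1,3)])
qed

text \<open>The operator that represents \<open>h\<close> with respect to the Euclidean inner
  product, \<open>gram h w \<bullet> c = h w c\<close>. It turns the Koszul formula into a linear
  system for the vector \<open>\<Gamma> a b\<close>, from which both existence and smoothness are
  drawn.\<close>

definition gram :: "('a::euclidean_space \<Rightarrow> 'a \<Rightarrow> real) \<Rightarrow> 'a \<Rightarrow> 'a" where
  "gram h w = (\<Sum>i\<in>Basis. h w i *\<^sub>R i)"

lemma inner_sum_coeff:
  fixes f :: "'a::euclidean_space \<Rightarrow> real"
  assumes "linear f"
  shows "(\<Sum>i\<in>Basis. f i *\<^sub>R i) \<bullet> c = f c"
  using linear_basis_expand[OF assms, of c]
  by (simp add: inner_sum_left inner_commute[of c] mult.commute)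

lemma gram_inner: "inner_coeff h \<Longrightarrow> gram h w \<bullet> c = h w c"
  unfolding gram_def by (rule inner_sum_coeff) (simp add: inner_coeffD(1) bilinearD(1))

lemma linear_gram: "inner_coeff h \<Longrightarrow> linear (gram h)"
  by (rule linearI; rule euclidean_eqI) (simp_all add: gram_inner inner_add_left inner_coeffD)

lemma inj_gram:
  assumes "inner_coeff h"
  shows "inj (gram h)"
proof (rule injI)
  show "a = b" if "gram h a = gram h b" for a b
    using that gram_inner[OF assms] by (intro inner_coeff_nondegenerate[OF assms]) metis
qed

text \<open>The coefficients are bilinear and symmetric at every point of an open set, so the
  identities may be differentiated at \<open>x\<close>.\<close>

lemma metric_derivative:
  fixes h :: "'a::euclidean_space \<Rightarrow> 'a \<Rightarrow> 'a \<Rightarrow> real"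
  assumes "open U" "x \<in> U" "\<And>y. y \<in> U \<Longrightarrow> inner_coeff (h y)" "\<And>a b. (\<lambda>y. h y a b) differentiable (at x)"
  shows "linear (\<lambda>a. FD (\<lambda>y. h y a b) x u)" "linear (\<lambda>b. FD (\<lambda>y. h y a b) x u)" "linear (\<lambda>u. FD (\<lambda>y. h y a b) x u)"
    "FD (\<lambda>y. h y a b) x u = FD (\<lambda>y. h y b a) x u"
proof -
  note d = assms(4)[unfolded frechet_derivative_works]
  have sym: "FD (\<lambda>y. h y a b) x = FD (\<lambda>y. h y b a) x" for a b
    by (rule FD_cong[OF assms(1,2)]) (rule inner_coeffD(2)[OF assms(3)])
  have add: "FD (\<lambda>y. h y (a + a') b) x = (\<lambda>u. FD (\<lambda>y. h y a b) x u + FD (\<lambda>y. h y a' b) x u)" for a a' b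
    by (rule FD_I, rule has_derivative_transform_within_open[OF has_derivative_add[OF d d] assms(1,2)])
       (simp add: inner_coeffD(4)[OF assms(3)])
  have scale: "FD (\<lambda>y. h y (r *\<^sub>R a) b) x = (\<lambda>u. r * FD (\<lambda>y. h y a b) x u)" for r a b
    by (rule FD_I, rule has_derivative_transform_within_open[OF has_derivative_mult_right[OF d] assms(1,2)])
       (simp add: inner_coeffD(6)[OF assms(3)])
  show l: "linear (\<lambda>a. FD (\<lambda>y. h y a b) x u)" for b
    by (rule linearI) (simp_all add: add scale)
  show "linear (\<lambda>b. FD (\<lambda>y. h y a b) x u)"
    using l[of a] sym[of _ a] by simp
  show "linear (\<lambda>u. FD (\<lambda>y. h y a b) x u)"
    using linear_frechet_derivative[OF assms(4)] .
  show "FD (\<lambda>y. h y a b) x u = FD (\<lambda>y. h y b a) x u" using sym by metis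
qed

text \<open>\<open>V a b\<close> represents the Koszul form in the Euclidean inner product, and a
  right inverse of \<open>gram (h x)\<close> raises the index. The metric condition comes back
  because in the sum of \<open>koszul h x u a b\<close> and \<open>koszul h x u b a\<close>
  everything cancels except the derivative along \<open>u\<close>.\<close>

lemma is_lc_ex:
  fixes h :: "'a::euclidean_space \<Rightarrow> 'a \<Rightarrow> 'a \<Rightarrow> real"
  assumes "open U" "x \<in> U" "\<And>y. y \<in> U \<Longrightarrow> inner_coeff (h y)" "\<And>a b. (\<lambda>y. h y a b) differentiable (at x)"
  shows "\<exists>\<Gamma>. is_lc h x \<Gamma>"
proof -
  have md: "linear (\<lambda>a. FD (\<lambda>y. h y a b) x u)" "linear (\<lambda>b. FD (\<lambda>y. h y a b) x u)" "linear (\<lambda>u. FD (\<lambda>y. h y a b) x u)"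
    "FD (\<lambda>y. h y a b) x u = FD (\<lambda>y. h y b a) x u" for a b u
    by (rule metric_derivative[OF assms(1,2)], fact assms(3), fact assms(4))+
  note ic = inner_coeffD[OF assms(3)[OF assms(2)]]
  have half: "linear (\<lambda>v. (1 / 2) *\<^sub>R (f v + g v - k v))" if "linear f" "linear g" "linear k" for f g k :: "'a \<Rightarrow> real"
    using that by (intro linear_compose_scale_right linear_compose_add linear_compose_sub)
  have K1: "linear (\<lambda>c. koszul h x a b c)" for a b
    unfolding koszul_half by (rule half[OF md(2) md(2) md(3)])
  have K2: "linear (\<lambda>b. koszul h x a b c)" for a c
    unfolding koszul_half by (rule half[OF md(1) md(3) md(2)])
  have K3: "linear (\<lambda>a. koszul h x a b c)" for b c
    unfolding koszul_half by (rule half[OF md(3) md(1) md(1)])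
  note lg = linear_gram[OF assms(3)[OF assms(2)]]
  obtain M where M: "linear M" "gram (h x) \<circ> M = id"
    using linear_surjective_right_inverse[OF lg linear_injective_imp_surjective[OF lg inj_gram[OF assms(3)[OF assms(2)]]]]
    by blast
  define V where "V a b = (\<Sum>i\<in>Basis. koszul h x a b i *\<^sub>R i)" for a b
  have V: "V a b \<bullet> c = koszul h x a b c" for a b c
    unfolding V_def by (rule inner_sum_coeff[OF K1])
  have V1: "linear (\<lambda>b. V a b)" for a
    by (rule linearI; rule euclidean_eqI)
       (simp_all add: V inner_add_left linear_add[OF K2] linear_scale[OF K2])
  have V2: "linear (\<lambda>a. V a b)" for b
    by (rule linearI; rule euclidean_eqI)
       (simp_all add: V inner_add_left linear_add[OF K3] linear_scale[OF K3])
  have bM: "bilinear (\<lambda>a b. M (V a b))"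
    unfolding bilinear_def
    using linear_compose[OF V1 M(1)] linear_compose[OF V2 M(1)] by (simp add: o_def)
  have hM: "h x (M (V a b)) c = koszul h x a b c" for a b c
  proof -
    have "gram (h x) (M (V a b)) = V a b" using fun_cong[OF M(2)] by simp
    then show ?thesis using gram_inner[OF assms(3)[OF assms(2)], of "M (V a b)" c] V by simp
  qed
  have kc: "koszul h x a b c = koszul h x b a c" for a b c
    using md(4)[where a=a and b=b and u=c] unfolding koszul_def by simp
  have "is_lc h x (\<lambda>a b. M (V a b))"
    unfolding is_lc_def
  proof (intro conjI allI bM)
    have "V a b = V b a" for a b by (rule euclidean_eqI) (simp only: V kc[of a b])
    then show "M (V a b) = M (V b a)" for a b by simp
    show "FD (\<lambda>y. h y a b) x u = h x (M (V u a)) b + h x a (M (V u b))" for u a b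
    proof -
      have "h x (M (V u a)) b + h x a (M (V u b)) = koszul h x u a b + koszul h x u b a"
        by (simp only: ic(2)[of a "M (V u b)"] hM)
      also have "\<dots> = FD (\<lambda>y. h y a b) x u"
        unfolding koszul_def
        using md(4)[where a=b and b=a and u=u] md(4)[where a=u and b=a and u=b] md(4)[where a=u and b=b and u=a]
        by (simp add: field_simps)
      finally show ?thesis by simp
    qed
  qed
  then show ?thesis by blast
qed

lemma levi_civita_eq: "inner_coeff (h x) \<Longrightarrow> is_lc h x \<Gamma> \<Longrightarrow> levi_civita h x = \<Gamma>"
  unfolding levi_civita_def by (blast intro: is_lc_unique)

lemma is_lc_levi_civita:
  fixes h :: "'a::euclidean_space \<Rightarrow> 'a \<Rightarrow> 'a \<Rightarrow> real"
  assumes "open U" "x \<in> U" "\<And>y. y \<in> U \<Longrightarrow> inner_coeff (h y)" "\<And>a b. (\<lambda>y. h y a b) differentiable (at x)"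
  shows "is_lc h x (levi_civita h x)"
  using is_lc_ex[OF assms] levi_civita_eq[where h=h and x=x, OF assms(3)[OF assms(2)]] by metis

text \<open>For fixed \<open>a\<close> and \<open>b\<close> the vector solves a system with matrix
  \<open>gram (h y)\<close> and Koszul right-hand side, both smooth in \<open>y\<close>.\<close>

lemma smooth_on_levi_civita:
  fixes h :: "'a::euclidean_space \<Rightarrow> 'a \<Rightarrow> 'a \<Rightarrow> real"
  assumes "open U" "\<And>y. y \<in> U \<Longrightarrow> inner_coeff (h y)" "\<And>a b. smooth_on U (\<lambda>y. h y a b)"
  shows "smooth_on U (\<lambda>y. levi_civita h y a b)"
proof (rule smooth_on_linear_solution[OF assms(1), where L="\<lambda>y. gram (h y)" and \<kappa>="\<lambda>y. \<Sum>i\<in>Basis. koszul h y a b i *\<^sub>R i"])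
  show "linear (gram (h y))" "inj (gram (h y))" if "y \<in> U" for y
    using linear_gram inj_gram assms(2) that by auto
  show "smooth_on U (\<lambda>y. gram (h y) b)" for b
    unfolding gram_def by (intro smooth_on_sum smooth_on_bounded_linear[OF _ bounded_linear_scaleR_left] assms)
  have "smooth_on U (\<lambda>y. (1/2) *\<^sub>R (FD (\<lambda>y. h y b c) y a + FD (\<lambda>y. h y a c) y b - FD (\<lambda>y. h y a b) y c))" for c
    by (intro smooth_on_bounded_linear[OF _ bounded_linear_scaleR_right] smooth_on_add smooth_on_diff smooth_on_FD assms)
  then have "smooth_on U (\<lambda>y. koszul h y a b c)" for c
    by (simp add: koszul_half)
  then show "smooth_on U (\<lambda>y. \<Sum>i\<in>Basis. koszul h y a b i *\<^sub>R i)"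
    by (intro smooth_on_sum smooth_on_bounded_linear[OF _ bounded_linear_scaleR_left] assms)
  show "gram (h y) (levi_civita h y a b) = (\<Sum>i\<in>Basis. koszul h y a b i *\<^sub>R i)" if y: "y \<in> U" for y
    unfolding gram_def
    using is_lc_koszul[of h y, OF assms(2)[OF y] is_lc_levi_civita[OF assms(1) y assms(2) smooth_on_differentiable[OF assms(3) y]]]
    by simp
qed

text \<open>Read \<open>p\<close>, \<open>v\<close>, \<open>c\<close> as position, velocity and
  second derivative of a curve. The first two terms on the right are then the time derivative of the
  momentum paired with a constant \<open>z\<close>, and the last is the derivative of the kinetic
  energy along \<open>z\<close>. Through this identity the Sasaki metric can be treated without
  explicit Christoffel symbols.\<close>

lemma is_lc_euler_lagrange:
  assumes "inner_coeff (h p)" "is_lc h p \<Gamma>"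
  shows "h p (c + \<Gamma> v v) z = FD (\<lambda>y. h y v z) p v + h p c z - FD (\<lambda>y. h y v v) p z / 2"
  using assms(2) inner_coeffD(2)[OF assms(1), of v] unfolding is_lc_def
  by (simp add: inner_coeffD(4)[OF assms(1)])

text \<open>The transformation law follows from uniqueness: pulling \<open>\<Gamma>'\<close> back along \<open>\<phi>\<close> gives a connection
  that is symmetric and metric for \<open>h\<close>.\<close>

lemma levi_civita_transform:
  fixes h :: "'a::euclidean_space \<Rightarrow> 'a \<Rightarrow> 'a \<Rightarrow> real" and h' :: "'a \<Rightarrow> 'a \<Rightarrow> 'a \<Rightarrow> real"
  assumes U: "open U" "x \<in> U" "\<And>y. y \<in> U \<Longrightarrow> inner_coeff (h y)"
    and U': "open U'" "\<phi> ` U \<subseteq> U'" "\<And>y. y \<in> U' \<Longrightarrow> inner_coeff (h' y)" "\<And>a b. smooth_on U' (\<lambda>y. h' y a b)"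
    and \<phi>: "smooth_on U \<phi>" "\<And>y a b. y \<in> U \<Longrightarrow> h y a b = h' (\<phi> y) (FD \<phi> y a) (FD \<phi> y b)"
  shows "FD \<phi> x (levi_civita h x a b) =
    levi_civita h' (\<phi> x) (FD \<phi> x a) (FD \<phi> x b) + FD (\<lambda>y. FD \<phi> y b) x a"
proof -
  have x': "\<phi> x \<in> U'" using U(2) U'(2) by auto
  note ic' = inner_coeffD[OF U'(3)[OF x']]
  have lin: "linear (FD \<phi> x)" using linear_frechet_derivative[OF smooth_on_differentiable[OF \<phi>(1) U(2)]] .
  \<comment> \<open>The pulled-back form is positive definite, so the differential has no kernel; as
    it maps a space to itself, it is also onto.\<close>
  have inj: "inj (FD \<phi> x)"
    unfolding linear_injective_0[OF lin]
  proof (intro allI impI)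
    fix a assume "FD \<phi> x a = 0"
    then have "h x a a = 0" using \<phi>(2)[OF U(2)] ic'(10) by simp
    then show "a = 0" using inner_coeffD(3)[OF U(3)[OF U(2)], of a] by (cases "a = 0") auto
  qed
  obtain M where M: "linear M" "FD \<phi> x \<circ> M = id"
    using linear_surjective_right_inverse[OF lin linear_injective_imp_surjective[OF lin inj]] by blast
  have M': "FD \<phi> x (M w) = w" for w using M(2) by (metis comp_apply id_apply)
  let ?G = "levi_civita h' (\<phi> x)"
  have lc': "is_lc h' (\<phi> x) ?G"
    using is_lc_levi_civita[OF U'(1) x' U'(3) smooth_on_differentiable[OF U'(4) x']] .
  then have bG: "bilinear ?G" and sG: "?G a b = ?G b a"
    and dG: "FD (\<lambda>y. h' y a b) (\<phi> x) u = h' (\<phi> x) (?G u a) b + h' (\<phi> x) a (?G u b)" for a b u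
    unfolding is_lc_def by blast+
  let ?D2 = "\<lambda>a b. FD (\<lambda>y. FD \<phi> y b) x a"
  \<comment> \<open>The right-hand side of the transformation law, to be carried back by
    \<open>M\<close>. Its second-derivative part is symmetric by \<open>FD_commute\<close>, so
    linearity has to be checked in one argument only.\<close>
  define V where "V a b = ?G (FD \<phi> x a) (FD \<phi> x b) + ?D2 a b" for a b
  have sV: "V a b = V b a" for a b
    unfolding V_def using sG[of "FD \<phi> x a"] FD_commute[OF U(1) \<phi>(1) U(2), of b a] by simp
  have lV: "linear (\<lambda>a. V a b)" for b
    unfolding V_def
    by (intro linear_compose_add linear_compose[OF lin bilinearD(2)[OF bG], unfolded o_def]
         linear_frechet_derivative smooth_on_differentiable[OF smooth_on_FD[OF \<phi>(1)] U(2)])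
  moreover have "linear (\<lambda>b. V a b)" for a
    using lV[of a] sV[of _ a] by simp
  ultimately have bM: "bilinear (\<lambda>a b. M (V a b))"
    unfolding bilinear_def using linear_compose[OF lV M(1)] linear_compose[OF _ M(1), of "V _"] by (simp add: o_def)
  have "is_lc h x (\<lambda>a b. M (V a b))"
    unfolding is_lc_def
  proof (intro conjI allI bM)
    show "M (V a b) = M (V b a)" for a b using sV by simp
    show "FD (\<lambda>y. h y a b) x u = h x (M (V u a)) b + h x a (M (V u b))" for u a b
    proof -
      have "((\<lambda>y. h' (\<phi> y) (FD \<phi> y a) (FD \<phi> y b)) has_derivative
        (\<lambda>w. FD (\<lambda>z. h' z (FD \<phi> x a) (FD \<phi> x b)) (\<phi> x) (FD \<phi> x w) + h' (\<phi> x) (?D2 w a) (FD \<phi> x b)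
          + h' (\<phi> x) (FD \<phi> x a) (?D2 w b))) (at x)"
        by (rule has_derivative_bilinear_apply[OF U(1,2) _ _ _ U'(1)])
           (use U'(2) in \<open>auto intro!: smooth_on_has_derivative[OF \<phi>(1) U(2)] smooth_on_has_derivative[OF smooth_on_FD[OF \<phi>(1)] U(2)]
              smooth_on_differentiable[OF U'(4) x'] inner_coeffD(1) U'(3)\<close>)
      then have "((\<lambda>y. h y a b) has_derivative
        (\<lambda>w. FD (\<lambda>z. h' z (FD \<phi> x a) (FD \<phi> x b)) (\<phi> x) (FD \<phi> x w) + h' (\<phi> x) (?D2 w a) (FD \<phi> x b)
          + h' (\<phi> x) (FD \<phi> x a) (?D2 w b))) (at x)"
        by (rule has_derivative_transform_within_open[OF _ U(1,2)]) (simp add: \<phi>(2))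
      from FD_I[OF this] show ?thesis
        by (simp add: dG \<phi>(2)[OF U(2)] M' V_def ic'(4,5))
    qed
  qed
  from levi_civita_eq[of h x, OF U(3)[OF U(2)] this] show ?thesis by (simp add: M' V_def)
qed

section \<open>Covariant derivative along a curve, in coordinates\<close>

definition covd :: "('a::real_normed_vector \<Rightarrow> 'a \<Rightarrow> 'a \<Rightarrow> 'a) \<Rightarrow> (real \<Rightarrow> 'a) \<Rightarrow> (real \<Rightarrow> 'a) \<Rightarrow> real \<Rightarrow> 'a" where
  "covd \<Gamma> x v t = vderiv 1 v t + \<Gamma> (x t) (vderiv 1 x t) (v t)"

lemma covd_cong:
  assumes "open N" "t \<in> N" "\<And>s. s \<in> N \<Longrightarrow> x s = x' s" "\<And>s. s \<in> N \<Longrightarrow> v s = v' s"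
  shows "covd \<Gamma> x v t = covd \<Gamma> x' v' t"
  unfolding covd_def using assms(2-) vderiv_cong[OF assms(1,2), of x x'] vderiv_cong[OF assms(1,2), of v v'] by simp

lemma covd_pow_cong:
  assumes "open N" "t \<in> N" "\<And>s. s \<in> N \<Longrightarrow> x s = x' s" "\<And>s. s \<in> N \<Longrightarrow> v s = v' s"
  shows "(covd \<Gamma> x ^^ n) v t = (covd \<Gamma> x' ^^ n) v' t"
  using assms(2)
proof (induction n arbitrary: t)
  case (Suc n)
  show ?case unfolding funpow.simps o_def
    by (rule covd_cong[OF assms(1) Suc.prems]) (auto intro: assms(3) Suc.IH)
qed (simp add: assms(4))

lemma smooth_on_covd:
  fixes \<Gamma> :: "'a::euclidean_space \<Rightarrow> 'a \<Rightarrow> 'a \<Rightarrow> 'a"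
  assumes "open U" "\<And>y. y \<in> U \<Longrightarrow> bilinear (\<Gamma> y)" "\<And>a b. smooth_on U (\<lambda>y. \<Gamma> y a b)"
    and "open N" "smooth_on N x" "x ` N \<subseteq> U" "smooth_on N v"
  shows "smooth_on N (covd \<Gamma> x v)"
proof -
  have "smooth_on N (\<lambda>t. vderiv 1 v t + \<Gamma> (x t) (vderiv 1 x t) (v t))"
    by (intro smooth_on_add smooth_on_bilinear_apply[OF assms(4,1,6,5) _ _ assms(2,3)] smooth_on_vderiv assms(4,5,7))
  then show ?thesis unfolding covd_def .
qed

lemma has_derivative_metric_curve:
  fixes h :: "'a::euclidean_space \<Rightarrow> 'a \<Rightarrow> 'a \<Rightarrow> real"
  assumes "open U" "\<And>y. y \<in> U \<Longrightarrow> inner_coeff (h y)" "\<And>a b. smooth_on U (\<lambda>y. h y a b)"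
    and "open N" "t \<in> N" "x ` N \<subseteq> U"
    and "(x has_vector_derivative x') (at t)" "(v has_vector_derivative v') (at t)" "(w has_vector_derivative w') (at t)"
  shows "((\<lambda>s. h (x s) (v s) (w s)) has_real_derivative
    FD (\<lambda>y. h y (v t) (w t)) (x t) x' + h (x t) v' (w t) + h (x t) (v t) w') (at t)"
proof -
  have xU: "x t \<in> U" using assms(5,6) by auto
  have "((\<lambda>s. h (x s) (v s) (w s)) has_derivative
    (\<lambda>r. FD (\<lambda>y. h y (v t) (w t)) (x t) (r *\<^sub>R x') + h (x t) (r *\<^sub>R v') (w t) + h (x t) (v t) (r *\<^sub>R w'))) (at t)"
    by (rule has_derivative_bilinear_apply[OF assms(4,5) _ _ _ assms(1)])
       (use assms(6-9) in \<open>auto simp: has_vector_derivative_def inner_coeffD(1)[OF assms(2)]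
          intro: smooth_on_differentiable[OF assms(3) xU]\<close>)
  then show ?thesis
    unfolding has_real_derivative_iff_has_vector_derivative has_vector_derivative_def
    by (simp add: inner_coeffD(6,7)[OF assms(2)[OF xU]] algebra_simps
        linear_scale[OF linear_frechet_derivative[OF smooth_on_differentiable[OF assms(3) xU]]])
qed

lemma has_derivative_metric_covd:
  fixes h :: "'a::euclidean_space \<Rightarrow> 'a \<Rightarrow> 'a \<Rightarrow> real"
  assumes "open U" "\<And>y. y \<in> U \<Longrightarrow> inner_coeff (h y)" "\<And>a b. smooth_on U (\<lambda>y. h y a b)"
    and "open N" "t \<in> N" "x ` N \<subseteq> U" "smooth_on N x" "smooth_on N v" "smooth_on N w"
  shows "((\<lambda>s. h (x s) (v s) (w s)) has_real_derivative
    h (x t) (covd (levi_civita h) x v t) (w t) + h (x t) (v t) (covd (levi_civita h) x w t)) (at t)"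
proof -
  have xU: "x t \<in> U" using assms(5,6) by auto
  have lc: "is_lc h (x t) (levi_civita h (x t))"
    using is_lc_levi_civita[OF assms(1) xU assms(2) smooth_on_differentiable[OF assms(3) xU]] .
  have "FD (\<lambda>y. h y (v t) (w t)) (x t) (vderiv 1 x t) + h (x t) (vderiv 1 v t) (w t) + h (x t) (v t) (vderiv 1 w t)
    = h (x t) (covd (levi_civita h) x v t) (w t) + h (x t) (v t) (covd (levi_civita h) x w t)"
    using lc unfolding is_lc_def covd_def by (simp add: inner_coeffD(4,5)[OF assms(2)[OF xU]])
  with has_derivative_metric_curve[OF assms(1-6) has_vector_derivative_smooth[OF assms(7,5)]
    has_vector_derivative_smooth[OF assms(8,5)] has_vector_derivative_smooth[OF assms(9,5)]]
  show ?thesis by simp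
qed

text \<open>Differentiating \<open>FD \<phi> (x s) (v s)\<close> produces a second derivative of
  \<open>\<phi>\<close>, which is exactly the inhomogeneous term in the transformation law of the
  Christoffel symbols.\<close>

lemma covd_transform:
  fixes \<phi> :: "'a::euclidean_space \<Rightarrow> 'a"
  assumes "open N" "t \<in> N" "smooth_on N x" "smooth_on N v" "x ` N \<subseteq> U" "smooth_on U \<phi>" "open U"
    and "\<And>a b. FD \<phi> (x t) (\<Gamma> (x t) a b) = \<Gamma>' (\<phi> (x t)) (FD \<phi> (x t) a) (FD \<phi> (x t) b) + FD (\<lambda>y. FD \<phi> y b) (x t) a"
  shows "covd \<Gamma>' (\<lambda>s. \<phi> (x s)) (\<lambda>s. FD \<phi> (x s) (v s)) t = FD \<phi> (x t) (covd \<Gamma> x v t)"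
proof -
  have xU: "x t \<in> U" using assms(2,5) by auto
  note x' = has_vector_derivative_smooth[OF assms(3,2)] and v' = has_vector_derivative_smooth[OF assms(4,2)]
  have "((\<lambda>s. \<phi> (x s)) has_vector_derivative FD \<phi> (x t) (vderiv 1 x t)) (at t)"
    using has_vector_derivative_FD[OF x' smooth_on_differentiable[OF assms(6) xU]] .
  then have 1: "vderiv 1 (\<lambda>s. \<phi> (x s)) t = FD \<phi> (x t) (vderiv 1 x t)"
    by (simp add: vderiv_def vector_derivative_at)
  note lin = linear_frechet_derivative[OF smooth_on_differentiable[OF assms(6)]]
  have "((\<lambda>s. \<Sum>b\<in>Basis. (v s \<bullet> b) *\<^sub>R FD \<phi> (x s) b) has_vector_derivative
     (\<Sum>b\<in>Basis. (v t \<bullet> b) *\<^sub>R FD (\<lambda>y. FD \<phi> y b) (x t) (vderiv 1 x t) + (vderiv 1 v t \<bullet> b) *\<^sub>R FD \<phi> (x t) b)) (at t)"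
  proof (intro has_vector_derivative_sum has_vector_derivative_scaleR)
    show "((\<lambda>s. v s \<bullet> b) has_real_derivative vderiv 1 v t \<bullet> b) (at t)" for b
      unfolding has_real_derivative_iff_has_vector_derivative
      using bounded_linear.has_vector_derivative[OF bounded_linear_inner_left v'] .
    show "((\<lambda>s. FD \<phi> (x s) b) has_vector_derivative FD (\<lambda>y. FD \<phi> y b) (x t) (vderiv 1 x t)) (at t)" for b
      using has_vector_derivative_FD[OF x' smooth_on_differentiable[OF smooth_on_FD[OF assms(6)] xU]] .
  qed
  then have "((\<lambda>s. FD \<phi> (x s) (v s)) has_vector_derivative
     (\<Sum>b\<in>Basis. (v t \<bullet> b) *\<^sub>R FD (\<lambda>y. FD \<phi> y b) (x t) (vderiv 1 x t) + (vderiv 1 v t \<bullet> b) *\<^sub>R FD \<phi> (x t) b)) (at t)"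
    by (rule has_vector_derivative_transform_within_open[OF _ assms(1,2)])
       (use assms(5) in \<open>auto simp: linear_basis_expand[OF lin, symmetric]\<close>)
  \<comment> \<open>By symmetry of second derivatives \<open>b\<close> can be moved into the slot in
    which linearity is automatic.\<close>
  moreover have l2: "linear (\<lambda>b. FD (\<lambda>y. FD \<phi> y b) (x t) u)" for u
  proof -
    have "FD (\<lambda>y. FD \<phi> y b) (x t) u = FD (\<lambda>y. FD \<phi> y u) (x t) b" for b
      by (rule FD_commute[OF assms(7,6) xU])
    then show ?thesis
      using linear_frechet_derivative[OF smooth_on_differentiable[OF smooth_on_FD[OF assms(6), of u] xU]] by simp
  qed
  ultimately have "((\<lambda>s. FD \<phi> (x s) (v s)) has_vector_derivative
     FD (\<lambda>y. FD \<phi> y (v t)) (x t) (vderiv 1 x t) + FD \<phi> (x t) (vderiv 1 v t)) (at t)"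
    by (simp add: sum.distrib linear_basis_expand[OF lin[OF xU], symmetric]
        linear_basis_expand[OF l2, symmetric])
  then have 2: "vderiv 1 (\<lambda>s. FD \<phi> (x s) (v s)) t = FD (\<lambda>y. FD \<phi> y (v t)) (x t) (vderiv 1 x t) + FD \<phi> (x t) (vderiv 1 v t)"
    by (simp add: vderiv_def vector_derivative_at)
  show ?thesis
    unfolding covd_def 1 2 by (simp add: linear_add[OF lin[OF xU]] assms(8))
qed

section \<open>Jet coordinates and iterated covariant derivatives\<close>

lemma vderiv_vderiv: "vderiv n (vderiv (Suc 0) f) = vderiv (Suc n) f"
  using vderiv_Suc_inner[of n f] by simp

text \<open>The inverse of the numbering used in \<open>jet_chart\<close>: for
  \<open>n < CARD('k)\<close> the slot \<open>n\<close> of a jet holds the derivative of order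
  \<open>n\<close>. For larger \<open>n\<close> the component is an arbitrary one, hence the bounds
  in the lemmas that follow.\<close>

definition slot :: "'e ^ 'k::finite \<Rightarrow> nat \<Rightarrow> 'e" where
  "slot X n = X $ from_nat_into UNIV n"

definition jetv :: "(real \<Rightarrow> 'e::real_normed_vector) \<Rightarrow> real \<Rightarrow> 'e ^ 'k::finite" where
  "jetv x t = (\<chi> i. vderiv (to_nat_on (UNIV :: 'k set) i) x t)"

text \<open>The formal total derivative: every slot takes the value of the next one. The derivative
  of order \<open>CARD('k)\<close> is not part of the jet and is replaced by 0; when
  \<open>Suc n < CARD('k)\<close>, a function of the slots up to \<open>n\<close> does not see
  this.\<close>

definition jet_shift :: "'e::zero ^ 'k::finite \<Rightarrow> 'e ^ 'k" where
  "jet_shift X = (\<chi> i. if Suc (to_nat_on (UNIV :: 'k set) i) < CARD('k) then slot X (Suc (to_nat_on (UNIV :: 'k set) i)) else 0)"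

definition put_slot :: "nat \<Rightarrow> 'e::zero \<Rightarrow> 'e ^ 'k::finite" where
  "put_slot n z = (\<chi> i. if to_nat_on (UNIV :: 'k set) i = n then z else 0)"

definition jdom :: "'e set \<Rightarrow> ('e ^ 'k::finite) set" where
  "jdom U = {X. slot X 0 \<in> U}"

lemma to_nat_on_less_card: "to_nat_on UNIV (i :: 'k::finite) < CARD('k)"
  using to_nat_on_finite[of "UNIV :: 'k set"] by (auto simp: bij_betw_def)

lemma to_nat_on_from_nat_into_less: "n < CARD('k) \<Longrightarrow> to_nat_on UNIV (from_nat_into UNIV n :: 'k::finite) = n"
  using to_nat_on_finite[of "UNIV :: 'k set"] by (intro to_nat_on_from_nat_into) (simp add: bij_betw_def)

lemma slot_to_nat_on: "slot X (to_nat_on UNIV i) = X $ i"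
  by (simp add: slot_def countable_finite)

lemma slot_lambda: "n < CARD('k) \<Longrightarrow> slot (\<chi> i::'k::finite. f (to_nat_on UNIV i)) n = f n"
  by (simp add: slot_def to_nat_on_from_nat_into_less)

lemma slot_jetv: "n < CARD('k::finite) \<Longrightarrow> slot (jetv x t :: _ ^ 'k) n = vderiv n x t"
  unfolding jetv_def by (rule slot_lambda)

lemma slot_jet_shift_if:
  "n < CARD('k::finite) \<Longrightarrow> slot (jet_shift X :: _ ^ 'k) n = (if Suc n < CARD('k) then slot X (Suc n) else 0)"
  unfolding jet_shift_def by (rule slot_lambda)

lemma slot_jet_shift: "Suc n < CARD('k::finite) \<Longrightarrow> slot (jet_shift X :: _ ^ 'k) n = slot X (Suc n)"
  by (simp add: slot_jet_shift_if)

lemma slot_put_slot: "m < CARD('k::finite) \<Longrightarrow> slot (put_slot n z :: _ ^ 'k) m = (if m = n then z else 0)"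
  unfolding put_slot_def by (rule slot_lambda)

lemma slot_eqI: "(\<And>n. n < CARD('k::finite) \<Longrightarrow> slot X n = slot (Y :: _ ^ 'k) n) \<Longrightarrow> X = Y"
  unfolding vec_eq_iff using slot_to_nat_on to_nat_on_less_card by metis

lemma slot_simps [simp]:
  "slot (X + Y) n = slot X n + slot Y n" "slot (X - Y) n = slot X n - slot Y n"
  "slot (r *\<^sub>R X) n = r *\<^sub>R slot X n" "slot 0 n = 0"
  by (simp_all add: slot_def)

lemma bounded_linear_slot: "bounded_linear (\<lambda>X. slot X n)"
  unfolding slot_def by (rule bounded_linear_vec_nth)

lemma linear_slot: "linear (\<lambda>X :: 'e::real_normed_vector ^ 'k::finite. slot X n)"
  using bounded_linear_slot bounded_linear.linear by blast

lemma bounded_linear_jet_shift: "bounded_linear (jet_shift :: 'e::euclidean_space ^ 'k::finite \<Rightarrow> _)"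
  unfolding linear_conv_bounded_linear[symmetric] jet_shift_def
  by (rule linearI) (auto simp: vec_eq_iff)

lemma put_slot_scale: "put_slot n (r *\<^sub>R z) = r *\<^sub>R put_slot n (z :: 'e::real_vector)"
  by (simp add: put_slot_def vec_eq_iff)

lemma jet_shift_put_slot:
  "Suc n < CARD('k) \<Longrightarrow> jet_shift (put_slot (Suc n) z :: 'e::zero ^ 'k::finite) = put_slot n z"
  by (rule slot_eqI) (auto simp: slot_jet_shift_if slot_put_slot)

lemma open_jdom: "open U \<Longrightarrow> open (jdom U :: ('e::real_normed_vector ^ 'k::finite) set)"
  unfolding jdom_def using open_vimage[of U "\<lambda>X. slot X 0"] linear_continuous_on[OF bounded_linear_slot, of UNIV 0]
  by (simp add: vimage_def)

lemma FD_bounded_linear: "bounded_linear L \<Longrightarrow> FD L x = L"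
  by (rule FD_I) (rule bounded_linear_imp_has_derivative)

lemma FD_line:
  assumes "F differentiable (at y)" "\<And>s. F (y + s *\<^sub>R w) = c + s *\<^sub>R d"
  shows "FD F y w = d"
proof -
  have "((\<lambda>s. F (y + s *\<^sub>R w)) has_vector_derivative FD F y w) (at 0)"
    using has_vector_derivative_FD[OF has_vector_derivative_line[of y w 0], of F] assms(1) by simp
  moreover have "((\<lambda>s. F (y + s *\<^sub>R w)) has_vector_derivative d) (at 0)"
    unfolding assms(2) by (rule has_vector_derivative_line)
  ultimately show ?thesis by (rule vector_derivative_unique_at)
qed

text \<open>A directional derivative is a derivative along a line, and along it \<open>F\<close>
  sees only the slots up to \<open>n\<close>; for small parameters slot 0 stays in the open set
  \<open>U\<close>. The slots are an abstract family \<open>sl\<close>, since the lemma is applied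
  both to jets and to pairs of jets. It is what makes the truncation in \<open>jet_shift\<close>
  harmless.\<close>

lemma FD_eq_if_depends:
  fixes F :: "'z::real_normed_vector \<Rightarrow> 'b::real_normed_vector" and sl :: "'z \<Rightarrow> nat \<Rightarrow> 'y::real_normed_vector"
  assumes sl: "\<And>m. bounded_linear (\<lambda>z. sl z m)" and "open U"
    and F: "\<And>z z'. sl z 0 \<in> U \<Longrightarrow> sl z' 0 \<in> U \<Longrightarrow> (\<And>m. m \<le> n \<Longrightarrow> sl z m = sl z' m) \<Longrightarrow> F z = F z'"
    and d: "F differentiable (at z)" "F differentiable (at z')"
    and z: "sl z 0 \<in> U" "\<And>m. m \<le> n \<Longrightarrow> sl z m = sl z' m" "\<And>m. m \<le> n \<Longrightarrow> sl w m = sl w' m"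
  shows "FD F z w = FD F z' w'"
proof -
  let ?N = "(\<lambda>s. sl z 0 + s *\<^sub>R sl w 0) -` U"
  have N: "open ?N"
    by (rule open_vimage[OF assms(2)]) (intro continuous_intros)
  have "0 \<in> ?N" using z by simp
  have eq: "F (z + s *\<^sub>R w) = F (z' + s *\<^sub>R w')" if "s \<in> ?N" for s
  proof (rule F)
    have *: "sl (y + s *\<^sub>R v) m = sl y m + s *\<^sub>R sl v m" for y v m
      using linear_add[OF bounded_linear.linear[OF sl]] linear_scale[OF bounded_linear.linear[OF sl]] by metis
    show "sl (z + s *\<^sub>R w) 0 \<in> U" "sl (z' + s *\<^sub>R w') 0 \<in> U" using that z(2,3)[of 0] by (auto simp: *)
    show "sl (z + s *\<^sub>R w) m = sl (z' + s *\<^sub>R w') m" if "m \<le> n" for m using z(2,3)[OF that] by (simp add: *)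
  qed
  have "((\<lambda>s. F (z + s *\<^sub>R w)) has_vector_derivative FD F z w) (at 0)"
    using has_vector_derivative_FD[OF has_vector_derivative_line[of z w 0], of F] d(1) by simp
  then have "((\<lambda>s. F (z' + s *\<^sub>R w')) has_vector_derivative FD F z w) (at 0)"
    by (rule has_vector_derivative_transform_within_open[OF _ N \<open>0 \<in> ?N\<close> eq])
  moreover have "((\<lambda>s. F (z' + s *\<^sub>R w')) has_vector_derivative FD F z' w') (at 0)"
    using has_vector_derivative_FD[OF has_vector_derivative_line[of z' w' 0], of F] d(2) by simp
  ultimately show ?thesis by (rule vector_derivative_unique_at)
qed

lemma smooth_on_jetv:
  assumes "open N" "smooth_on N x"
  shows "smooth_on N (jetv x :: real \<Rightarrow> 'e::euclidean_space ^ 'k::finite)"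
  by (rule smooth_on_vec[OF assms(1)]) (simp add: jetv_def smooth_on_vderiv[OF assms])

lemma has_vector_derivative_jetv:
  assumes "open N" "smooth_on N x" "t \<in> N"
  shows "((jetv x :: real \<Rightarrow> 'e::euclidean_space ^ 'k::finite) has_vector_derivative jetv (vderiv 1 x) t) (at t)"
proof -
  have d: "((jetv x :: real \<Rightarrow> 'e ^ 'k) has_vector_derivative vderiv 1 (jetv x) t) (at t)"
    using has_vector_derivative_smooth[OF smooth_on_jetv[OF assms(1,2)] assms(3)] .
  have "slot (vderiv 1 (jetv x :: real \<Rightarrow> 'e ^ 'k) t) n = slot (jetv (vderiv 1 x) t :: 'e ^ 'k) n" if n: "n < CARD('k)" for n
  proof -
    have "((\<lambda>s. slot (jetv x s :: 'e ^ 'k) n) has_vector_derivative slot (vderiv 1 (jetv x :: real \<Rightarrow> 'e ^ 'k) t) n) (at t)"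
      using bounded_linear.has_vector_derivative[OF bounded_linear_slot d] .
    then have "(vderiv n x has_vector_derivative slot (vderiv 1 (jetv x :: real \<Rightarrow> 'e ^ 'k) t) n) (at t)"
      by (simp add: slot_jetv n)
    from vector_derivative_unique_at[OF this has_vector_derivative_vderiv[OF assms(1,2,3)]]
    show ?thesis by (simp add: slot_jetv n vderiv_vderiv)
  qed
  then have "vderiv 1 (jetv x :: real \<Rightarrow> 'e ^ 'k) t = jetv (vderiv 1 x) t" by (rule slot_eqI)
  with d show ?thesis by simp
qed

lemma vderiv_jetv:
  assumes "open N" "smooth_on N x" "t \<in> N"
  shows "vderiv 1 (jetv x :: real \<Rightarrow> 'e::euclidean_space ^ 'k::finite) t = jetv (vderiv 1 x) t"
  using vector_derivative_at[OF has_vector_derivative_jetv[OF assms]] by (simp add: vderiv_def)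

text \<open>The coordinate expressions of the derivatives of \<open>\<phi> \<circ> x\<close>, as functions of those of \<open>x\<close>.\<close>

primrec prolong :: "('e::euclidean_space \<Rightarrow> 'd::real_normed_vector) \<Rightarrow> nat \<Rightarrow> 'e ^ 'k::finite \<Rightarrow> 'd" where
  "prolong \<phi> 0 = (\<lambda>X. \<phi> (slot X 0))"
| "prolong \<phi> (Suc n) = (\<lambda>X. FD (prolong \<phi> n) X (jet_shift X))"

lemma smooth_on_prolong:
  assumes "open U" "smooth_on U \<phi>"
  shows "smooth_on (jdom U) (prolong \<phi> n :: 'e::euclidean_space ^ 'k::finite \<Rightarrow> _)"
proof (induction n)
  case 0
  have "smooth_on (jdom U) (\<lambda>X :: 'e ^ 'k. \<phi> (slot X 0))"
    by (rule smooth_on_compose[OF open_jdom[OF assms(1)] assms(1) smooth_on_linear[OF bounded_linear_slot] assms(2)])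
       (auto simp: jdom_def)
  then show ?case by simp
next
  case (Suc n)
  then show ?case
    using smooth_on_FD_apply[OF open_jdom[OF assms(1)] Suc smooth_on_linear[OF bounded_linear_jet_shift]] by simp
qed

lemma prolong_depends:
  fixes X Y :: "'e::euclidean_space ^ 'k::finite"
  assumes "open U" "smooth_on U \<phi>" "n < CARD('k)" "slot X 0 \<in> U" "slot Y 0 \<in> U"
    and "\<And>m. m \<le> n \<Longrightarrow> slot X m = slot Y m"
  shows "prolong \<phi> n X = prolong \<phi> n Y"
  using assms(3-)
proof (induction n arbitrary: X Y)
  case (Suc n)
  have diff: "(prolong \<phi> n :: 'e ^ 'k \<Rightarrow> _) differentiable (at Z)" if "slot Z 0 \<in> U" for Z
    using smooth_on_differentiable[OF smooth_on_prolong[OF assms(1,2)], of Z] that by (simp add: jdom_def)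
  show ?case
    unfolding prolong.simps
  proof (rule FD_eq_if_depends[where sl=slot and n=n, OF bounded_linear_slot assms(1) Suc.IH[OF Suc_lessD[OF Suc.prems(1)]]])
    show "slot X m = slot Y m" "slot (jet_shift X) m = slot (jet_shift Y) m" if "m \<le> n" for m
      using Suc.prems(1) Suc.prems(4)[of m] Suc.prems(4)[of "Suc m"] that by (simp_all add: slot_jet_shift)
  qed (use diff Suc.prems in blast)+
qed simp

lemma vderiv_prolong:
  fixes x :: "real \<Rightarrow> 'e::euclidean_space"
  assumes "open U" "smooth_on U \<phi>" "open N" "smooth_on N x" "x ` N \<subseteq> U" "n < CARD('k::finite)" "t \<in> N"
  shows "vderiv n (\<lambda>s. \<phi> (x s)) t = prolong \<phi> n (jetv x t :: 'e ^ 'k)"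
  using assms(6,7)
proof (induction n arbitrary: t)
  case 0
  then show ?case by (simp add: slot_jetv)
next
  case (Suc n)
  let ?X = "jetv x t :: 'e ^ 'k"
  have U: "slot ?X 0 \<in> U" using assms(5) Suc.prems(2) by (auto simp: slot_jetv)
  have diff: "(prolong \<phi> n :: 'e ^ 'k \<Rightarrow> _) differentiable (at ?X)"
    using smooth_on_differentiable[OF smooth_on_prolong[OF assms(1,2)], of ?X] U by (simp add: jdom_def)
  have "((\<lambda>s. prolong \<phi> n (jetv x s :: 'e ^ 'k)) has_vector_derivative FD (prolong \<phi> n) ?X (jetv (vderiv 1 x) t)) (at t)"
    by (rule has_vector_derivative_FD[OF has_vector_derivative_jetv[OF assms(3,4) Suc.prems(2)] diff])
  \<comment> \<open>The true derivative of the jet and \<open>jet_shift\<close> differ in the top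
    slot only, which is beyond the order \<open>n\<close> on which \<open>prolong \<phi> n\<close>
    depends.\<close>
  also have "FD (prolong \<phi> n) ?X (jetv (vderiv 1 x) t) = FD (prolong \<phi> n) ?X (jet_shift ?X)"
    by (rule FD_eq_if_depends[where sl=slot and n=n, OF bounded_linear_slot assms(1) prolong_depends[OF assms(1,2)]])
       (use Suc.prems U diff in \<open>auto simp: slot_jet_shift slot_jetv vderiv_vderiv\<close>)
  finally have "(vderiv n (\<lambda>s. \<phi> (x s)) has_vector_derivative FD (prolong \<phi> n) ?X (jet_shift ?X)) (at t)"
    by (rule has_vector_derivative_transform_within_open[OF _ assms(3) Suc.prems(2)]) (use Suc in simp)
  then show ?case by (simp add: vderiv_Suc vector_derivative_at)
qed

text \<open>\<open>cov \<Gamma> n (X, a)\<close> is the \<open>n\<close>-th covariant derivative, along a curve with jet coordinates \<open>X\<close>, of a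
  vector field along this curve whose components have the derivatives \<open>a\<close>.\<close>

primrec cov :: "('e::euclidean_space \<Rightarrow> 'e \<Rightarrow> 'e \<Rightarrow> 'e) \<Rightarrow> nat \<Rightarrow> ('e ^ 'k::finite) \<times> ('e ^ 'k) \<Rightarrow> 'e" where
  "cov \<Gamma> 0 = (\<lambda>Y. slot (snd Y) 0)"
| "cov \<Gamma> (Suc n) = (\<lambda>Y. FD (cov \<Gamma> n) Y (jet_shift (fst Y), jet_shift (snd Y)) +
     \<Gamma> (slot (fst Y) 0) (slot (fst Y) 1) (cov \<Gamma> n Y))"

definition slot2 :: "('e ^ 'k::finite) \<times> ('e ^ 'k) \<Rightarrow> nat \<Rightarrow> 'e \<times> 'e" where
  "slot2 Y n = (slot (fst Y) n, slot (snd Y) n)"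

lemma bounded_linear_slot2: "bounded_linear (\<lambda>Y. slot2 Y n)"
  unfolding slot2_def
  by (intro bounded_linear_Pair bounded_linear_compose[OF bounded_linear_slot, unfolded o_def] bounded_linear_fst bounded_linear_snd)

locale connection_coords =
  fixes U :: "'e::euclidean_space set" and \<Gamma> :: "'e \<Rightarrow> 'e \<Rightarrow> 'e \<Rightarrow> 'e"
  assumes open_U: "open U"
    and bilinear_\<Gamma>: "\<And>y. y \<in> U \<Longrightarrow> bilinear (\<Gamma> y)"
    and smooth_\<Gamma>: "\<And>a b. smooth_on U (\<lambda>y. \<Gamma> y a b)"
begin

lemma open_dom2: "open (jdom U \<times> UNIV :: (('e ^ 'k::finite) \<times> ('e ^ 'k)) set)"
  by (intro open_Times open_jdom open_U open_UNIV)

lemma smooth_on_cov: "smooth_on (jdom U \<times> UNIV) (cov \<Gamma> n :: ('e ^ 'k::finite) \<times> ('e ^ 'k) \<Rightarrow> 'e)"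
proof (induction n)
  case 0
  show ?case
    unfolding cov.simps
    by (rule smooth_on_linear) (rule bounded_linear_compose[OF bounded_linear_slot bounded_linear_snd, unfolded o_def])
next
  case (Suc n)
  have fst: "bounded_linear (\<lambda>Y :: ('e ^ 'k) \<times> ('e ^ 'k). slot (fst Y) m)" for m
    by (rule bounded_linear_compose[OF bounded_linear_slot bounded_linear_fst, unfolded o_def])
  have sh: "bounded_linear (\<lambda>Y :: ('e ^ 'k) \<times> ('e ^ 'k). (jet_shift (fst Y), jet_shift (snd Y)))"
    by (intro bounded_linear_Pair bounded_linear_compose[OF bounded_linear_jet_shift, unfolded o_def] bounded_linear_fst bounded_linear_snd)
  show ?case
    unfolding cov.simps
    by (intro smooth_on_add[OF open_dom2] smooth_on_FD_apply[OF open_dom2 Suc smooth_on_linear[OF sh]]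
       smooth_on_bilinear_apply[OF open_dom2 open_U _ smooth_on_linear[OF fst] smooth_on_linear[OF fst] Suc bilinear_\<Gamma> smooth_\<Gamma>])
       (auto simp: jdom_def)
qed

lemma cov_differentiable:
  "slot X 0 \<in> U \<Longrightarrow> (cov \<Gamma> n :: ('e ^ 'k::finite) \<times> ('e ^ 'k) \<Rightarrow> 'e) differentiable (at (X, a))"
  using smooth_on_differentiable[OF smooth_on_cov, of "(X, a)"] by (simp add: jdom_def)

lemma cov_depends:
  fixes Y Y' :: "('e ^ 'k::finite) \<times> ('e ^ 'k)"
  assumes "n < CARD('k)" "slot2 Y 0 \<in> U \<times> UNIV" "slot2 Y' 0 \<in> U \<times> UNIV" "\<And>m. m \<le> n \<Longrightarrow> slot2 Y m = slot2 Y' m"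
  shows "cov \<Gamma> n Y = cov \<Gamma> n Y'"
  using assms
proof (induction n arbitrary: Y Y')
  case 0
  then show ?case by (auto simp: slot2_def)
next
  case (Suc n)
  have "FD (cov \<Gamma> n) Y (jet_shift (fst Y), jet_shift (snd Y)) = FD (cov \<Gamma> n) Y' (jet_shift (fst Y'), jet_shift (snd Y'))"
  proof (rule FD_eq_if_depends[where sl=slot2 and n=n, OF bounded_linear_slot2 open_Times[OF open_U open_UNIV] Suc.IH[OF Suc_lessD[OF Suc.prems(1)]]])
    show "cov \<Gamma> n differentiable (at Y)" "cov \<Gamma> n differentiable (at Y')"
      using cov_differentiable[of "fst Y" n "snd Y"] cov_differentiable[of "fst Y'" n "snd Y'"] Suc.prems(2,3)
      by (auto simp: slot2_def)
    show "slot2 (jet_shift (fst Y), jet_shift (snd Y)) m = slot2 (jet_shift (fst Y'), jet_shift (snd Y')) m" if "m \<le> n" for m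
      using Suc.prems(1) Suc.prems(4)[of "Suc m"] that by (simp add: slot2_def slot_jet_shift)
    show "slot2 Y m = slot2 Y' m" if "m \<le> n" for m using Suc.prems(4) that by simp
  qed (use Suc.prems(2) in blast)+
  moreover have "cov \<Gamma> n Y = cov \<Gamma> n Y'"
    using Suc.prems(4) by (intro Suc.IH Suc_lessD[OF Suc.prems(1)] Suc.prems(2,3)) simp
  moreover have "slot (fst Y) 0 = slot (fst Y') 0" "slot (fst Y) 1 = slot (fst Y') 1"
    using Suc.prems(4)[of 0] Suc.prems(4)[of 1] by (auto simp: slot2_def)
  ultimately show ?case by simp
qed

lemma FD_cov_depends:
  fixes Y Y' :: "('e ^ 'k::finite) \<times> ('e ^ 'k)"
  assumes "n < CARD('k)" "slot (fst Y) 0 \<in> U"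
    and "\<And>m. m \<le> n \<Longrightarrow> slot2 Y m = slot2 Y' m" "\<And>m. m \<le> n \<Longrightarrow> slot2 w m = slot2 w' m"
  shows "FD (cov \<Gamma> n) Y w = FD (cov \<Gamma> n) Y' w'"
proof (rule FD_eq_if_depends[where sl=slot2 and n=n, OF bounded_linear_slot2 open_Times[OF open_U open_UNIV] cov_depends[OF assms(1)]])
  show "cov \<Gamma> n differentiable (at Y)" "cov \<Gamma> n differentiable (at Y')"
    using cov_differentiable[of "fst Y" n "snd Y"] cov_differentiable[of "fst Y'" n "snd Y'"] assms(2) assms(3)[of 0]
    by (auto simp: slot2_def)
  show "slot2 Y 0 \<in> U \<times> UNIV" using assms(2) by (simp add: slot2_def)
qed (use assms(3,4) in blast)+

text \<open>Differentiating in the direction of the field gives \<open>cov \<Gamma> n\<close> back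
  by linearity, and differentiating a family of linear maps with respect to the jet \<open>X\<close>
  gives linear maps again. The dependence on \<open>X\<close> itself is not linear.\<close>

lemma linear_cov:
  fixes X :: "'e ^ 'k::finite"
  assumes "slot X 0 \<in> U"
  shows "linear (\<lambda>a. cov \<Gamma> n (X, a))"
  using assms
proof (induction n arbitrary: X)
  case 0
  show ?case by (simp add: linear_slot)
next
  case (Suc n)
  let ?F = "cov \<Gamma> n :: ('e ^ 'k) \<times> ('e ^ 'k) \<Rightarrow> 'e"
  note lin = Suc.IH
  have d: "(?F has_derivative FD ?F (X, a)) (at (X, a))" for a
    using cov_differentiable[OF Suc.prems] frechet_derivative_works by blast
  have Xd: "X \<in> jdom U" using Suc.prems by (simp add: jdom_def)
  have D1: "((\<lambda>Y. ?F (Y, a)) has_derivative (\<lambda>v. FD ?F (X, a) (v, 0))) (at X)" for a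
  proof -
    have "((\<lambda>Y. (Y, a)) has_derivative (\<lambda>v. (v, 0))) (at X)"
      by (auto intro!: derivative_eq_intros)
    from has_derivative_compose[OF this d] show ?thesis .
  qed
  have "((\<lambda>Y. ?F (Y, a + b)) has_derivative (\<lambda>v. FD ?F (X, a) (v, 0) + FD ?F (X, b) (v, 0))) (at X)" for a b
    by (rule has_derivative_transform_within_open[OF has_derivative_add[OF D1 D1] open_jdom[OF open_U] Xd])
       (simp add: jdom_def linear_add[OF lin])
  note D1a = fun_cong[OF has_derivative_unique[OF D1 this]]
  have "((\<lambda>Y. ?F (Y, r *\<^sub>R a)) has_derivative (\<lambda>v. r *\<^sub>R FD ?F (X, a) (v, 0))) (at X)" for r a
    by (rule has_derivative_transform_within_open[OF has_derivative_scaleR_right[OF D1] open_jdom[OF open_U] Xd])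
       (simp add: jdom_def linear_scale[OF lin])
  note D1s = fun_cong[OF has_derivative_unique[OF D1 this]]
  have D2: "FD ?F (X, a) (0, w) = ?F (X, w)" for a w
    by (rule FD_line[OF cov_differentiable[OF Suc.prems], where c="?F (X, a)"])
       (simp add: linear_add[OF lin[OF Suc.prems]] linear_scale[OF lin[OF Suc.prems]])
  have D: "FD ?F (X, a) (v, w) = FD ?F (X, a) (v, 0) + ?F (X, w)" for a v w
    using linear_add[OF linear_frechet_derivative[OF cov_differentiable[OF Suc.prems, of n a]], of "(v, 0)" "(0, w)"] D2
    by simp
  note sh = bounded_linear.linear[OF bounded_linear_jet_shift]
  note G = bilinearD(1)[OF bilinear_\<Gamma>[OF Suc.prems]]
  have eq: "cov \<Gamma> (Suc n) (X, a) = FD ?F (X, a) (jet_shift X, 0) + ?F (X, jet_shift a) + \<Gamma> (slot X 0) (slot X 1) (?F (X, a))" for a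
    using D[of a "jet_shift X" "jet_shift a"] by simp
  show ?case
    by (rule linearI)
       (simp_all only: eq D1a D1s linear_add[OF sh] linear_scale[OF sh] linear_add[OF lin[OF Suc.prems]] linear_scale[OF lin[OF Suc.prems]]
         linear_add[OF G] linear_scale[OF G] scaleR_add_right add_ac)
qed

text \<open>The n-th covariant derivative is the n-th derivative of the components plus terms in
  lower derivatives of them. This triangularity yields the definiteness of the Sasaki metric and the
  value of each \<open>K_n\<close> on a vector in the top slot.\<close>

lemma cov_leading:
  fixes X a :: "'e ^ 'k::finite"
  assumes "n < CARD('k)" "slot X 0 \<in> U" "\<And>m. m < n \<Longrightarrow> slot a m = 0"
  shows "cov \<Gamma> n (X, a) = slot a n"
  using assms
proof (induction n arbitrary: X a)
  case (Suc n)
  let ?F = "cov \<Gamma> n :: ('e ^ 'k) \<times> ('e ^ 'k) \<Rightarrow> 'e"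
  have "?F (X, a) = 0" using Suc.IH[of X a] Suc.prems by simp
  have "FD ?F (X, a) (jet_shift X, jet_shift a) = slot a (Suc n)"
  proof -
    \<comment> \<open>Along this line the slots of the field below \<open>n\<close> stay 0, so the
      induction hypothesis gives \<open>cov \<Gamma> n\<close> on the whole line near 0 and not just
      at its origin; there it is linear in the parameter with slope
      \<open>slot a (Suc n)\<close>.\<close>
    let ?N = "(\<lambda>s. slot X 0 + s *\<^sub>R slot (jet_shift X) 0) -` U"
    have N: "open ?N" by (rule open_vimage[OF open_U]) (intro continuous_intros)
    have "((\<lambda>s. ?F ((X, a) + s *\<^sub>R (jet_shift X, jet_shift a))) has_vector_derivative FD ?F (X, a) (jet_shift X, jet_shift a)) (at 0)"
      using has_vector_derivative_FD[OF has_vector_derivative_line[of "(X, a)" "(jet_shift X, jet_shift a)" 0], of ?F]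
        cov_differentiable[OF Suc.prems(2)] by simp
    then have "((\<lambda>s. 0 + s *\<^sub>R slot a (Suc n)) has_vector_derivative FD ?F (X, a) (jet_shift X, jet_shift a)) (at 0)"
    proof (rule has_vector_derivative_transform_within_open[OF _ N])
      show "0 \<in> ?N" using Suc.prems by simp
      fix s assume s: "s \<in> ?N"
      have "?F (X + s *\<^sub>R jet_shift X, a + s *\<^sub>R jet_shift a) = slot (a + s *\<^sub>R jet_shift a) n"
        by (rule Suc.IH) (use s Suc.prems in \<open>auto simp: slot_jet_shift\<close>)
      then show "?F ((X, a) + s *\<^sub>R (jet_shift X, jet_shift a)) = 0 + s *\<^sub>R slot a (Suc n)"
        using Suc.prems by (simp add: slot_jet_shift)
    qed
    then show ?thesis using vector_derivative_unique_at[OF _ has_vector_derivative_line] by blast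
  qed
  then show ?case
    using \<open>?F (X, a) = 0\<close> linear_0[OF bilinearD(1)[OF bilinear_\<Gamma>[OF Suc.prems(2)]]] by simp
qed simp

text \<open>The derivative of the curve of the same order as the covariant derivative enters through
  a single Christoffel term. It starts as \<Gamma>(x', a) at order 1; each further covariant
  derivative replaces the highest derivative of \<open>x\<close> by the next one through
  \<open>jet_shift\<close>, while all other terms contain lower derivatives.\<close>

lemma cov_top:
  fixes X a :: "'e ^ 'k::finite"
  assumes "Suc n < CARD('k)" "slot X 0 \<in> U"
  shows "cov \<Gamma> (Suc n) (X + put_slot (Suc n) z, a) = cov \<Gamma> (Suc n) (X, a) + \<Gamma> (slot X 0) z (slot a 0)"
  using assms
proof (induction n arbitrary: X z a)
  case 0
  have "FD (cov \<Gamma> 0) Y = (\<lambda>w. slot (snd w) 0)" for Y :: "('e ^ 'k) \<times> ('e ^ 'k)"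
    unfolding cov.simps
    by (rule FD_bounded_linear) (rule bounded_linear_compose[OF bounded_linear_slot bounded_linear_snd, unfolded o_def])
  moreover have "slot (put_slot (Suc 0) z :: 'e ^ 'k) 0 = 0" "slot (put_slot (Suc 0) z :: 'e ^ 'k) (Suc 0) = z"
    using 0 by (simp_all add: slot_put_slot)
  ultimately show ?case
    using linear_add[OF bilinearD(2)[OF bilinear_\<Gamma>[OF 0(2)]]] by simp
next
  case (Suc n)
  let ?F = "cov \<Gamma> (Suc n) :: ('e ^ 'k) \<times> ('e ^ 'k) \<Rightarrow> 'e"
  let ?P = "put_slot (Suc (Suc n)) z :: 'e ^ 'k"
  let ?Q = "put_slot (Suc n) z :: 'e ^ 'k"
  have P: "slot ?P m = 0" if "m \<le> Suc n" for m using that Suc.prems by (simp add: slot_put_slot)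
  have sh: "jet_shift (X + ?P) = jet_shift X + ?Q"
    using linear_add[OF bounded_linear.linear[OF bounded_linear_jet_shift]] jet_shift_put_slot[OF Suc.prems(1)] by metis
  have lin: "linear (FD ?F (X, a))" using linear_frechet_derivative[OF cov_differentiable[OF Suc.prems(2)]] .
  \<comment> \<open>The induction hypothesis says that \<open>cov \<Gamma> (Suc n)\<close> is affine
    in the direction \<open>?Q\<close>, so the derivative is its slope.\<close>
  have "FD ?F (X, a) (?Q, 0) = \<Gamma> (slot X 0) z (slot a 0)"
  proof (rule FD_line[OF cov_differentiable[OF Suc.prems(2)], where c="?F (X, a)"])
    fix s
    show "?F ((X, a) + s *\<^sub>R (?Q, 0)) = ?F (X, a) + s *\<^sub>R \<Gamma> (slot X 0) z (slot a 0)"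
      using Suc.IH[of X "s *\<^sub>R z" a] Suc.prems linear_scale[OF bilinearD(2)[OF bilinear_\<Gamma>[OF Suc.prems(2)]]]
      by (simp add: put_slot_scale)
  qed
  moreover have "FD ?F (X + ?P, a) (jet_shift (X + ?P), jet_shift a) = FD ?F (X, a) (jet_shift X + ?Q, jet_shift a)"
    unfolding sh by (rule FD_cov_depends) (use Suc.prems P in \<open>auto simp: slot2_def\<close>)
  moreover have "FD ?F (X, a) (jet_shift X + ?Q, jet_shift a) = FD ?F (X, a) (jet_shift X, jet_shift a) + FD ?F (X, a) (?Q, 0)"
    using linear_add[OF lin, of "(jet_shift X, jet_shift a)" "(?Q, 0)"] by simp
  moreover have "?F (X + ?P, a) = ?F (X, a)"
    by (rule cov_depends) (use Suc.prems P in \<open>auto simp: slot2_def\<close>)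
  moreover have "slot (X + ?P) 0 = slot X 0" "slot (X + ?P) 1 = slot X 1" using P by simp_all
  ultimately show ?case
    by (subst (1 2) cov.simps(2)) simp
qed

text \<open>On the jets of genuine curves the formal total derivative agrees with the time
  derivative in all slots that \<open>cov \<Gamma> n\<close> reads, so formal and actual iteration
  coincide up to order \<open>CARD('k) - 1\<close>.\<close>

lemma covd_pow_eq_cov:
  fixes x v :: "real \<Rightarrow> 'e"
  assumes "open N" "smooth_on N x" "smooth_on N v" "x ` N \<subseteq> U" "n < CARD('k::finite)" "t \<in> N"
  shows "(covd \<Gamma> x ^^ n) v t = cov \<Gamma> n (jetv x t :: 'e ^ 'k, jetv v t)"
  using assms(5,6)
proof (induction n arbitrary: t)
  case 0
  then show ?case by (simp add: slot_jetv)
next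
  case (Suc n)
  let ?F = "cov \<Gamma> n :: ('e ^ 'k) \<times> ('e ^ 'k) \<Rightarrow> 'e"
  let ?X = "jetv x t :: 'e ^ 'k" and ?a = "jetv v t :: 'e ^ 'k"
  have U: "slot ?X 0 \<in> U" using assms(4) Suc.prems by (auto simp: slot_jetv)
  have "((\<lambda>s. (jetv x s :: 'e ^ 'k, jetv v s :: 'e ^ 'k)) has_vector_derivative (jetv (vderiv 1 x) t, jetv (vderiv 1 v) t)) (at t)"
    by (intro has_vector_derivative_Pair has_vector_derivative_jetv[OF assms(1,2)] has_vector_derivative_jetv[OF assms(1,3)] Suc.prems)
  from has_vector_derivative_FD[OF this cov_differentiable[OF U]]
  have "((\<lambda>s. ?F (jetv x s, jetv v s)) has_vector_derivative FD ?F (?X, ?a) (jetv (vderiv 1 x) t, jetv (vderiv 1 v) t)) (at t)" .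
  also have "FD ?F (?X, ?a) (jetv (vderiv 1 x) t, jetv (vderiv 1 v) t) = FD ?F (?X, ?a) (jet_shift ?X, jet_shift ?a)"
    by (rule FD_cov_depends) (use Suc.prems U in \<open>auto simp: slot2_def slot_jet_shift slot_jetv vderiv_vderiv\<close>)
  finally have "((covd \<Gamma> x ^^ n) v has_vector_derivative FD ?F (?X, ?a) (jet_shift ?X, jet_shift ?a)) (at t)"
    by (rule has_vector_derivative_transform_within_open[OF _ assms(1) Suc.prems(2)]) (use Suc in simp)
  then have "vderiv 1 ((covd \<Gamma> x ^^ n) v) t = FD ?F (?X, ?a) (jet_shift ?X, jet_shift ?a)"
    by (simp add: vderiv_def vector_derivative_at)
  then show ?case
    using Suc by (simp add: covd_def[of _ _ "(covd \<Gamma> x ^^ n) v"] slot_jetv)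
qed

lemma smooth_on_covd_pow:
  assumes "open N" "smooth_on N x" "smooth_on N v" "x ` N \<subseteq> U"
  shows "smooth_on N ((covd \<Gamma> x ^^ n) v)"
proof (induction n)
  case (Suc n)
  then show ?case
    using smooth_on_covd[OF open_U bilinear_\<Gamma> smooth_\<Gamma> assms(1,2,4) Suc] by simp
qed (use assms in simp)

end

section \<open>The Sasaki metric in coordinates\<close>

locale metric_coords =
  fixes U :: "'e::euclidean_space set" and h :: "'e \<Rightarrow> 'e \<Rightarrow> 'e \<Rightarrow> real"
  assumes open_U: "open U"
    and inner_h: "\<And>y. y \<in> U \<Longrightarrow> inner_coeff (h y)"
    and smooth_h: "\<And>a b. smooth_on U (\<lambda>y. h y a b)"
begin

lemma is_lc_h: "y \<in> U \<Longrightarrow> is_lc h y (levi_civita h y)"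
  by (rule is_lc_levi_civita[OF open_U _ inner_h smooth_on_differentiable[OF smooth_h]])

end

sublocale metric_coords \<subseteq> connection_coords U "levi_civita h"
proof
  show "bilinear (levi_civita h y)" if "y \<in> U" for y
    using is_lc_h[OF that] by (simp add: is_lc_def)
  show "smooth_on U (\<lambda>y. levi_civita h y a b)" for a b
    by (rule smooth_on_levi_civita[OF open_U inner_h smooth_h])
qed (rule open_U)

context metric_coords
begin

text \<open>The Sasaki metric in a jet chart. The square comes from the factor
  \<open>1 / fact n\<close> that each of the two arguments brings along through
  \<open>K_map\<close>.\<close>

definition sasaki_coeff :: "'e ^ 'k::finite \<Rightarrow> 'e ^ 'k \<Rightarrow> 'e ^ 'k \<Rightarrow> real" where
  "sasaki_coeff X a b = (\<Sum>n<CARD('k). h (slot X 0) (cov (levi_civita h) n (X, a)) (cov (levi_civita h) n (X, b)) / (fact n)\<^sup>2)"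

text \<open>If the value on \<open>a\<close> is 0, every \<open>cov\<close> of order below
  \<open>CARD('k)\<close> vanishes, and \<open>cov_leading\<close> then kills the slots of
  \<open>a\<close> one after another.\<close>

lemma inner_sasaki_coeff:
  fixes X :: "'e ^ 'k::finite"
  assumes "slot X 0 \<in> U"
  shows "inner_coeff (sasaki_coeff X)"
  unfolding inner_coeff_def
proof (intro conjI allI impI)
  note ic = inner_coeffD[OF inner_h[OF assms]]
  note lin = linear_cov[OF assms]
  have sym: "sasaki_coeff X a b = sasaki_coeff X b a" for a b
    unfolding sasaki_coeff_def by (simp only: ic(2))
  then show "sasaki_coeff X a b = sasaki_coeff X b a" for a b .
  have l: "linear (\<lambda>a. sasaki_coeff X a b)" for b
    unfolding sasaki_coeff_def
    by (rule linearI)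
       (simp_all add: linear_add[OF lin] linear_scale[OF lin] ic(4,6) add_divide_distrib sum.distrib sum_distrib_left)
  then show "bilinear (sasaki_coeff X)"
    unfolding bilinear_def using sym by simp
  show "sasaki_coeff X a a > 0" if a: "a \<noteq> 0" for a
  proof (rule ccontr)
    let ?c = "\<lambda>n. cov (levi_civita h) n (X, a)"
    have nn: "0 \<le> h (slot X 0) (?c n) (?c n)" for n
      using ic(3)[of "?c n"] ic(10)[of 0] by (cases "?c n = 0") auto
    assume "\<not> sasaki_coeff X a a > 0"
    moreover have "0 \<le> sasaki_coeff X a a"
      unfolding sasaki_coeff_def by (intro sum_nonneg divide_nonneg_nonneg nn) simp
    ultimately have "(\<Sum>n<CARD('k). h (slot X 0) (?c n) (?c n) / (fact n)\<^sup>2) = 0"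
      unfolding sasaki_coeff_def by simp
    then have "\<forall>n\<in>{..<CARD('k)}. h (slot X 0) (?c n) (?c n) / (fact n)\<^sup>2 = 0"
      by (subst (asm) sum_nonneg_eq_0_iff) (simp_all add: nn)
    then have c0: "?c n = 0" if "n < CARD('k)" for n
      using that ic(3)[of "?c n"] by fastforce
    have "slot a n = 0" if "n < CARD('k)" for n
      using that
    proof (induction n rule: less_induct)
      case (less n)
      then show ?case using cov_leading[OF less.prems assms, of a] c0[OF less.prems] by simp
    qed
    then have "a = 0" by (intro slot_eqI) simp
    then show False using a by simp
  qed
qed

lemma smooth_on_slot_0: "smooth_on S (\<lambda>X :: 'e ^ 'k::finite. slot X 0)"
  by (rule smooth_on_linear[OF bounded_linear_slot])

lemma smooth_on_cov_fst:
  "smooth_on (jdom U) (\<lambda>X. cov (levi_civita h) n (X, a :: 'e ^ 'k::finite))"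
  by (rule smooth_on_compose[OF open_jdom[OF open_U] open_dom2 _ smooth_on_cov])
     (auto intro!: smooth_on_Pair open_jdom open_U smooth_on_const smooth_on_linear[OF bounded_linear_ident])

lemma smooth_on_sasaki_coeff: "smooth_on (jdom U) (\<lambda>X. sasaki_coeff X a (b :: 'e ^ 'k::finite))"
proof -
  have "smooth_on (jdom U) (\<lambda>X. \<Sum>n<CARD('k). (1 / (fact n)\<^sup>2) *\<^sub>R
      h (slot X 0) (cov (levi_civita h) n (X, a)) (cov (levi_civita h) n (X, b)))"
    by (intro smooth_on_sum[OF open_jdom[OF open_U]] smooth_on_bounded_linear[OF open_jdom[OF open_U] bounded_linear_scaleR_right]
         smooth_on_bilinear_apply[OF open_jdom[OF open_U] open_U _ smooth_on_slot_0 smooth_on_cov_fst smooth_on_cov_fst inner_coeffD(1)[OF inner_h] smooth_h])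
       (auto simp: jdom_def)
  then show ?thesis by (simp add: sasaki_coeff_def)
qed

lemma has_derivative_sasaki_coeff:
  fixes X v z :: "'e ^ 'k::finite"
  assumes "slot X 0 \<in> U"
  shows "FD (\<lambda>Y. sasaki_coeff Y v v) X z = (\<Sum>n<CARD('k).
    (FD (\<lambda>y. h y (cov (levi_civita h) n (X, v)) (cov (levi_civita h) n (X, v))) (slot X 0) (slot z 0)
     + 2 * h (slot X 0) (cov (levi_civita h) n (X, v)) (FD (\<lambda>Y. cov (levi_civita h) n (Y, v)) X z)) / (fact n)\<^sup>2)"
proof -
  let ?c = "\<lambda>n Y. cov (levi_civita h) n (Y, v)"
  have X: "X \<in> jdom U" using assms by (simp add: jdom_def)
  have "((\<lambda>Y. h (slot Y 0) (?c n Y) (?c n Y)) has_derivative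
    (\<lambda>w. FD (\<lambda>y. h y (?c n X) (?c n X)) (slot X 0) (slot w 0) + h (slot X 0) (FD (?c n) X w) (?c n X)
       + h (slot X 0) (?c n X) (FD (?c n) X w))) (at X)" for n
    by (rule has_derivative_bilinear_apply[OF open_jdom[OF open_U] X bounded_linear_imp_has_derivative[OF bounded_linear_slot]
           smooth_on_has_derivative[OF smooth_on_cov_fst X] smooth_on_has_derivative[OF smooth_on_cov_fst X] open_U])
       (auto simp: jdom_def inner_coeffD(1)[OF inner_h] intro: smooth_on_differentiable[OF smooth_h assms])
  then have "((\<lambda>Y. \<Sum>n<CARD('k). h (slot Y 0) (?c n Y) (?c n Y) / (fact n)\<^sup>2) has_derivative
    (\<lambda>w. \<Sum>n<CARD('k). (FD (\<lambda>y. h y (?c n X) (?c n X)) (slot X 0) (slot w 0) + h (slot X 0) (FD (?c n) X w) (?c n X)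
       + h (slot X 0) (?c n X) (FD (?c n) X w)) / (fact n)\<^sup>2)) (at X)"
    by (intro has_derivative_sum bounded_linear.has_derivative[OF bounded_linear_divide])
  from FD_I[OF this] show ?thesis
    using inner_coeffD(2)[OF inner_h[OF assms], of "FD (?c _) X z"] by (simp add: sasaki_coeff_def algebra_simps)
qed

lemma is_lc_sasaki:
  assumes "slot X 0 \<in> U"
  shows "is_lc sasaki_coeff X (levi_civita sasaki_coeff (X :: 'e ^ 'k::finite))"
proof (rule is_lc_levi_civita[OF open_jdom[OF open_U]])
  show "X \<in> jdom U" using assms by (simp add: jdom_def)
  then show "(\<lambda>y. sasaki_coeff y a b) differentiable at X" for a b
    by (rule smooth_on_differentiable[OF smooth_on_sasaki_coeff])
qed (simp add: inner_sasaki_coeff jdom_def)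

end

declare One_nat_def [simp del]

lemma vderiv_1_const [simp]: "vderiv 1 (\<lambda>s. c) t = 0"
  by (simp add: vderiv_def One_nat_def)

section \<open>Euler-Lagrange equation of a lifted curve\<close>

locale metric_curve = metric_coords U h for U :: "'e::euclidean_space set" and h +
  fixes N :: "real set" and x :: "real \<Rightarrow> 'e"
  assumes open_N: "open N" and smooth_x: "smooth_on N x" and x_in: "x ` N \<subseteq> U"
begin

definition acc :: "nat \<Rightarrow> real \<Rightarrow> 'e" where
  "acc n = (covd (levi_civita h) x ^^ n) (vderiv 1 x)"

text \<open>The left-hand side of the geodesic equation for the lift, in jet coordinates;
  \<open>acc n\<close> plays the part of \<open>w_n\<close>.\<close>

definition jet_acc :: "'k::finite itself \<Rightarrow> real \<Rightarrow> 'e ^ 'k" where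
  "jet_acc K = covd (levi_civita sasaki_coeff) (jetv x) (vderiv 1 (jetv x))"

lemma smooth_v: "smooth_on N (vderiv 1 x)"
  by (rule smooth_on_vderiv[OF open_N smooth_x])

lemma smooth_acc: "smooth_on N (acc n)"
  unfolding acc_def by (rule smooth_on_covd_pow[OF open_N smooth_x smooth_v x_in])

lemma slot_jetv_0: "slot (jetv x t :: 'e ^ 'k::finite) 0 = x t"
  by (simp add: slot_jetv)

lemma slot_jetv_in: "t \<in> N \<Longrightarrow> slot (jetv x t :: 'e ^ 'k::finite) 0 \<in> U"
  using x_in by (auto simp: slot_jetv_0)

text \<open>The velocity of the jet of \<open>x\<close> is the jet of \<open>x'\<close>, so the
  formal expression, evaluated at the lift and its velocity, is the true covariant
  derivative.\<close>

lemma cov_jetv: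
  assumes "n < CARD('k::finite)" "t \<in> N"
  shows "cov (levi_civita h) n (jetv x t :: 'e ^ 'k, vderiv 1 (jetv x) t) = acc n t"
  unfolding vderiv_jetv[OF open_N smooth_x assms(2)] acc_def
  by (rule covd_pow_eq_cov[OF open_N smooth_x smooth_v x_in assms, symmetric])

text \<open>The sum is the squared speed of the lift, and metric compatibility expresses its
  derivative at \<open>t\<close> through the acceleration at \<open>t\<close> alone. A statement
  about one time is what is wanted, since the chart may change with the time.\<close>

lemma has_derivative_speed:
  assumes "t \<in> N" "jet_acc TYPE('k::finite) t = 0"
  shows "((\<lambda>s. \<Sum>n<CARD('k). h (x s) (acc n s) (acc n s) / (fact n)\<^sup>2) has_real_derivative 0) (at t)"
proof -
  let ?X = "jetv x :: real \<Rightarrow> 'e ^ 'k"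
  have sm: "smooth_on N ?X" by (rule smooth_on_jetv[OF open_N smooth_x])
  have "((\<lambda>s. sasaki_coeff (?X s) (vderiv 1 ?X s) (vderiv 1 ?X s)) has_real_derivative
     sasaki_coeff (?X t) (jet_acc TYPE('k) t) (vderiv 1 ?X t) + sasaki_coeff (?X t) (vderiv 1 ?X t) (jet_acc TYPE('k) t)) (at t)"
    unfolding jet_acc_def
    by (rule has_derivative_metric_covd[OF open_jdom[OF open_U] _ smooth_on_sasaki_coeff open_N assms(1)])
       (auto simp: jdom_def inner_sasaki_coeff slot_jetv_in intro!: sm smooth_on_vderiv[OF open_N])
  then have "((\<lambda>s. sasaki_coeff (?X s) (vderiv 1 ?X s) (vderiv 1 ?X s)) has_real_derivative 0) (at t)"
    using inner_coeffD(10,11)[OF inner_sasaki_coeff[OF slot_jetv_in[OF assms(1), where 'k='k]]] assms(2) by simp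
  then show ?thesis
    unfolding has_field_derivative_def
    by (rule has_derivative_transform_within_open[OF _ open_N assms(1)])
       (simp add: sasaki_coeff_def cov_jetv[where 'k='k] slot_jetv_0 cong: sum.cong_simp)
qed

text \<open>\<open>D\<close> is the time derivative of the momentum paired with \<open>z\<close>,
  whose components are constant. The sum is the derivative of the squared speed along
  \<open>z\<close> at frozen velocity: \<open>h\<close> varies through its base point, and
  \<open>cov\<close> through its dependence on the jet.\<close>

lemma sasaki_euler_lagrange:
  fixes z :: "'e ^ 'k::finite"
  assumes "t \<in> N" "((\<lambda>s. sasaki_coeff (jetv x s) (vderiv 1 (jetv x) s) z) has_real_derivative D) (at t)"
  shows "sasaki_coeff (jetv x t) (jet_acc TYPE('k) t) z = D - (\<Sum>n<CARD('k).
    (FD (\<lambda>y. h y (acc n t) (acc n t)) (x t) (slot z 0)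
     + 2 * h (x t) (acc n t) (FD (\<lambda>Y. cov (levi_civita h) n (Y, vderiv 1 (jetv x) t)) (jetv x t) z)) / (fact n)\<^sup>2) / 2"
proof -
  let ?X = "jetv x :: real \<Rightarrow> 'e ^ 'k"
  let ?v = "vderiv 1 ?X"
  have sm: "smooth_on N ?X" by (rule smooth_on_jetv[OF open_N smooth_x])
  have smv: "smooth_on N ?v" by (rule smooth_on_vderiv[OF open_N sm])
  have "((\<lambda>s. sasaki_coeff (?X s) (?v s) z) has_real_derivative
     FD (\<lambda>Y. sasaki_coeff Y (?v t) z) (?X t) (?v t) + sasaki_coeff (?X t) (vderiv 1 ?v t) z + sasaki_coeff (?X t) (?v t) 0) (at t)"
    by (rule has_derivative_metric_curve[OF open_jdom[OF open_U] _ smooth_on_sasaki_coeff open_N assms(1) _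
          has_vector_derivative_smooth[OF sm assms(1)] has_vector_derivative_smooth[OF smv assms(1)] has_vector_derivative_const])
       (auto simp: jdom_def inner_sasaki_coeff slot_jetv_in)
  from DERIV_unique[OF this assms(2)]
  have D: "D = FD (\<lambda>Y. sasaki_coeff Y (?v t) z) (?X t) (?v t) + sasaki_coeff (?X t) (vderiv 1 ?v t) z"
    using inner_coeffD(11)[OF inner_sasaki_coeff[OF slot_jetv_in[OF assms(1), where 'k='k]]] by simp
  have "sasaki_coeff (?X t) (jet_acc TYPE('k) t) z = D - FD (\<lambda>Y. sasaki_coeff Y (?v t) (?v t)) (?X t) z / 2"
    unfolding D jet_acc_def covd_def
    by (rule is_lc_euler_lagrange[OF inner_sasaki_coeff[OF slot_jetv_in[OF assms(1)]] is_lc_sasaki[OF slot_jetv_in[OF assms(1)]]])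
  also have "FD (\<lambda>Y. sasaki_coeff Y (?v t) (?v t)) (?X t) z = (\<Sum>n<CARD('k).
    (FD (\<lambda>y. h y (acc n t) (acc n t)) (x t) (slot z 0)
     + 2 * h (x t) (acc n t) (FD (\<lambda>Y. cov (levi_civita h) n (Y, ?v t)) (?X t) z)) / (fact n)\<^sup>2)"
    unfolding has_derivative_sasaki_coeff[OF slot_jetv_in[OF assms(1)]] slot_jetv_0
    by (rule sum.cong) (simp_all add: cov_jetv[OF _ assms(1)])
  finally show ?thesis .
qed

text \<open>Varying only the top slot in the Euler-Lagrange equation.\<close>

lemma acc_top_eq_0:
  assumes "t \<in> N" "jet_acc TYPE('k::finite) t = 0" "CARD('k) = Suc k" "k \<ge> 1"
  shows "acc (Suc k) t = 0"
proof -
  obtain m where m: "k = Suc m" using assms(4) by (cases k) auto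
  let ?G = "levi_civita h"
  let ?X = "jetv x :: real \<Rightarrow> 'e ^ 'k"
  let ?v = "vderiv 1 ?X"
  note inU = slot_jetv_in[OF assms(1), where 'k='k]
  have xU: "x t \<in> U" using inU by (simp add: slot_jetv_0)
  note ic = inner_coeffD[OF inner_h[OF xU]]
  have "h (x t) (acc (Suc k) t) \<zeta> = 0" for \<zeta>
  proof -
    let ?z = "put_slot k \<zeta> :: 'e ^ 'k"
    have sz: "slot ?z n = (if n = k then \<zeta> else 0)" if "n \<le> k" for n
      using that assms(3) by (simp add: slot_put_slot)
    \<comment> \<open>By triangularity a vector in the top slot is seen by the covariant derivative
      of order \<open>k\<close> only, so the momentum reduces to one summand.\<close>
    have cz: "cov ?G n (?X s, ?z) = (if n = k then \<zeta> else 0)" if "n \<le> k" "s \<in> N" for n s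
      by (subst cov_leading[OF _ slot_jetv_in[OF that(2)]]) (use that(1) assms(3) sz in auto)
    have "((\<lambda>s. h (x s) (acc k s) \<zeta>) has_real_derivative
        h (x t) (covd ?G x (acc k) t) \<zeta> + h (x t) (acc k t) (covd ?G x (\<lambda>s. \<zeta>) t)) (at t)"
      by (rule has_derivative_metric_covd[OF open_U inner_h smooth_h open_N assms(1) x_in smooth_x smooth_acc smooth_on_const])
    \<comment> \<open>The vector \<zeta> is constant in coordinates but not parallel, which leaves
      the first of the two Christoffel terms.\<close>
    then have d: "((\<lambda>s. h (x s) (acc k s) \<zeta> / (fact k)\<^sup>2) has_real_derivative
        (h (x t) (acc (Suc k) t) \<zeta> + h (x t) (acc k t) (?G (x t) (vderiv 1 x t) \<zeta>)) / (fact k)\<^sup>2) (at t)" (is "(_ has_real_derivative ?D) _")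
      by (intro DERIV_cdivide) (simp add: acc_def covd_def[of _ _ "\<lambda>s. \<zeta>"] vderiv_Suc)
    have eq: "h (x s) (acc k s) \<zeta> / (fact k)\<^sup>2 = sasaki_coeff (?X s) (?v s) ?z" if "s \<in> N" for s
    proof -
      have "sasaki_coeff (?X s) (?v s) ?z = (\<Sum>n\<in>{..<Suc k}. if n = k then h (x s) (acc k s) \<zeta> / (fact k)\<^sup>2 else 0)"
        unfolding sasaki_coeff_def assms(3) slot_jetv_0
        by (rule sum.cong)
           (use x_in that in \<open>auto simp: cz cov_jetv assms(3) inner_coeffD(11)[OF inner_h]\<close>)
      then show ?thesis by simp
    qed
    have "((\<lambda>s. sasaki_coeff (?X s) (?v s) ?z) has_real_derivative ?D) (at t)"
      using has_derivative_transform_within_open[OF d[unfolded has_field_derivative_def] open_N assms(1) eq]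
      unfolding has_field_derivative_def .
    note EL = sasaki_euler_lagrange[OF assms(1) this]
    \<comment> \<open>The second Christoffel term: by \<open>cov_top\<close> only order
      \<open>k\<close> reacts to the top slot, and it does so affinely.\<close>
    have c: "FD (\<lambda>Y. cov ?G n (Y, ?v t)) (?X t) ?z = (if n = k then ?G (x t) \<zeta> (vderiv 1 x t) else 0)" if "n \<le> k" for n
    proof (rule FD_line[where c="cov ?G n (?X t, ?v t)"])
      show "(\<lambda>Y. cov ?G n (Y, ?v t)) differentiable at (?X t)"
        using smooth_on_differentiable[OF smooth_on_cov_fst] inU by (simp add: jdom_def)
      have bl: "linear (\<lambda>a. ?G (x t) a b)" for b using bilinearD(2)[OF bilinear_\<Gamma>[OF xU]] .
      have s0: "slot (?v t) 0 = vderiv 1 x t"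
        by (simp add: vderiv_jetv[OF open_N smooth_x assms(1), simplified] slot_jetv)
      show "cov ?G n (?X t + s *\<^sub>R ?z, ?v t) = cov ?G n (?X t, ?v t) + s *\<^sub>R (if n = k then ?G (x t) \<zeta> (vderiv 1 x t) else 0)" for s
      proof (cases "n = k")
        case True
        then show ?thesis
          using cov_top[of m "?X t" "s *\<^sub>R \<zeta>" "?v t"] inU m assms(3) s0 linear_scale[OF bl]
          by (simp add: put_slot_scale slot_jetv_0)
      next
        case False
        have "cov ?G n (?X t + s *\<^sub>R ?z, ?v t) = cov ?G n (?X t, ?v t)"
          by (rule cov_depends) (use False that assms(3,4) inU sz in \<open>auto simp: slot2_def\<close>)
        then show ?thesis using False by simp
      qed
    qed
    \<comment> \<open>As \<open>k \<ge> 1\<close>, the top slot is not the base point, and the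
      derivative of the coefficients \<open>h\<close> contributes nothing.\<close>
    have z0: "slot ?z 0 = 0" using sz[of 0] assms(4) by simp
    have F0: "FD (\<lambda>y. h y a b) (x t) 0 = 0" for a b
      using linear_0[OF linear_frechet_derivative[OF smooth_on_differentiable[OF smooth_h xU]]] .
    have "(\<Sum>n<CARD('k). (FD (\<lambda>y. h y (acc n t) (acc n t)) (x t) (slot ?z 0)
       + 2 * h (x t) (acc n t) (FD (\<lambda>Y. cov ?G n (Y, ?v t)) (?X t) ?z)) / (fact n)\<^sup>2)
      = (\<Sum>n\<in>{..<Suc k}. if n = k then 2 * h (x t) (acc k t) (?G (x t) \<zeta> (vderiv 1 x t)) / (fact k)\<^sup>2 else 0)"
      unfolding assms(3) z0 F0 by (rule sum.cong) (auto simp: c ic(11))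
    also have "\<dots> = 2 * h (x t) (acc k t) (?G (x t) \<zeta> (vderiv 1 x t)) / (fact k)\<^sup>2" by simp
    finally have "sasaki_coeff (?X t) (jet_acc TYPE('k) t) ?z
      = ?D - h (x t) (acc k t) (?G (x t) \<zeta> (vderiv 1 x t)) / (fact k)\<^sup>2"
      using EL by simp
    moreover have "sasaki_coeff (?X t) (jet_acc TYPE('k) t) ?z = 0"
      using inner_coeffD(10)[OF inner_sasaki_coeff[OF inU]] assms(2) by simp
    \<comment> \<open>Torsion-freeness makes the two Christoffel terms equal; what remains pairs
      \<open>acc (Suc k) t\<close> with an arbitrary \<zeta>.\<close>
    moreover have "?G (x t) \<zeta> (vderiv 1 x t) = ?G (x t) (vderiv 1 x t) \<zeta>"
      using is_lc_h[OF xU] by (simp add: is_lc_def)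
    ultimately show ?thesis by (simp add: add_divide_distrib)
  qed
  then show ?thesis
    by (intro inner_coeff_nondegenerate[OF inner_h[OF xU]]) (simp add: ic(10))
qed

text \<open>All \<open>acc n\<close> of positive order vanish near \<open>t\<close>, so the momentum
  keeps its summand of order 0 only. In the derivative of the squared speed the summands of positive
  order drop out too, being quadratic in \<open>acc n\<close>. What is left is the Euler-Lagrange
  equation of \<open>x\<close> for \<open>h\<close>.\<close>

lemma jet_acc_eq_0:
  assumes "t \<in> N" "\<And>s. s \<in> N \<Longrightarrow> acc 1 s = 0"
  shows "jet_acc TYPE('k::finite) t = 0"
proof -
  let ?G = "levi_civita h"
  let ?X = "jetv x :: real \<Rightarrow> 'e ^ 'k"
  let ?v = "vderiv 1 ?X"
  note inU = slot_jetv_in[OF assms(1), where 'k='k]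
  have xU: "x t \<in> U" using inU by (simp add: slot_jetv_0)
  note ic = inner_coeffD[OF inner_h[OF xU]]
  have acc0: "acc n s = 0" if "s \<in> N" "n > 0" for n s
    using that
  proof (induction n arbitrary: s)
    case (Suc n)
    show ?case
    proof (cases "n = 0")
      case False
      have "acc (Suc n) s = covd ?G x (acc n) s" by (simp add: acc_def)
      also have "\<dots> = covd ?G x (\<lambda>s. 0) s"
        by (rule covd_cong[OF open_N Suc.prems(1)]) (use False Suc.IH in auto)
      also have "\<dots> = 0"
        using linear_0[OF bilinearD(1)[OF bilinear_\<Gamma>[of "x s"]]] x_in Suc.prems(1) by (auto simp: covd_def vderiv_Suc)
      finally show ?thesis .
    qed (use assms(2) Suc.prems in \<open>simp add: One_nat_def\<close>)
  qed simp
  have "sasaki_coeff (?X t) (jet_acc TYPE('k) t) z = 0" for z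
  proof -
    have "((\<lambda>s. h (x s) (vderiv 1 x s) (slot z 0)) has_real_derivative
        FD (\<lambda>y. h y (vderiv 1 x t) (slot z 0)) (x t) (vderiv 1 x t) + h (x t) (vderiv 1 (vderiv 1 x) t) (slot z 0) + h (x t) (vderiv 1 x t) 0) (at t)"
      by (rule has_derivative_metric_curve[OF open_U inner_h smooth_h open_N assms(1) x_in has_vector_derivative_smooth[OF smooth_x assms(1)]
            has_vector_derivative_smooth[OF smooth_v assms(1)] has_vector_derivative_const])
    then have d: "((\<lambda>s. h (x s) (vderiv 1 x s) (slot z 0)) has_real_derivative
        FD (\<lambda>y. h y (vderiv 1 x t) (slot z 0)) (x t) (vderiv 1 x t) + h (x t) (vderiv 1 (vderiv 1 x) t) (slot z 0)) (at t)"
      (is "(_ has_real_derivative ?D) _") by (simp add: ic(11))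
    have eq: "h (x s) (vderiv 1 x s) (slot z 0) = sasaki_coeff (?X s) (?v s) z" if "s \<in> N" for s
    proof -
      have "sasaki_coeff (?X s) (?v s) z = (\<Sum>n\<in>{..<CARD('k)}. if n = 0 then h (x s) (vderiv 1 x s) (slot z 0) else 0)"
        unfolding sasaki_coeff_def slot_jetv_0
        by (rule sum.cong)
           (use x_in that in \<open>auto simp: acc0 cov_jetv inner_coeffD(10)[OF inner_h], simp add: acc_def\<close>)
      then show ?thesis by simp
    qed
    have "((\<lambda>s. sasaki_coeff (?X s) (?v s) z) has_real_derivative ?D) (at t)"
      using has_derivative_transform_within_open[OF d[unfolded has_field_derivative_def] open_N assms(1) eq]
      unfolding has_field_derivative_def .
    note EL = sasaki_euler_lagrange[OF assms(1) this]
    have F0: "FD (\<lambda>y. h y 0 0) (x t) = (\<lambda>w. 0)"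
    proof -
      have "FD (\<lambda>y. h y 0 0) (x t) = FD (\<lambda>y. 0) (x t)"
        by (rule FD_cong[OF open_U xU]) (simp add: inner_coeffD(10)[OF inner_h])
      then show ?thesis by simp
    qed
    \<comment> \<open>At order 0 \<open>cov\<close> reads the velocity only, which is frozen, so
      varying the jet changes nothing.\<close>
    have c0: "FD (\<lambda>Y. cov ?G 0 (Y, ?v t)) (?X t) z = 0" by simp
    have "(\<Sum>n<CARD('k). (FD (\<lambda>y. h y (acc n t) (acc n t)) (x t) (slot z 0)
       + 2 * h (x t) (acc n t) (FD (\<lambda>Y. cov ?G n (Y, ?v t)) (?X t) z)) / (fact n)\<^sup>2)
      = (\<Sum>n\<in>{..<CARD('k)}. if n = 0 then FD (\<lambda>y. h y (vderiv 1 x t) (vderiv 1 x t)) (x t) (slot z 0) else 0)"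
    proof (rule sum.cong[OF refl])
      fix n
      show "(FD (\<lambda>y. h y (acc n t) (acc n t)) (x t) (slot z 0)
       + 2 * h (x t) (acc n t) (FD (\<lambda>Y. cov ?G n (Y, ?v t)) (?X t) z)) / (fact n)\<^sup>2
       = (if n = 0 then FD (\<lambda>y. h y (vderiv 1 x t) (vderiv 1 x t)) (x t) (slot z 0) else 0)"
      proof (cases "n = 0")
        case True
        then show ?thesis using c0 by (simp add: ic(11) acc_def)
      next
        case False
        then show ?thesis using acc0[OF assms(1), of n] by (simp add: F0 ic(10))
      qed
    qed
    also have "\<dots> = FD (\<lambda>y. h y (vderiv 1 x t) (vderiv 1 x t)) (x t) (slot z 0)" by simp
    finally have "sasaki_coeff (?X t) (jet_acc TYPE('k) t) z
       = h (x t) (vderiv 1 (vderiv 1 x) t + ?G (x t) (vderiv 1 x t) (vderiv 1 x t)) (slot z 0)"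
      using EL is_lc_euler_lagrange[of h, OF inner_h[OF xU] is_lc_h[OF xU]] by simp
    also have "\<dots> = h (x t) (acc 1 t) (slot z 0)" by (simp add: acc_def covd_def One_nat_def)
    finally show ?thesis using assms(2)[OF assms(1)] by (simp add: ic(10))
  qed
  then show ?thesis
    by (intro inner_coeff_nondegenerate[OF inner_sasaki_coeff[OF inU]]) (simp add: inner_coeffD(10)[OF inner_sasaki_coeff[OF inU]])
qed

end

text \<open>Leibniz' rule for the scalar products \<open>f a b\<close> of the \<open>a\<close>-th and \<open>b\<close>-th derivative of a polynomial
  of degree \<open>d\<close>: among the \<open>f a a\<close>, the \<open>2 d\<close>-th derivative of \<open>f 0 0\<close> alone survives.\<close>

primrec leibniz :: "(nat \<Rightarrow> nat \<Rightarrow> real \<Rightarrow> real) \<Rightarrow> nat \<Rightarrow> nat \<Rightarrow> nat \<Rightarrow> real \<Rightarrow> real" where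
  "leibniz f 0 a b t = f a b t"
| "leibniz f (Suc n) a b t = leibniz f n (Suc a) b t + leibniz f n a (Suc b) t"

text \<open>In the application \<open>f a b\<close> is the scalar product of the covariant
  derivatives of orders \<open>a\<close> and \<open>b\<close>, so \<open>der\<close> is metric
  compatibility and \<open>zero\<close> says that the field has degree at most \<open>d\<close>. The
  weighted sum \<open>F 0\<close> is constant, hence its derivative of order \<open>2 * d\<close> is
  0.\<close>

lemma top_derivative_vanishes:
  fixes f :: "nat \<Rightarrow> nat \<Rightarrow> real \<Rightarrow> real"
  assumes "open I" "t \<in> I" "d \<ge> 1" "d \<le> k"
    and der: "\<And>a b s. s \<in> I \<Longrightarrow> (f a b has_real_derivative f (Suc a) b s + f a (Suc b) s) (at s)"
    and zero: "\<And>a b s. s \<in> I \<Longrightarrow> a > d \<or> b > d \<Longrightarrow> f a b s = 0"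
    and const: "\<And>s. s \<in> I \<Longrightarrow> ((\<lambda>s. \<Sum>a\<le>k. c a * f a a s) has_real_derivative 0) (at s)"
    and c: "c 0 > 0"
  shows "f d d t = 0"
proof -
  have L: "leibniz f 0 a b = f a b" "leibniz f (Suc n) a b = (\<lambda>s. leibniz f n (Suc a) b s + leibniz f n a (Suc b) s)" for n a b
    by (simp_all add: fun_eq_iff)
  have derL: "(leibniz f n a b has_real_derivative leibniz f (Suc n) a b s) (at s)" if "s \<in> I" for n a b s
  proof (induction n arbitrary: a b)
    case 0
    then show ?case unfolding L using der[OF that] .
  next
    case (Suc n)
    show ?case unfolding L(2)[of "Suc n"] by (subst L(2)) (rule DERIV_add[OF Suc Suc])
  qed
  \<comment> \<open>When \<open>2 * d\<close> derivatives are distributed in total, only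
    \<open>f d d\<close> survives, and the binomial coefficient counts the choices of the
    \<open>d - a\<close> that fall on the first factor. For \<open>b > d\<close> this coefficient is
    0.\<close>
  have val: "leibniz f n a b s = (if a \<le> d then real (n choose (d - a)) * f d d s else 0)"
    if "a + b + n = 2 * d" "s \<in> I" for n a b s
    using that(1)
  proof (induction n arbitrary: a b)
    case 0
    show ?case
    proof (cases "a = d")
      case False
      then have "a > d \<or> b > d" using 0 by linarith
      then show ?thesis using zero[OF that(2)] False by auto
    qed (use 0 in auto)
  next
    case (Suc n)
    have "leibniz f (Suc n) a b s = (if Suc a \<le> d then real (n choose (d - Suc a)) * f d d s else 0)
        + (if a \<le> d then real (n choose (d - a)) * f d d s else 0)"
      using Suc.IH[of "Suc a" b] Suc.IH[of a "Suc b"] Suc.prems by simp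
    moreover have "Suc n choose (d - a) = (n choose (d - Suc a)) + (n choose (d - a))" if "a < d"
    proof -
      have "d - a = Suc (d - Suc a)" using that by simp
      then show ?thesis by (metis binomial_Suc_Suc)
    qed
    ultimately show ?case
      by (cases "a < d"; cases "a = d") (auto simp: algebra_simps)
  qed
  have large: "leibniz f n a b s = 0" if "a + b + n > 2 * d" "s \<in> I" for n a b s
    using that(1)
  proof (induction n arbitrary: a b)
    case 0
    then have "a > d \<or> b > d" by linarith
    then show ?case using zero[OF that(2)] by simp
  qed simp
  define F where "F n s = (\<Sum>a\<le>k. c a * leibniz f n a a s)" for n s
  have derF: "(F n has_real_derivative F (Suc n) s) (at s)" if "s \<in> I" for n s
  proof -
    have "((\<lambda>s. \<Sum>a\<le>k. c a * leibniz f n a a s) has_real_derivative (\<Sum>a\<le>k. c a * leibniz f (Suc n) a a s)) (at s)"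
      by (intro DERIV_sum DERIV_cmult derL that)
    then show ?thesis unfolding F_def .
  qed
  have F0: "F (Suc n) s = 0" if "s \<in> I" for n s
    using that
  proof (induction n arbitrary: s)
    case 0
    have "(F 0 has_real_derivative 0) (at s)"
      using const[OF 0] by (simp add: F_def[abs_def])
    then show ?case using DERIV_unique[OF derF[OF 0, of 0]] by simp
  next
    case (Suc n)
    have "((\<lambda>s. 0) has_real_derivative F (Suc (Suc n)) s) (at s)"
      using has_derivative_transform_within_open[OF derF[OF Suc.prems, of "Suc n", unfolded has_field_derivative_def] assms(1) Suc.prems Suc.IH]
      by (simp add: has_field_derivative_def)
    then show ?case using DERIV_unique[OF _ DERIV_const] by blast
  qed
  have "0 = F (2 * d) t" using F0[OF assms(2), of "2 * d - 1"] assms(3) by simp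
  \<comment> \<open>The summand \<open>a\<close> carries \<open>2 * a + 2 * d\<close> derivatives in
    total, too many unless \<open>a = 0\<close>.\<close>
  also have "\<dots> = (\<Sum>a\<le>k. if a = 0 then c 0 * (real (2 * d choose d) * f d d t) else 0)"
    unfolding F_def by (rule sum.cong) (use val[of 0 0 "2 * d" t] large[OF _ assms(2)] assms(2) in auto)
  also have "\<dots> = c 0 * (real (2 * d choose d) * f d d t)" by simp
  finally show ?thesis using c by (simp add: mult_2)
qed

section \<open>Tangent vectors of a manifold\<close>

abbreviation cimage :: "('p, 'e) chart \<Rightarrow> 'e set" where "cimage c \<equiv> cmap c ` cdom c"
abbreviation overlap :: "('p, 'e) chart \<Rightarrow> ('p, 'e) chart \<Rightarrow> 'e set" where
  "overlap c d \<equiv> cmap c ` (cdom c \<inter> cdom d)"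
abbreviation trans_map :: "('p, 'e) chart \<Rightarrow> ('p, 'e) chart \<Rightarrow> 'e \<Rightarrow> 'e" where
  "trans_map c d \<equiv> \<lambda>y. cmap d (cinv c y)"

definition tangent :: "('p, 'e::euclidean_space) atlas \<Rightarrow> 'p \<Rightarrow> 'p jet set" where
  "tangent A p = {jet A 1 r | r. smooth_near_0 A r \<and> r 0 = p}"

lemma smooth_on_shift:
  fixes f :: "real \<Rightarrow> 'a::real_normed_vector"
  assumes "open N" "smooth_on N f"
  shows "open {s. t + s \<in> N}" "smooth_on {s. t + s \<in> N} (\<lambda>s :: real. f (t + s))"
proof -
  show o: "open {s. t + s \<in> N}"
    using open_vimage[OF assms(1), of "\<lambda>s. t + s"] by (simp add: vimage_def continuous_intros)
  show "smooth_on {s. t + s \<in> N} (\<lambda>s. f (t + s))"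
    by (rule smooth_on_compose[OF o assms(1) _ assms(2)])
       (auto intro!: smooth_on_add o smooth_on_const smooth_on_linear[OF bounded_linear_ident])
qed

lemma smooth_into_shift:
  fixes q :: "real \<Rightarrow> 'p"
  assumes "smooth_into A N q"
  shows "smooth_into A {s. t + s \<in> N} (\<lambda>s. q (t + s))"
  unfolding smooth_into_def
proof
  fix s assume "s \<in> {s. t + s \<in> N}"
  then obtain c M where M: "c \<in> A" "open M" "t + s \<in> M" "M \<subseteq> N" "q ` M \<subseteq> cdom c" "smooth_on M (cmap c \<circ> q)"
    using assms unfolding smooth_into_def by blast
  have "smooth_on {s. t + s \<in> M} (cmap c \<circ> (\<lambda>s. q (t + s)))"
    using smooth_on_shift(2)[OF M(2,6)] by (simp add: o_def)
  then show "\<exists>c\<in>A. \<exists>M. open M \<and> s \<in> M \<and> M \<subseteq> {s. t + s \<in> N} \<and> (\<lambda>s. q (t + s)) ` M \<subseteq> cdom c \<and> smooth_on M (cmap c \<circ> (\<lambda>s. q (t + s)))"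
    using M smooth_on_shift(1)[OF M(2,6)] by (intro bexI[OF _ M(1)] exI[of _ "{s. t + s \<in> M}"]) auto
qed

lemma smooth_intoI_chart:
  assumes "c \<in> A" "open N" "f ` N \<subseteq> cdom c" "smooth_on N (\<lambda>s. cmap c (f s))"
  shows "smooth_into A N f"
  using assms unfolding smooth_into_def o_def by blast

lemma smooth_near_0I: "open N \<Longrightarrow> 0 \<in> N \<Longrightarrow> smooth_into A N f \<Longrightarrow> smooth_near_0 A f"
  unfolding smooth_near_0_def by blast

lemma smooth_near_0_shift:
  fixes q :: "real \<Rightarrow> 'p"
  shows "open N \<Longrightarrow> t \<in> N \<Longrightarrow> smooth_into A N q \<Longrightarrow> smooth_near_0 A (\<lambda>s. q (t + s))"
  using smooth_into_shift[of A N q t] smooth_on_shift(1)[OF _ smooth_on_const, of N t] by (intro smooth_near_0I) auto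

lemma chart_atI:
  assumes "c \<in> A" "p \<in> cdom c"
  shows "chart_at A p \<in> A" "p \<in> cdom (chart_at A p)"
  using someI[of "\<lambda>c. c \<in> A \<and> p \<in> cdom c" c] assms unfolding chart_at_def by auto

lemma jetI: "smooth_near_0 A q \<Longrightarrow> q \<in> jet A k q"
  unfolding jet_def by simp

lemma jetD:
  assumes "r \<in> jet A k q"
  shows "smooth_near_0 A r" "r 0 = q 0" "c \<in> A \<Longrightarrow> q 0 \<in> cdom c \<Longrightarrow> i \<le> k \<Longrightarrow> vderiv i (\<lambda>s. cmap c (r s)) 0 = vderiv i (\<lambda>s. cmap c (q s)) 0"
  using assms unfolding jet_def o_def by auto

lemma jrep_jet: "smooth_near_0 A q \<Longrightarrow> jrep (jet A k q) \<in> jet A k q"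
  unfolding jrep_def by (rule someI[of "\<lambda>r. r \<in> jet A k q"]) (rule jetI)

lemma jbase_jet: "smooth_near_0 A q \<Longrightarrow> jbase (jet A k q) = q 0"
  unfolding jbase_def using jetD(2)[OF jrep_jet] .

lemma jet_eqI:
  assumes "q 0 = r 0" "\<And>c i. c \<in> A \<Longrightarrow> r 0 \<in> cdom c \<Longrightarrow> i \<le> k \<Longrightarrow> vderiv i (\<lambda>s. cmap c (q s)) 0 = vderiv i (\<lambda>s. cmap c (r s)) 0"
  shows "jet A k q = jet A k r"
  unfolding jet_def o_def using assms by auto

lemma tcoord_jet:
  assumes "smooth_near_0 A q" "c \<in> A" "q 0 \<in> cdom c"
  shows "tcoord c (jet A 1 q) = vderiv 1 (\<lambda>s. cmap c (q s)) 0"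
  using jetD(3)[OF jrep_jet[OF assms(1)] assms(2,3), of 1] by (simp add: tcoord_def vderiv_def o_def One_nat_def)

lemma smooth_near_0_cong:
  assumes "smooth_near_0 A q" "open N" "0 \<in> N" "\<And>s. s \<in> N \<Longrightarrow> q s = r s"
  shows "smooth_near_0 A r"
proof -
  obtain M where M: "open M" "0 \<in> M" "smooth_into A M q" using assms(1) unfolding smooth_near_0_def by blast
  have "smooth_into A (M \<inter> N) r"
    unfolding smooth_into_def
  proof
    fix x assume "x \<in> M \<inter> N"
    then obtain c L where L: "c \<in> A" "open L" "x \<in> L" "L \<subseteq> M" "q ` L \<subseteq> cdom c" "smooth_on L (cmap c \<circ> q)" "x \<in> N"
      using M(3) unfolding smooth_into_def by blast
    have "smooth_on (L \<inter> N) (cmap c \<circ> r)"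
      by (rule smooth_on_cong[OF open_Int[OF L(2) assms(2)] _ smooth_on_subset[OF L(6)]]) (auto simp: assms(4))
    moreover have "r ` (L \<inter> N) \<subseteq> cdom c"
      using L(5) assms(4) by (auto simp: image_subset_iff)
    ultimately show "\<exists>c\<in>A. \<exists>K. open K \<and> x \<in> K \<and> K \<subseteq> M \<inter> N \<and> r ` K \<subseteq> cdom c \<and> smooth_on K (cmap c \<circ> r)"
      using L assms(2) by (intro bexI[OF _ L(1)] exI[of _ "L \<inter> N"]) auto
  qed
  then show ?thesis using M assms(2,3) by (intro smooth_near_0I[of "M \<inter> N"]) auto
qed

lemma jet_cong:
  assumes "open N" "0 \<in> N" "\<And>s. s \<in> N \<Longrightarrow> q s = r s"
  shows "jet A k q = jet A k r"
  by (rule jet_eqI) (use assms(2,3) in \<open>auto intro!: vderiv_cong[OF assms(1,2)]\<close>)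

locale smooth_atlas_loc =
  fixes A :: "('p, 'e::euclidean_space) atlas"
  assumes smooth_atlas: "smooth_atlas A"
begin

lemma open_cimage: "c \<in> A \<Longrightarrow> open (cimage c)"
  and inj_chart: "c \<in> A \<Longrightarrow> inj_on (cmap c) (cdom c)"
  and open_overlap: "c \<in> A \<Longrightarrow> d \<in> A \<Longrightarrow> open (overlap c d)"
  using smooth_atlas unfolding smooth_atlas_def by blast+

lemma smooth_trans: "c \<in> A \<Longrightarrow> d \<in> A \<Longrightarrow> smooth_on (overlap c d) (trans_map c d)"
  using smooth_atlas unfolding smooth_atlas_def o_def by blast

lemma cinv_cmap: "c \<in> A \<Longrightarrow> p \<in> cdom c \<Longrightarrow> cinv c (cmap c p) = p"
  by (simp add: inj_chart inv_into_f_f)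

lemma cmap_cinv: "y \<in> cimage c \<Longrightarrow> cmap c (cinv c y) = y" "y \<in> cimage c \<Longrightarrow> cinv c y \<in> cdom c"
  by (auto intro: f_inv_into_f inv_into_into)

lemma overlap_cinv: "c \<in> A \<Longrightarrow> y \<in> overlap c d \<Longrightarrow> cinv c y \<in> cdom c \<inter> cdom d"
  by (auto simp: cinv_cmap)

text \<open>\<open>smooth_into\<close> provides some chart around each point. Composition with a
  transition map turns it into the prescribed chart \<open>c\<close>.\<close>

lemma smooth_into_chart:
  assumes "c \<in> A" "smooth_into A S f"
  shows "open {s \<in> S. f s \<in> cdom c}" "smooth_on {s \<in> S. f s \<in> cdom c} (\<lambda>s. cmap c (f s))"
proof -
  let ?T = "{s \<in> S. f s \<in> cdom c}"
  have *: "\<exists>M. open M \<and> s \<in> M \<and> M \<subseteq> ?T \<and> smooth_on M (\<lambda>s. cmap c (f s))" if s: "s \<in> ?T" for s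
  proof -
    obtain d N where N: "d \<in> A" "open N" "s \<in> N" "N \<subseteq> S" "f ` N \<subseteq> cdom d" "smooth_on N (\<lambda>s. cmap d (f s))"
      using bspec[OF assms(2)[unfolded smooth_into_def o_def], of s] s by auto
    \<comment> \<open>The condition of lying in both charts is put in terms of coordinates, so that
      \<open>M\<close> is a preimage of an open set under a continuous map.\<close>
    define M where "M = {y \<in> N. cmap d (f y) \<in> overlap d c}"
    have oM: "open M"
      unfolding M_def
      using continuous_open_preimage[OF smooth_on_continuous_on[OF N(6)] N(2) open_overlap[OF N(1) assms(1)]]
      by (simp add: vimage_def Int_def)
    have Mc: "f y \<in> cdom c \<inter> cdom d" if "y \<in> M" for y
      using that N(5) inj_onD[OF inj_chart[OF N(1)], of "f y"] unfolding M_def by auto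
    have "smooth_on M (\<lambda>s. trans_map d c (cmap d (f s)))"
      by (rule smooth_on_compose[OF oM open_overlap[OF N(1) assms(1)] _ smooth_trans[OF N(1) assms(1)]])
         (use N(6) in \<open>auto simp: M_def intro: smooth_on_subset\<close>)
    then have "smooth_on M (\<lambda>s. cmap c (f s))"
      by (rule smooth_on_cong[OF oM, rotated]) (simp add: cinv_cmap[OF N(1) IntD2[OF Mc]])
    moreover have "s \<in> M" using s N by (auto simp: M_def)
    moreover have "M \<subseteq> N" by (auto simp: M_def)
    then have "M \<subseteq> ?T" using Mc N(4) by blast
    ultimately show ?thesis using oM by blast
  qed
  then show "open ?T" by (subst open_subopen) blast
  show "smooth_on ?T (\<lambda>s. cmap c (f s))" by (rule smooth_on_local) (use * in blast)
qed

lemma smooth_near_0_chart: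
  assumes "c \<in> A" "smooth_near_0 A q" "q 0 \<in> cdom c"
  obtains N where "open N" "0 \<in> N" "q ` N \<subseteq> cdom c" "smooth_on N (\<lambda>s. cmap c (q s))"
proof -
  obtain M where M: "open M" "0 \<in> M" "smooth_into A M q" using assms(2) unfolding smooth_near_0_def by blast
  show ?thesis
    by (rule that[of "{s \<in> M. q s \<in> cdom c}"]) (use smooth_into_chart[OF assms(1) M(3)] M assms(3) in auto)
qed

lemma tangentD:
  assumes "v \<in> tangent A p"
  obtains r where "v = jet A 1 r" "smooth_near_0 A r" "r 0 = p"
  using assms unfolding tangent_def by blast

lemma tangentI: "smooth_near_0 A r \<Longrightarrow> r 0 = p \<Longrightarrow> jet A 1 r \<in> tangent A p"
  unfolding tangent_def by blast

lemma jbase_tangent: "v \<in> tangent A p \<Longrightarrow> jbase v = p"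
  by (auto elim!: tangentD simp: jbase_jet)

lemma tcoord_change:
  assumes "v \<in> tangent A p" "c \<in> A" "d \<in> A" "p \<in> cdom c" "p \<in> cdom d"
  shows "tcoord d v = FD (trans_map c d) (cmap c p) (tcoord c v)"
proof -
  obtain r where r: "v = jet A 1 r" "smooth_near_0 A r" "r 0 = p" using tangentD[OF assms(1)] .
  obtain N where N: "open N" "0 \<in> N" "r ` N \<subseteq> cdom c" "smooth_on N (\<lambda>s. cmap c (r s))"
    using smooth_near_0_chart[OF assms(2) r(2)] r(3) assms(4) by metis
  have "cmap c p \<in> overlap c d" using assms by auto
  from has_vector_derivative_FD[OF has_vector_derivative_smooth[OF N(4,2)], of "trans_map c d"]
    smooth_on_differentiable[OF smooth_trans[OF assms(2,3)] this]
  have "((\<lambda>s. trans_map c d (cmap c (r s))) has_vector_derivative FD (trans_map c d) (cmap c p) (vderiv 1 (\<lambda>s. cmap c (r s)) 0)) (at 0)"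
    by (simp add: r(3))
  then have "((\<lambda>s. cmap d (r s)) has_vector_derivative FD (trans_map c d) (cmap c p) (vderiv 1 (\<lambda>s. cmap c (r s)) 0)) (at 0)"
    by (rule has_vector_derivative_transform_within_open[OF _ N(1,2)]) (use N(3) cinv_cmap[OF assms(2)] in auto)
  then show ?thesis
    using tcoord_jet[OF r(2) assms(2)] tcoord_jet[OF r(2) assms(3)] assms(4,5) r(1,3)
    by (simp add: vderiv_def One_nat_def vector_derivative_at)
qed

text \<open>A 1-jet records the components in all charts, but those in one chart determine the
  others through the differential of the transition map.\<close>

lemma tangent_eqI:
  assumes "v \<in> tangent A p" "w \<in> tangent A p" "c \<in> A" "p \<in> cdom c" "tcoord c v = tcoord c w"
  shows "v = w"
proof -
  obtain r where r: "v = jet A 1 r" "smooth_near_0 A r" "r 0 = p" using tangentD[OF assms(1)] .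
  obtain q where q: "w = jet A 1 q" "smooth_near_0 A q" "q 0 = p" using tangentD[OF assms(2)] .
  show ?thesis
    unfolding r(1) q(1)
  proof (rule jet_eqI)
    fix d i assume d: "d \<in> A" "q 0 \<in> cdom d" "i \<le> (1::nat)"
    have "tcoord d v = tcoord d w"
      using tcoord_change[OF assms(1,3) d(1) assms(4)] tcoord_change[OF assms(2,3) d(1) assms(4)] assms(5) d(2) q(3) by simp
    then have "vderiv 1 (\<lambda>s. cmap d (r s)) 0 = vderiv 1 (\<lambda>s. cmap d (q s)) 0"
      using tcoord_jet[OF r(2) d(1)] tcoord_jet[OF q(2) d(1)] d(2) q r by simp
    moreover have "i = 0 \<or> i = 1" using d(3) by linarith
    ultimately show "vderiv i (\<lambda>s. cmap d (r s)) 0 = vderiv i (\<lambda>s. cmap d (q s)) 0"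
      using r(3) q(3) by auto
  qed (simp add: r q)
qed

lemma smooth_chart_curve:
  assumes "c \<in> A" "open N" "0 \<in> N" "x ` N \<subseteq> cimage c" "smooth_on N x"
  shows "smooth_near_0 A (\<lambda>s. cinv c (x s))"
proof (rule smooth_near_0I[OF assms(2,3) smooth_intoI_chart[OF assms(1,2)]])
  show "(\<lambda>s. cinv c (x s)) ` N \<subseteq> cdom c" using assms(4) by (auto intro!: cmap_cinv(2)[of _ c])
  show "smooth_on N (\<lambda>s. cmap c (cinv c (x s)))"
    by (rule smooth_on_cong[OF assms(2) _ assms(5)]) (use assms(4) cmap_cinv(1)[of _ c] in auto)
qed

lemma line_nhd:
  fixes x a :: 'e
  assumes "open U" "x \<in> U"
  shows "open {t. x + t *\<^sub>R a \<in> U}" "0 \<in> {t. x + t *\<^sub>R a \<in> U}"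
  using open_vimage[OF assms(1), of "\<lambda>t. x + t *\<^sub>R a"] assms(2) by (simp_all add: vimage_def continuous_intros)

lemma smooth_on_line: "open N \<Longrightarrow> smooth_on N (\<lambda>t :: real. x + t *\<^sub>R a)"
  by (intro smooth_on_add smooth_on_const smooth_on_linear[OF bounded_linear_scaleR_left])

lemma
  assumes "c \<in> A" "x \<in> cimage c"
  shows smooth_near_0_line: "smooth_near_0 A (\<lambda>t. cinv c (x + t *\<^sub>R a))"
    and tvec_tangent: "tvec A c x a \<in> tangent A (cinv c x)"
    and tcoord_tvec: "tcoord c (tvec A c x a) = a"
proof -
  note N = line_nhd[OF open_cimage[OF assms(1)] assms(2), of a]
  show sn: "smooth_near_0 A (\<lambda>t. cinv c (x + t *\<^sub>R a))"
    by (rule smooth_chart_curve[OF assms(1) N _ smooth_on_line[OF N(1)]]) auto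
  then show "tvec A c x a \<in> tangent A (cinv c x)"
    unfolding tvec_def by (rule tangentI) simp
  have "vderiv 1 (\<lambda>t. cmap c (cinv c (x + t *\<^sub>R a))) 0 = vderiv 1 (\<lambda>t. x + t *\<^sub>R a) 0"
    by (rule vderiv_cong[OF N]) (simp add: cmap_cinv(1))
  also have "\<dots> = a"
    using vector_derivative_at[OF has_vector_derivative_line] by (simp add: vderiv_def One_nat_def)
  finally show "tcoord c (tvec A c x a) = a"
    using tcoord_jet[OF sn assms(1)] cmap_cinv(2)[OF assms(2)] by (simp add: tvec_def)
qed

lemma tvec_tangent': "c \<in> A \<Longrightarrow> p \<in> cdom c \<Longrightarrow> tvec A c (cmap c p) a \<in> tangent A p"
  using tvec_tangent[of c "cmap c p" a] cinv_cmap by auto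

lemma tvec_tcoord:
  assumes "v \<in> tangent A p" "c \<in> A" "p \<in> cdom c"
  shows "tvec A c (cmap c p) (tcoord c v) = v"
  by (rule tangent_eqI[OF tvec_tangent'[OF assms(2,3)] assms]) (simp add: tcoord_tvec assms)

lemma tzero_eq_tvec: "c \<in> A \<Longrightarrow> p \<in> cdom c \<Longrightarrow> tzero A p = tvec A c (cmap c p) 0"
  unfolding tzero_def tvec_def by (simp add: cinv_cmap)

lemma tvec_eq_tzero_iff: "c \<in> A \<Longrightarrow> p \<in> cdom c \<Longrightarrow> tvec A c (cmap c p) a = tzero A p \<longleftrightarrow> a = 0"
  using tcoord_tvec[of c "cmap c p"] by (metis imageI tzero_eq_tvec)

lemma tangent_eq_tzero_iff: "v \<in> tangent A p \<Longrightarrow> c \<in> A \<Longrightarrow> p \<in> cdom c \<Longrightarrow> v = tzero A p \<longleftrightarrow> tcoord c v = 0"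
  using tvec_eq_tzero_iff tvec_tcoord by metis

lemma FD_trans_linear:
  assumes "c \<in> A" "d \<in> A" "p \<in> cdom c" "p \<in> cdom d"
  shows "linear (FD (trans_map c d) (cmap c p))"
  by (rule linear_frechet_derivative[OF smooth_on_differentiable[OF smooth_trans[OF assms(1,2)]]]) (use assms in auto)

text \<open>\<open>tscale\<close> is defined through the chart chosen by \<open>chart_at\<close>.
  Linearity of the differential of the transition map makes it scale the components in every
  chart.\<close>

lemma
  assumes "v \<in> tangent A p" "c \<in> A" "p \<in> cdom c"
  shows tscale_tangent: "tscale A r v \<in> tangent A p"
    and tcoord_tscale: "tcoord c (tscale A r v) = r *\<^sub>R tcoord c v"
proof -
  let ?d = "chart_at A p"
  note d = chart_atI[OF assms(2,3)]
  have ts: "tscale A r v = tvec A ?d (cmap ?d p) (r *\<^sub>R tcoord ?d v)"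
    by (simp add: tscale_def jbase_tangent[OF assms(1)] Let_def)
  show t: "tscale A r v \<in> tangent A p" unfolding ts by (rule tvec_tangent'[OF d])
  have "tcoord ?d (tscale A r v) = r *\<^sub>R tcoord ?d v" unfolding ts by (rule tcoord_tvec) (use d in auto)
  then show "tcoord c (tscale A r v) = r *\<^sub>R tcoord c v"
    using tcoord_change[OF t d(1) assms(2) d(2) assms(3)] tcoord_change[OF assms(1) d(1) assms(2) d(2) assms(3)]
      linear_scale[OF FD_trans_linear[OF d(1) assms(2) d(2) assms(3)]] by simp
qed

lemma metric_tangent:
  assumes "v \<in> tangent A p" "w \<in> tangent A p" "c \<in> A" "p \<in> cdom c"
  shows "g v w = metric_in A g c (cmap c p) (tcoord c v) (tcoord c w)"
  unfolding metric_in_def by (simp add: tvec_tcoord[OF _ assms(3,4)] assms(1,2))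

lemma
  assumes "open N" "smooth_into A N q" "t \<in> N"
  shows velocity_tangent: "velocity A q t \<in> tangent A (q t)"
    and tcoord_velocity: "c \<in> A \<Longrightarrow> q t \<in> cdom c \<Longrightarrow> tcoord c (velocity A q t) = vderiv 1 (\<lambda>s. cmap c (q s)) t"
proof -
  note sn = smooth_near_0_shift[OF assms(1,3,2)]
  show "velocity A q t \<in> tangent A (q t)"
    unfolding velocity_def jet_lift_def by (rule tangentI[OF sn]) simp
  show "tcoord c (velocity A q t) = vderiv 1 (\<lambda>s. cmap c (q s)) t" if "c \<in> A" "q t \<in> cdom c"
    unfolding velocity_def jet_lift_def using tcoord_jet[OF sn that(1)] that(2) vderiv_shift[of 1 "\<lambda>s. cmap c (q s)" t 0] by simp
qed

text \<open>This evaluates \<open>nabla\<close> in the chart that its definition selects. It is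
  stated for a smooth atlas and any \<open>g\<close>, so it can be applied to the jet atlas with the
  Sasaki metric.\<close>

lemma nabla_chart_at:
  assumes "open N" "t \<in> N" "\<And>s. s \<in> N \<Longrightarrow> V s \<in> tangent A (q s)" "c = chart_at A (q t)"
  shows "nabla A g V t = tvec A c (cmap c (q t)) (covd (christoffel A g c) (\<lambda>s. cmap c (q s)) (\<lambda>s. tcoord c (V s)) t)"
proof -
  have b: "jbase (V s) = q s" if "s \<in> N" for s using jbase_tangent assms(3) that by blast
  have "vector_derivative (\<lambda>s. cmap c (jbase (V s))) (at t) = vector_derivative (\<lambda>s. cmap c (q s)) (at t)"
    by (rule vector_derivative_cong_open[OF assms(1,2)]) (simp add: b)
  then show ?thesis
    unfolding nabla_def by (simp add: Let_def b[OF assms(2)] assms(4)[symmetric] covd_def vderiv_def One_nat_def)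
qed

end

section \<open>Covariant derivatives along curves\<close>

lemma christoffel_eq: "christoffel A g c = levi_civita (metric_in A g c)"
  unfolding christoffel_def levi_civita_def is_lc_def by (rule ext) simp

locale riem = smooth_atlas_loc A for A :: "('p, 'e::euclidean_space) atlas" +
  fixes g :: "'p metric"
  assumes riem: "riemannian_manifold A g"
begin

lemma metric_coords: "c \<in> A \<Longrightarrow> metric_coords (cimage c) (metric_in A g c)"
  using riem open_cimage unfolding riemannian_manifold_def metric_coords_def inner_coeff_def by auto

lemma metric_transform:
  assumes "c \<in> A" "d \<in> A" "y \<in> overlap c d"
  shows "metric_in A g c y a b = metric_in A g d (trans_map c d y) (FD (trans_map c d) y a) (FD (trans_map c d) y b)"
proof -
  let ?p = "cinv c y"
  have p: "?p \<in> cdom c" "?p \<in> cdom d" using overlap_cinv[OF assms(1,3)] by auto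
  have y: "cmap c ?p = y" "y \<in> cimage c" using assms(3) cmap_cinv(1)[of y c] by auto
  have "tvec A c y a = tvec A d (cmap d ?p) (FD (trans_map c d) y a)" for a
  proof -
    note t = tvec_tangent[OF assms(1) y(2), of a]
    have "tcoord d (tvec A c y a) = FD (trans_map c d) y a"
      using tcoord_change[OF t assms(1,2) p] by (simp add: y tcoord_tvec[OF assms(1)])
    then show ?thesis using tvec_tcoord[OF t assms(2) p(2)] by simp
  qed
  then show ?thesis by (simp add: metric_in_def)
qed

lemma levi_civita_trans:
  assumes "c \<in> A" "d \<in> A" "x \<in> overlap c d"
  shows "FD (trans_map c d) x (levi_civita (metric_in A g c) x a b) =
    levi_civita (metric_in A g d) (trans_map c d x) (FD (trans_map c d) x a) (FD (trans_map c d) x b)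
      + FD (\<lambda>y. FD (trans_map c d) y b) x a"
proof -
  interpret C: metric_coords "cimage c" "metric_in A g c" by (rule metric_coords[OF assms(1)])
  interpret D: metric_coords "cimage d" "metric_in A g d" by (rule metric_coords[OF assms(2)])
  show ?thesis
    by (rule levi_civita_transform[OF open_overlap[OF assms(1,2)] assms(3) _ D.open_U _ D.inner_h D.smooth_h smooth_trans[OF assms(1,2)]])
       (use C.inner_h metric_transform[OF assms(1,2)] overlap_cinv[OF assms(1)] in auto)
qed

end

locale riem_curve = riem A g for A :: "('p, 'e::euclidean_space) atlas" and g +
  fixes N :: "real set" and q :: "real \<Rightarrow> 'p"
  assumes open_N: "open N" and smooth_q: "smooth_into A N q"
begin

definition Nc :: "('p, 'e) chart \<Rightarrow> real set" where
  "Nc c = {s \<in> N. q s \<in> cdom c}"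

text \<open>Smooth fields along \<open>q\<close>. The class is closed under \<open>nabla\<close>, as
  iterating the covariant derivative requires.\<close>

definition vfield :: "(real \<Rightarrow> 'p jet) \<Rightarrow> bool" where
  "vfield V \<longleftrightarrow> (\<forall>s\<in>N. V s \<in> tangent A (q s)) \<and> (\<forall>c\<in>A. smooth_on (Nc c) (\<lambda>s. tcoord c (V s)))"

lemma vfieldD: "vfield V \<Longrightarrow> s \<in> N \<Longrightarrow> V s \<in> tangent A (q s)" "vfield V \<Longrightarrow> c \<in> A \<Longrightarrow> smooth_on (Nc c) (\<lambda>s. tcoord c (V s))"
  unfolding vfield_def by auto

lemma open_Nc: "c \<in> A \<Longrightarrow> open (Nc c)"
  and smooth_Nc: "c \<in> A \<Longrightarrow> smooth_on (Nc c) (\<lambda>s. cmap c (q s))"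
  unfolding Nc_def using smooth_into_chart[OF _ smooth_q] by auto

lemma ex_chart: "t \<in> N \<Longrightarrow> \<exists>c\<in>A. t \<in> Nc c"
  using smooth_q unfolding smooth_into_def Nc_def by blast

lemma metric_curve: "c \<in> A \<Longrightarrow> metric_curve (cimage c) (metric_in A g c) (Nc c) (\<lambda>s. cmap c (q s))"
  by (intro metric_curve.intro metric_coords metric_curve_axioms.intro open_Nc smooth_Nc) (auto simp: Nc_def)

lemma vfield_velocity: "vfield (velocity A q)"
  unfolding vfield_def
proof (intro conjI ballI)
  show "velocity A q s \<in> tangent A (q s)" if "s \<in> N" for s
    by (rule velocity_tangent[OF open_N smooth_q that])
  show "smooth_on (Nc c) (\<lambda>s. tcoord c (velocity A q s))" if "c \<in> A" for c
    by (rule smooth_on_cong[OF open_Nc[OF that] _ smooth_on_vderiv[OF open_Nc[OF that] smooth_Nc[OF that]]])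
       (use tcoord_velocity[OF open_N smooth_q _ that] in \<open>auto simp: Nc_def\<close>)
qed

text \<open>Independence of charts. The value comes from the chart selected at time
  \<open>t\<close>; near \<open>t\<close> the curve and the field are carried to \<open>c\<close>,
  where the transformation law of the Christoffel symbols gives the same formula.\<close>

lemma
  assumes "vfield V" "c \<in> A" "t \<in> Nc c"
  shows nabla_tangent: "nabla A g V t \<in> tangent A (q t)"
    and tcoord_nabla: "tcoord c (nabla A g V t) =
      covd (levi_civita (metric_in A g c)) (\<lambda>s. cmap c (q s)) (\<lambda>s. tcoord c (V s)) t"
proof -
  let ?d = "chart_at A (q t)"
  have t: "t \<in> N" "q t \<in> cdom c" using assms(3) by (auto simp: Nc_def)
  note d = chart_atI[OF assms(2) t(2)]
  let ?D = "covd (levi_civita (metric_in A g ?d)) (\<lambda>s. cmap ?d (q s)) (\<lambda>s. tcoord ?d (V s)) t"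
  have n: "nabla A g V t = tvec A ?d (cmap ?d (q t)) ?D"
    using nabla_chart_at[OF open_N t(1) vfieldD(1)[OF assms(1)] refl] by (simp add: christoffel_eq)
  show nt: "nabla A g V t \<in> tangent A (q t)" unfolding n by (rule tvec_tangent'[OF d])
  have "tcoord ?d (nabla A g V t) = ?D" unfolding n by (rule tcoord_tvec) (use d in auto)
  then have "tcoord c (nabla A g V t) = FD (trans_map ?d c) (cmap ?d (q t)) ?D"
    using tcoord_change[OF nt d(1) assms(2) d(2) t(2)] by simp
  also have "\<dots> = covd (levi_civita (metric_in A g c)) (\<lambda>s. trans_map ?d c (cmap ?d (q s)))
      (\<lambda>s. FD (trans_map ?d c) (cmap ?d (q s)) (tcoord ?d (V s))) t"
  proof (rule covd_transform[symmetric, OF open_Int[OF open_Nc[OF d(1)] open_Nc[OF assms(2)]] _ _ _ _ smooth_trans[OF d(1) assms(2)] open_overlap[OF d(1) assms(2)]])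
    show tM: "t \<in> Nc ?d \<inter> Nc c" using t d by (auto simp: Nc_def)
    show "smooth_on (Nc ?d \<inter> Nc c) (\<lambda>s. cmap ?d (q s))" "smooth_on (Nc ?d \<inter> Nc c) (\<lambda>s. tcoord ?d (V s))"
      using smooth_Nc[OF d(1)] vfieldD(2)[OF assms(1) d(1)] by (auto intro: smooth_on_subset)
    show sub: "(\<lambda>s. cmap ?d (q s)) ` (Nc ?d \<inter> Nc c) \<subseteq> overlap ?d c" by (auto simp: Nc_def)
    have "cmap ?d (q t) \<in> overlap ?d c" using tM sub by blast
    then show "FD (trans_map ?d c) (cmap ?d (q t)) (levi_civita (metric_in A g ?d) (cmap ?d (q t)) a b) =
      levi_civita (metric_in A g c) (trans_map ?d c (cmap ?d (q t))) (FD (trans_map ?d c) (cmap ?d (q t)) a) (FD (trans_map ?d c) (cmap ?d (q t)) b)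
      + FD (\<lambda>y. FD (trans_map ?d c) y b) (cmap ?d (q t)) a" for a b
      by (rule levi_civita_trans[OF d(1) assms(2)])
  qed
  also have "\<dots> = covd (levi_civita (metric_in A g c)) (\<lambda>s. cmap c (q s)) (\<lambda>s. tcoord c (V s)) t"
  proof (rule covd_cong[OF open_Int[OF open_Nc[OF d(1)] open_Nc[OF assms(2)]]])
    show "t \<in> Nc ?d \<inter> Nc c" using t d by (auto simp: Nc_def)
    fix s assume s: "s \<in> Nc ?d \<inter> Nc c"
    then show "trans_map ?d c (cmap ?d (q s)) = cmap c (q s)" using cinv_cmap[OF d(1)] by (simp add: Nc_def)
    show "FD (trans_map ?d c) (cmap ?d (q s)) (tcoord ?d (V s)) = tcoord c (V s)"
      using tcoord_change[OF vfieldD(1)[OF assms(1)] d(1) assms(2)] s by (simp add: Nc_def)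
  qed
  finally show "tcoord c (nabla A g V t) = covd (levi_civita (metric_in A g c)) (\<lambda>s. cmap c (q s)) (\<lambda>s. tcoord c (V s)) t" .
qed

lemma vfield_nabla: "vfield V \<Longrightarrow> vfield (nabla A g V)"
  unfolding vfield_def[of "nabla A g V"]
proof (intro conjI ballI)
  assume V: "vfield V"
  show "nabla A g V s \<in> tangent A (q s)" if "s \<in> N" for s
    using ex_chart[OF that] nabla_tangent[OF V] by blast
  show "smooth_on (Nc c) (\<lambda>s. tcoord c (nabla A g V s))" if c: "c \<in> A" for c
  proof -
    interpret metric_curve "cimage c" "metric_in A g c" "Nc c" "\<lambda>s. cmap c (q s)" by (rule metric_curve[OF c])
    show ?thesis
      by (rule smooth_on_cong[OF open_Nc[OF c] _ smooth_on_covd[OF open_U bilinear_\<Gamma> smooth_\<Gamma> open_Nc[OF c] smooth_x x_in vfieldD(2)[OF V c]]])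
         (simp_all add: tcoord_nabla[OF V c])
  qed
qed

lemma vfield_nabla_pow: "vfield V \<Longrightarrow> vfield ((nabla A g ^^ n) V)"
  by (induction n) (auto intro: vfield_nabla)

text \<open>The definition of \<open>nabla\<close> may select a new chart at each time. Since
  \<open>tcoord_nabla\<close> holds on all of the open set \<open>Nc c\<close>, the derivatives can
  nevertheless all be taken in \<open>c\<close>.\<close>

lemma tcoord_nabla_pow:
  assumes "vfield V" "c \<in> A" "t \<in> Nc c"
  shows "tcoord c ((nabla A g ^^ n) V t) = (covd (levi_civita (metric_in A g c)) (\<lambda>s. cmap c (q s)) ^^ n) (\<lambda>s. tcoord c (V s)) t"
  using assms(3)
proof (induction n arbitrary: t)
  case (Suc n)
  show ?case
    using tcoord_nabla[OF vfield_nabla_pow[OF assms(1)] assms(2) Suc.prems, of n]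
      covd_cong[OF open_Nc[OF assms(2)] Suc.prems refl Suc.IH] by simp
qed simp

lemma has_derivative_metric:
  assumes "vfield V" "vfield W" "t \<in> N"
  shows "((\<lambda>s. g (V s) (W s)) has_real_derivative g (nabla A g V t) (W t) + g (V t) (nabla A g W t)) (at t)"
proof -
  obtain c where c: "c \<in> A" "t \<in> Nc c" using ex_chart[OF assms(3)] by blast
  interpret metric_curve "cimage c" "metric_in A g c" "Nc c" "\<lambda>s. cmap c (q s)" by (rule metric_curve[OF c(1)])
  have m: "g (V s) (W s) = metric_in A g c (cmap c (q s)) (tcoord c (V s)) (tcoord c (W s))"
    if "s \<in> Nc c" "vfield V" "vfield W" for s V W
    using that by (intro metric_tangent[OF _ _ c(1)] vfieldD(1)) (auto simp: Nc_def)
  have "((\<lambda>s. metric_in A g c (cmap c (q s)) (tcoord c (V s)) (tcoord c (W s))) has_real_derivative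
    metric_in A g c (cmap c (q t)) (tcoord c (nabla A g V t)) (tcoord c (W t))
    + metric_in A g c (cmap c (q t)) (tcoord c (V t)) (tcoord c (nabla A g W t))) (at t)"
    unfolding tcoord_nabla[OF assms(1) c] tcoord_nabla[OF assms(2) c]
    by (rule has_derivative_metric_covd[OF open_U inner_h smooth_h open_Nc[OF c(1)] c(2) x_in smooth_x vfieldD(2)[OF assms(1) c(1)] vfieldD(2)[OF assms(2) c(1)]])
  then have "((\<lambda>s. metric_in A g c (cmap c (q s)) (tcoord c (V s)) (tcoord c (W s))) has_real_derivative
     g (nabla A g V t) (W t) + g (V t) (nabla A g W t)) (at t)"
    by (simp add: m[OF c(2) vfield_nabla[OF assms(1)] assms(2)] m[OF c(2) assms(1) vfield_nabla[OF assms(2)]])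
  then show ?thesis
    unfolding has_field_derivative_def
    by (rule has_derivative_transform_within_open[OF _ open_Nc[OF c(1)] c(2)]) (simp add: m assms(1,2))
qed

lemma metric_eq_0D:
  assumes "vfield V" "t \<in> N" "g (V t) (V t) = 0"
  shows "V t = tzero A (q t)"
proof -
  obtain c where c: "c \<in> A" "t \<in> Nc c" using ex_chart[OF assms(2)] by blast
  interpret metric_coords "cimage c" "metric_in A g c" by (rule metric_coords[OF c(1)])
  have p: "q t \<in> cdom c" using c(2) by (simp add: Nc_def)
  note V = vfieldD(1)[OF assms(1,2)]
  have "metric_in A g c (cmap c (q t)) (tcoord c (V t)) (tcoord c (V t)) = 0"
    using metric_tangent[OF V V c(1) p, of g] assms(3) by simp
  then have "tcoord c (V t) = 0"
    using inner_coeffD(3)[OF inner_h[of "cmap c (q t)"], of "tcoord c (V t)"] p by fastforce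
  then show ?thesis using tangent_eq_tzero_iff[OF V c(1) p] by simp
qed

lemma metric_tzero:
  assumes "vfield V" "t \<in> N"
  shows "g (tzero A (q t)) (V t) = 0" "g (V t) (tzero A (q t)) = 0"
proof -
  obtain c where c: "c \<in> A" "t \<in> Nc c" using ex_chart[OF assms(2)] by blast
  interpret metric_coords "cimage c" "metric_in A g c" by (rule metric_coords[OF c(1)])
  have p: "q t \<in> cdom c" using c(2) by (simp add: Nc_def)
  note V = vfieldD(1)[OF assms]
  have z: "tzero A (q t) \<in> tangent A (q t)" "tcoord c (tzero A (q t)) = 0"
    unfolding tzero_eq_tvec[OF c(1) p] using tvec_tangent'[OF c(1) p] tcoord_tvec[OF c(1)] p by auto
  show "g (tzero A (q t)) (V t) = 0" "g (V t) (tzero A (q t)) = 0"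
    using metric_tangent[OF z(1) V c(1) p, of g] metric_tangent[OF V z(1) c(1) p, of g] inner_coeffD(10,11)[OF inner_h[of "cmap c (q t)"]] p z(2)
    by simp_all
qed

end

section \<open>Charts of the jet manifold\<close>

text \<open>The Taylor polynomial with prescribed derivatives at 0. It provides a canonical curve
  for all jet coordinates, and one that is smooth jointly in the coordinates and the time.\<close>

definition poly_curve :: "'e::euclidean_space ^ 'k::finite \<Rightarrow> real \<Rightarrow> 'e" where
  "poly_curve X s = (\<Sum>i\<in>UNIV. (s ^ to_nat_on UNIV i / fact (to_nat_on UNIV i)) *\<^sub>R (X $ i))"

lemma smooth_on_power: "open S \<Longrightarrow> smooth_on S f \<Longrightarrow> smooth_on S (\<lambda>x. f x ^ n :: real)"
  by (induction n) (auto intro: smooth_on_const smooth_on_mult)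

lemma smooth_on_poly_curve:
  assumes "open S" "smooth_on S X" "smooth_on S r"
  shows "smooth_on S (\<lambda>p. poly_curve (X p) (r p))"
  unfolding poly_curve_def
  by (intro smooth_on_sum smooth_on_scaleR smooth_on_bounded_linear[OF _ bounded_linear_divide] smooth_on_power
        smooth_on_bounded_linear[OF _ bounded_linear_vec_nth] assms)

lemma jetv_poly_curve: "jetv (poly_curve X) 0 = (X :: 'e::euclidean_space ^ 'k::finite)"
proof (rule slot_eqI)
  fix n assume n: "n < CARD('k)"
  let ?i = "from_nat_into UNIV n :: 'k"
  have i: "to_nat_on UNIV i = n \<longleftrightarrow> i = ?i" for i :: 'k
    using to_nat_on_from_nat_into_less[OF n] by (metis countable_finite finite_class.finite_UNIV from_nat_into_to_nat_on UNIV_I)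
  have "vderiv n (poly_curve X) 0 = (\<Sum>i\<in>UNIV. vderiv n (\<lambda>s. (s ^ to_nat_on UNIV i / fact (to_nat_on UNIV i)) *\<^sub>R (X $ i)) 0)"
    unfolding poly_curve_def[abs_def]
    by (rule vderiv_sum[OF open_UNIV])
       (auto intro!: smooth_on_scaleR smooth_on_bounded_linear[OF _ bounded_linear_divide] smooth_on_power smooth_on_const
          smooth_on_linear[OF bounded_linear_ident])
  also have "\<dots> = (\<Sum>i\<in>UNIV. if i = ?i then X $ i else 0)"
    unfolding vderiv_monomial by (rule sum.cong) (auto simp: i[symmetric] power_0_left)
  also have "\<dots> = X $ ?i" by simp
  finally show "slot (jetv (poly_curve X) 0 :: 'e ^ 'k) n = slot X n"
    unfolding slot_jetv[OF n] slot_def[of X n] .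
qed

lemma poly_curve_0: "poly_curve X 0 = slot X 0"
  using jetv_poly_curve[of X] slot_jetv[of 0 "poly_curve X" 0] by (metis vderiv_0 zero_less_card_finite)

lemma smooth_into_compose:
  fixes L :: "real \<Rightarrow> 'd::euclidean_space"
  assumes "smooth_into A M F" "open T" "smooth_on T L" "L ` T \<subseteq> M"
  shows "smooth_into A T (\<lambda>s. F (L s))"
  unfolding smooth_into_def
proof
  fix s assume s: "s \<in> T"
  then have "L s \<in> M" using assms(4) by blast
  then obtain c N where N: "c \<in> A" "open N" "L s \<in> N" "F ` N \<subseteq> cdom c" "smooth_on N (cmap c \<circ> F)"
    using assms(1) unfolding smooth_into_def by blast
  define S where "S = T \<inter> L -` N"
  have oS: "open S"
    unfolding S_def using continuous_open_preimage[OF smooth_on_continuous_on[OF assms(3)] assms(2) N(2)] by (simp add: Int_commute)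
  have "smooth_on S (\<lambda>s. (cmap c \<circ> F) (L s))"
    by (rule smooth_on_compose[OF oS N(2) smooth_on_subset[OF assms(3)] N(5)]) (auto simp: S_def)
  then show "\<exists>c\<in>A. \<exists>N. open N \<and> s \<in> N \<and> N \<subseteq> T \<and> (\<lambda>s. F (L s)) ` N \<subseteq> cdom c \<and> smooth_on N (cmap c \<circ> (\<lambda>s. F (L s)))"
    using oS s N(3,4) by (intro bexI[OF _ N(1)] exI[of _ S]) (auto simp: S_def o_def)
qed

locale jet_manifold = riem A g for A :: "('p, 'e::euclidean_space) atlas" and g +
  fixes k :: nat and K :: "'k::finite itself"
  assumes card_k: "CARD('k) = Suc k"
begin

abbreviation JA :: "('p jet, 'e ^ 'k) atlas" where "JA \<equiv> jet_atlas A k"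
abbreviation JC :: "('p, 'e) chart \<Rightarrow> ('p jet, 'e ^ 'k) chart" where "JC \<equiv> jet_chart A k"

lemma cdom_JC: "cdom (JC c) = {u \<in> jets A k. jbase u \<in> cdom c}"
  by (simp add: jet_chart_def)

lemma cmap_JC: "cmap (JC c) u = jetv (\<lambda>s. cmap c (jrep u s)) 0"
  by (simp add: jet_chart_def jetv_def o_def)

lemma slot_cmap_JC_0: "slot (cmap (JC c) u) 0 = cmap c (jbase u)"
  by (simp add: cmap_JC slot_jetv jbase_def)

lemma
  assumes "smooth_near_0 A q" "c \<in> A" "q 0 \<in> cdom c"
  shows jet_in_JC: "jet A k q \<in> cdom (JC c)"
    and cmap_JC_jet: "cmap (JC c) (jet A k q) = jetv (\<lambda>s. cmap c (q s)) 0"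
proof -
  show "jet A k q \<in> cdom (JC c)"
    using assms jbase_jet[OF assms(1)] by (auto simp: cdom_JC jets_def)
  show "cmap (JC c) (jet A k q) = jetv (\<lambda>s. cmap c (q s)) 0"
    unfolding cmap_JC
    by (rule slot_eqI) (simp add: slot_jetv card_k jetD(3)[OF jrep_jet[OF assms(1)] assms(2,3)])
qed

lemma jetsD:
  assumes "u \<in> cdom (JC c)"
  obtains q where "u = jet A k q" "smooth_near_0 A q" "q 0 \<in> cdom c"
  using assms that by (auto simp: cdom_JC jets_def jbase_jet)

text \<open>The chain rule of order \<open>i\<close>, with the expression of Faa di Bruno in the
  form of \<open>prolong\<close>.\<close>

lemma vderiv_chart_change:
  assumes "smooth_near_0 A q" "c \<in> A" "d \<in> A" "q 0 \<in> cdom c" "q 0 \<in> cdom d" "i \<le> k"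
  shows "vderiv i (\<lambda>s. cmap d (q s)) 0 = prolong (trans_map c d) i (jetv (\<lambda>s. cmap c (q s)) 0 :: 'e ^ 'k)"
proof -
  obtain N where N: "open N" "0 \<in> N" "q ` N \<subseteq> cdom c" "smooth_on N (\<lambda>s. cmap c (q s))"
    using smooth_near_0_chart[OF assms(2,1,4)] .
  obtain M where M: "open M" "0 \<in> M" "q ` M \<subseteq> cdom d" "smooth_on M (\<lambda>s. cmap d (q s))"
    using smooth_near_0_chart[OF assms(3,1,5)] .
  have o: "open (N \<inter> M)" "0 \<in> N \<inter> M" using N M by auto
  have "vderiv i (\<lambda>s. cmap d (q s)) 0 = vderiv i (\<lambda>s. trans_map c d (cmap c (q s))) 0"
    by (rule vderiv_cong[OF o]) (use N(3) cinv_cmap[OF assms(2)] in \<open>simp add: image_subset_iff\<close>)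
  also have "\<dots> = prolong (trans_map c d) i (jetv (\<lambda>s. cmap c (q s)) 0 :: 'e ^ 'k)"
    by (rule vderiv_prolong[OF open_overlap[OF assms(2,3)] smooth_trans[OF assms(2,3)] o(1) smooth_on_subset[OF N(4)] _ _ o(2)])
       (use N(3) M(3) assms(6) card_k in auto)
  finally show ?thesis .
qed

text \<open>A jet is a class with respect to all charts of \<open>A\<close>. Derivatives in another
  chart are functions of those in \<open>c\<close>, so equal coordinates in \<open>c\<close> force
  equal classes.\<close>

lemma inj_JC:
  assumes c: "c \<in> A"
  shows "inj_on (cmap (JC c)) (cdom (JC c))"
proof (rule inj_onI)
  fix u v assume u: "u \<in> cdom (JC c)" and v: "v \<in> cdom (JC c)" and eq: "cmap (JC c) u = cmap (JC c) v"
  obtain q where q: "u = jet A k q" "smooth_near_0 A q" "q 0 \<in> cdom c" using jetsD[OF u] .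
  obtain r where r: "v = jet A k r" "smooth_near_0 A r" "r 0 \<in> cdom c" using jetsD[OF v] .
  have J: "(jetv (\<lambda>s. cmap c (q s)) 0 :: 'e ^ 'k) = jetv (\<lambda>s. cmap c (r s)) 0"
    using eq cmap_JC_jet[OF q(2) c q(3)] cmap_JC_jet[OF r(2) c r(3)] q(1) r(1) by simp
  have "slot (jetv (\<lambda>s. cmap c (q s)) 0 :: 'e ^ 'k) 0 = slot (jetv (\<lambda>s. cmap c (r s)) 0 :: 'e ^ 'k) 0"
    by (simp only: J)
  then have "cmap c (q 0) = cmap c (r 0)" by (simp add: slot_jetv)
  then have q0: "q 0 = r 0" using inj_onD[OF inj_chart[OF c]] q(3) r(3) by blast
  show "u = v"
    unfolding q(1) r(1)
  proof (rule jet_eqI[where q=q and r=r, OF q0])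
    fix d i assume d: "d \<in> A" "r 0 \<in> cdom d" "i \<le> k"
    then show "vderiv i (\<lambda>s. cmap d (q s)) 0 = vderiv i (\<lambda>s. cmap d (r s)) 0"
      using vderiv_chart_change[OF q(2) c d(1) q(3) _ d(3)] vderiv_chart_change[OF r(2) c d(1) r(3) d(2,3)] q0 J by simp
  qed
qed

text \<open>This makes the inverse of a jet chart explicit: the coordinates \<open>X\<close> belong
  to the jet of a polynomial in the chart \<open>c\<close>.\<close>

lemma poly_jet:
  assumes c: "c \<in> A" and X: "X \<in> jdom (cimage c)"
  shows "smooth_near_0 A (\<lambda>s. cinv c (poly_curve X s))"
    and "cmap (JC c) (jet A k (\<lambda>s. cinv c (poly_curve X s))) = (X :: 'e ^ 'k)"
    and "jet A k (\<lambda>s. cinv c (poly_curve X s)) \<in> cdom (JC c)"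
    and "jbase (jet A k (\<lambda>s. cinv c (poly_curve X s))) = cinv c (slot X 0)"
proof -
  have sm: "smooth_on S (poly_curve X)" if "open S" for S
    using smooth_on_poly_curve[OF that smooth_on_const smooth_on_linear[OF bounded_linear_ident], of X] by simp
  define N where "N = poly_curve X -` cimage c"
  have N: "open N"
    unfolding N_def using continuous_open_vimage[OF open_cimage[OF c], of "poly_curve X"]
      smooth_on_continuous_on[OF sm[OF open_UNIV]] by (simp add: continuous_on_eq_continuous_at)
  have N0: "0 \<in> N" using X by (simp add: N_def poly_curve_0 jdom_def)
  show s: "smooth_near_0 A (\<lambda>s. cinv c (poly_curve X s))"
    by (rule smooth_chart_curve[OF c N N0 _ sm[OF N]]) (auto simp: N_def)
  have "slot X 0 \<in> cimage c" using X by (simp add: jdom_def)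
  then have in_c: "cinv c (poly_curve X 0) \<in> cdom c" unfolding poly_curve_0 by (rule cmap_cinv(2))
  show "jet A k (\<lambda>s. cinv c (poly_curve X s)) \<in> cdom (JC c)" by (rule jet_in_JC[OF s c in_c])
  have "(jetv (\<lambda>s. cmap c (cinv c (poly_curve X s))) 0 :: 'e ^ 'k) = jetv (poly_curve X) 0"
    by (rule slot_eqI, simp only: slot_jetv, rule vderiv_cong[OF N N0]) (simp add: N_def cmap_cinv(1))
  then show "cmap (JC c) (jet A k (\<lambda>s. cinv c (poly_curve X s))) = X"
    unfolding cmap_JC_jet[OF s c in_c] by (simp add: jetv_poly_curve)
  show "jbase (jet A k (\<lambda>s. cinv c (poly_curve X s))) = cinv c (slot X 0)"
    unfolding jbase_jet[OF s] poly_curve_0 ..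
qed

lemma overlap_JC:
  assumes "c \<in> A"
  shows "overlap (JC c) (JC d) = jdom (overlap c d)"
proof (intro set_eqI iffI)
  fix X assume "X \<in> overlap (JC c) (JC d)"
  then obtain u where u: "u \<in> cdom (JC c)" "u \<in> cdom (JC d)" "X = cmap (JC c) u" by auto
  then have "jbase u \<in> cdom c \<inter> cdom d" by (simp add: cdom_JC)
  then show "X \<in> jdom (overlap c d)" unfolding u(3) jdom_def by (simp add: slot_cmap_JC_0)
next
  fix X :: "'e ^ 'k" assume X: "X \<in> jdom (overlap c d)"
  then have Xc: "X \<in> jdom (cimage c)" by (auto simp: jdom_def)
  note p = poly_jet[OF assms Xc]
  have "slot X 0 \<in> overlap c d" using X by (simp add: jdom_def)
  then have "cinv c (slot X 0) \<in> cdom d" using overlap_cinv[OF assms] by blast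
  then have "jet A k (\<lambda>s. cinv c (poly_curve X s)) \<in> cdom (JC d)" using p(3,4) by (simp add: cdom_JC)
  then show "X \<in> overlap (JC c) (JC d)" using p(2,3) by (metis IntI imageI)
qed

lemma cimage_JC: "c \<in> A \<Longrightarrow> cimage (JC c) = jdom (cimage c)"
  using overlap_JC[of c c] by simp

lemma cinv_JC:
  assumes "c \<in> A" "X \<in> jdom (cimage c)"
  shows "cinv (JC c) X = jet A k (\<lambda>s. cinv c (poly_curve X s))"
  using inv_into_f_f[OF inj_JC[OF assms(1)] poly_jet(3)[OF assms]] poly_jet(2)[OF assms] by simp

lemma smooth_trans_JC:
  assumes "c \<in> A" "d \<in> A"
  shows "smooth_on (jdom (overlap c d)) (trans_map (JC c) (JC d))"
proof (rule smooth_on_cong[OF open_jdom[OF open_overlap[OF assms]]])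
  let ?P = "\<lambda>X :: 'e ^ 'k. \<chi> i. prolong (trans_map c d) (to_nat_on (UNIV :: 'k set) i) X"
  show "smooth_on (jdom (overlap c d)) ?P"
    by (rule smooth_on_vec[OF open_jdom[OF open_overlap[OF assms]]])
       (simp add: smooth_on_prolong[OF open_overlap[OF assms] smooth_trans[OF assms]])
  show "?P X = trans_map (JC c) (JC d) X" if X: "X \<in> jdom (overlap c d)" for X
  proof -
    have Xc: "X \<in> jdom (cimage c)" using X by (auto simp: jdom_def)
    note p = poly_jet[OF assms(1) Xc]
    have "slot X 0 \<in> overlap c d" using X by (simp add: jdom_def)
    then have 0: "cinv c (poly_curve X 0) \<in> cdom c" "cinv c (poly_curve X 0) \<in> cdom d"
      unfolding poly_curve_0 using overlap_cinv[OF assms(1)] by auto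
    have X': "X = jetv (\<lambda>s. cmap c (cinv c (poly_curve X s))) 0"
      using p(2) cmap_JC_jet[OF p(1) assms(1) 0(1)] by simp
    have "trans_map (JC c) (JC d) X = jetv (\<lambda>s. cmap d (cinv c (poly_curve X s))) 0"
      unfolding cinv_JC[OF assms(1) Xc] by (rule cmap_JC_jet[OF p(1) assms(2) 0(2)])
    also have "\<dots> = ?P X"
    proof (rule slot_eqI)
      fix n assume n: "n < CARD('k)"
      then have "n \<le> k" by (simp add: card_k)
      then show "slot (jetv (\<lambda>s. cmap d (cinv c (poly_curve X s))) 0 :: 'e ^ 'k) n = slot (?P X) n"
        unfolding slot_jetv[OF n] slot_lambda[OF n, of "\<lambda>m. prolong (trans_map c d) m X"]
        using vderiv_chart_change[OF p(1) assms 0] X' by simp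
    qed
    finally show ?thesis ..
  qed
qed

lemma smooth_atlas_JA: "smooth_atlas JA"
  unfolding smooth_atlas_def jet_atlas_def
proof (intro conjI ballI; elim imageE)
  fix C D :: "('p jet, 'e ^ 'k) chart" and c d
  assume C: "C = JC c" "c \<in> A"
  show "inj_on (cmap C) (cdom C)" unfolding C(1) by (rule inj_JC[OF C(2)])
  show "open (cimage C)" unfolding C(1) cimage_JC[OF C(2)] by (rule open_jdom[OF open_cimage[OF C(2)]])
  assume D: "D = JC d" "d \<in> A"
  show "open (overlap C D)"
    unfolding C(1) D(1) overlap_JC[OF C(2)] by (rule open_jdom[OF open_overlap[OF C(2) D(2)]])
  show "smooth_on (overlap C D) (cmap D \<circ> cinv C)"
    unfolding C(1) D(1) overlap_JC[OF C(2)] o_def by (rule smooth_trans_JC[OF C(2) D(2)])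
qed

sublocale J: smooth_atlas_loc JA
  by (rule smooth_atlas_loc.intro) (rule smooth_atlas_JA)

lemma JC_in: "c \<in> A \<Longrightarrow> JC c \<in> JA"
  by (simp add: jet_atlas_def)

section \<open>The Sasaki metric in jet coordinates\<close>

text \<open>\<open>K_map\<close> selects a family by \<open>SOME\<close>, so one has to exist. The
  polynomials with coordinates \<open>X + s *\<^sub>R a\<close> do: their jets run along the
  straight line in the jet chart by which \<open>tvec\<close> represents \<open>W\<close>.\<close>

lemma represents_exists:
  assumes W: "W \<in> tangent JA u" and c: "c \<in> A" and u: "u \<in> cdom (JC c)"
  shows "\<exists>\<gamma>. represents A k W \<gamma>"
proof -
  define X where "X = cmap (JC c) u"
  define a where "a = tcoord (JC c) W"
  have X: "X \<in> jdom (cimage c)" unfolding X_def cimage_JC[OF c, symmetric] using u by blast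
  define \<gamma> where "\<gamma> s t = cinv c (poly_curve (X + s *\<^sub>R a) t)" for s t
  let ?P = "\<lambda>p :: real \<times> real. poly_curve (X + fst p *\<^sub>R a) (snd p)"
  have P: "smooth_on S ?P" if "open S" for S
    by (intro smooth_on_poly_curve[OF that] smooth_on_add[OF that] smooth_on_const smooth_on_linear
          bounded_linear_snd bounded_linear_compose[OF bounded_linear_scaleR_left bounded_linear_fst, unfolded o_def])
  define N where "N = ?P -` cimage c"
  have N: "open N"
    unfolding N_def
  proof (rule continuous_open_vimage[OF open_cimage[OF c]])
    show "isCont ?P p" for p
      using smooth_on_continuous_on[OF P[OF open_UNIV]] continuous_on_eq_continuous_at[OF open_UNIV, of ?P] by blast
  qed
  have N0: "0 \<in> N" using X by (simp add: N_def poly_curve_0 jdom_def)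
  have "smooth_on N (\<lambda>p. cmap c (case p of (s, t) \<Rightarrow> \<gamma> s t))"
    by (rule smooth_on_cong[OF N _ P[OF N]]) (auto simp: N_def \<gamma>_def cmap_cinv(1))
  moreover have "(\<lambda>p. case p of (s, t) \<Rightarrow> \<gamma> s t) ` N \<subseteq> cdom c"
    by (auto simp: N_def \<gamma>_def intro!: cmap_cinv(2)[of _ c])
  ultimately have sn: "smooth_near_0 A (\<lambda>(s, t). \<gamma> s t)"
    by (intro smooth_near_0I[OF N N0] smooth_intoI_chart[OF c N])
  note M = J.line_nhd[OF open_jdom[OF open_cimage[OF c]] X, of a]
  have eq: "cinv (JC c) (X + s *\<^sub>R a) = jet A k (\<gamma> s)" if "s \<in> {t. X + t *\<^sub>R a \<in> jdom (cimage c)}" for s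
    using cinv_JC[OF c, of "X + s *\<^sub>R a"] that by (simp add: \<gamma>_def[abs_def])
  have X': "X \<in> cimage (JC c)" using X cimage_JC[OF c] by simp
  have "W = tvec JA (JC c) X a"
    using J.tvec_tcoord[OF W JC_in[OF c] u] by (simp add: X_def a_def)
  also have "\<dots> = jet JA 1 (\<lambda>s. jet A k (\<gamma> s))"
    unfolding tvec_def by (rule jet_cong[OF M eq])
  finally have "(\<lambda>s. jet A k (\<gamma> s)) \<in> W"
    using jetI[OF smooth_near_0_cong[OF J.smooth_near_0_line[OF JC_in[OF c] X'] M eq]] by simp
  then show ?thesis using sn unfolding represents_def by blast
qed

abbreviation D1 :: "(real \<times> real \<Rightarrow> 'e) \<Rightarrow> real \<times> real \<Rightarrow> 'e" where "D1 f \<equiv> \<lambda>p. FD f p (1, 0)"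
abbreviation D2 :: "(real \<times> real \<Rightarrow> 'e) \<Rightarrow> real \<times> real \<Rightarrow> 'e" where "D2 f \<equiv> \<lambda>p. FD f p (0, 1)"

lemma smooth_on_D2_pow: "smooth_on M f \<Longrightarrow> smooth_on M ((D2 ^^ n) f)"
  by (induction n) (auto intro: smooth_on_FD)

text \<open>Jets are taken in the second variable, the velocity of the family in the first. Their
  exchange relates the jet of the variation field to the velocity of the jets.\<close>

lemma D1_D2_pow:
  assumes "open M" "smooth_on M f" "p \<in> M"
  shows "D1 ((D2 ^^ n) f) p = (D2 ^^ n) (D1 f) p"
  using assms(3)
proof (induction n arbitrary: p)
  case (Suc n)
  have "D1 ((D2 ^^ Suc n) f) p = D2 (D1 ((D2 ^^ n) f)) p"
    using FD_commute[OF assms(1) smooth_on_D2_pow[OF assms(2)] Suc.prems] by simp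
  also have "\<dots> = D2 ((D2 ^^ n) (D1 f)) p"
    using FD_cong[OF assms(1) Suc.prems, of "D1 ((D2 ^^ n) f)" "(D2 ^^ n) (D1 f)"] Suc.IH by simp
  finally show ?case by simp
qed simp

lemma vderiv_D2:
  assumes "open M" "smooth_on M f" "(s, t) \<in> M"
  shows "vderiv n (\<lambda>t. f (s, t)) t = (D2 ^^ n) f (s, t)"
  using assms(3)
proof (induction n arbitrary: t)
  case (Suc n)
  let ?T = "{t. (s, t) \<in> M}"
  have T: "open ?T" using open_vimage[OF assms(1), of "\<lambda>t. (s, t)"] by (simp add: vimage_def continuous_intros)
  have "((\<lambda>t. (s, t)) has_vector_derivative (0, 1)) (at t)"
    by (auto intro!: derivative_eq_intros simp: has_vector_derivative_def)
  from has_vector_derivative_FD[OF this smooth_on_differentiable[OF smooth_on_D2_pow[OF assms(2)] Suc.prems]]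
  have "((\<lambda>t. (D2 ^^ n) f (s, t)) has_vector_derivative (D2 ^^ Suc n) f (s, t)) (at t)" by simp
  then have "(vderiv n (\<lambda>t. f (s, t)) has_vector_derivative (D2 ^^ Suc n) f (s, t)) (at t)"
    by (rule has_vector_derivative_transform_within_open[OF _ T]) (use Suc in auto)
  then show ?case by (simp add: vderiv_Suc vector_derivative_at)
qed simp

lemma has_vector_derivative_D1:
  assumes "smooth_on M f" "(s, t) \<in> M"
  shows "((\<lambda>s. f (s, t)) has_vector_derivative D1 f (s, t)) (at s)"
proof -
  have "((\<lambda>s. (s, t)) has_vector_derivative (1, 0)) (at s)"
    by (auto intro!: derivative_eq_intros simp: has_vector_derivative_def)
  from has_vector_derivative_FD[OF this smooth_on_differentiable[OF assms]] show ?thesis .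
qed

text \<open>The result does not depend on the representing family. In a chart the n-th covariant
  derivative is determined by the jets in \<open>t\<close> of the curve \<open>\<gamma> 0\<close>
  and of its variation field; the first has the coordinates of \<open>u\<close>, the second the
  components of \<open>W\<close>.\<close>

lemma K_map_representative:
  assumes W: "W \<in> tangent JA u" and c: "c \<in> A" and u: "u \<in> cdom (JC c)" and \<gamma>: "represents A k W \<gamma>" and n: "n \<le> k"
  shows "(nabla A g ^^ n) (\<lambda>t. velocity A (\<lambda>s. \<gamma> s t) 0) 0 \<in> tangent A (jbase u)"
    and "tcoord c ((nabla A g ^^ n) (\<lambda>t. velocity A (\<lambda>s. \<gamma> s t) 0) 0)
      = cov (levi_civita (metric_in A g c)) n (cmap (JC c) u, tcoord (JC c) W)"
proof -
  let ?F = "\<lambda>(s, t). \<gamma> s t"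
  obtain M where M: "open M" "0 \<in> M" "smooth_into A M ?F"
    using \<gamma> unfolding represents_def smooth_near_0_def by blast
  have slice1: "open {s. (s, t) \<in> M}" "smooth_into A {s. (s, t) \<in> M} (\<lambda>s. \<gamma> s t)" for t
  proof -
    show o: "open {s. (s, t) \<in> M}"
      using open_vimage[OF M(1), of "\<lambda>s. (s, t)"] by (simp add: vimage_def continuous_intros)
    show "smooth_into A {s. (s, t) \<in> M} (\<lambda>s. \<gamma> s t)"
      using smooth_into_compose[OF M(3) o smooth_on_Pair[OF o smooth_on_linear[OF bounded_linear_ident] smooth_on_const]] by auto
  qed
  have slice2: "open {t. (s, t) \<in> M}" "smooth_into A {t. (s, t) \<in> M} (\<gamma> s)" for s
  proof -
    show o: "open {t. (s, t) \<in> M}"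
      using open_vimage[OF M(1), of "\<lambda>t. (s, t)"] by (simp add: vimage_def continuous_intros)
    show "smooth_into A {t. (s, t) \<in> M} (\<gamma> s)"
      using smooth_into_compose[OF M(3) o smooth_on_Pair[OF o smooth_on_const smooth_on_linear[OF bounded_linear_ident]]] by auto
  qed
  have M00: "(0, 0) \<in> M" using M(2) by (simp add: zero_prod_def)
  have sn: "smooth_near_0 A (\<gamma> s)" if "(s, 0) \<in> M" for s
    using smooth_near_0I[OF slice2(1) _ slice2(2)] that by blast
  obtain r where r: "W = jet JA 1 r" "smooth_near_0 JA r" "r 0 = u" using J.tangentD[OF W] .
  \<comment> \<open>Membership in this 1-jet fixes both the jet of \<open>\<gamma> 0\<close>, which
    is \<open>u\<close>, and the first derivative in \<open>s\<close> of the jet coordinates of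
    \<open>\<gamma> s\<close>.\<close>
  have mem: "(\<lambda>s. jet A k (\<gamma> s)) \<in> jet JA 1 r" using \<gamma> r(1) unfolding represents_def by simp
  have u0: "jet A k (\<gamma> 0) = u" using jetD(2)[OF mem] r(3) by simp
  have b: "\<gamma> 0 0 = jbase u" using jbase_jet[OF sn[OF M00], of k] u0 by simp
  have cb: "\<gamma> 0 0 \<in> cdom c" using u b by (simp add: cdom_JC)
  define Md where "Md d = {p \<in> M. ?F p \<in> cdom d}" for d :: "('p, 'e) chart"
  define f where "f d = (\<lambda>p. cmap d (?F p))" for d :: "('p, 'e) chart"
  have Md: "open (Md d)" "smooth_on (Md d) (f d)" if "d \<in> A" for d
    using smooth_into_chart[OF that M(3)] unfolding Md_def f_def by auto
  define T where "T = {t. (0, t) \<in> M}"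
  interpret C: riem_curve A g T "\<gamma> 0"
    by unfold_locales (use slice2 in \<open>auto simp: T_def\<close>)
  have Nc: "C.Nc d = {t. (0, t) \<in> M \<and> \<gamma> 0 t \<in> cdom d}" for d :: "('p, 'e) chart"
    unfolding C.Nc_def by (simp add: T_def)
  let ?V = "\<lambda>t. velocity A (\<lambda>s. \<gamma> s t) 0"
  have tV: "tcoord d (?V t) = D1 (f d) (0, t)" if "d \<in> A" "t \<in> C.Nc d" for d t
  proof -
    have t: "(0, t) \<in> M" "(0, t) \<in> Md d" using that(2) by (auto simp: Nc Md_def)
    have "tcoord d (?V t) = vderiv 1 (\<lambda>s. cmap d (\<gamma> s t)) 0"
      by (rule tcoord_velocity[OF slice1(1)[of t] slice1(2) _ that(1)]) (use t(1) that(2) in \<open>auto simp: Nc\<close>)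
    also have "\<dots> = D1 (f d) (0, t)"
      using has_vector_derivative_D1[OF Md(2)[OF that(1)] t(2)] by (simp add: f_def vderiv_def One_nat_def vector_derivative_at)
    finally show ?thesis .
  qed
  have V: "C.vfield ?V"
    unfolding C.vfield_def
  proof (intro conjI ballI)
    show "?V t \<in> tangent A (\<gamma> 0 t)" if "t \<in> T" for t
      by (rule velocity_tangent[OF slice1(1)[of t] slice1(2)]) (use that in \<open>simp add: T_def\<close>)
    show "smooth_on (C.Nc d) (\<lambda>t. tcoord d (?V t))" if d: "d \<in> A" for d
    proof (rule smooth_on_cong[OF C.open_Nc[OF d]])
      show "smooth_on (C.Nc d) (\<lambda>t. D1 (f d) (0, t))"
        by (rule smooth_on_compose[OF C.open_Nc[OF d] Md(1)[OF d] _ smooth_on_FD[OF Md(2)[OF d]]])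
           (rule smooth_on_Pair[OF C.open_Nc[OF d] smooth_on_const smooth_on_linear[OF bounded_linear_ident]], auto simp: Nc Md_def)
      show "D1 (f d) (0, t) = tcoord d (?V t)" if "t \<in> C.Nc d" for t using tV[OF d that] by simp
    qed
  qed
  have T0: "0 \<in> T" "0 \<in> C.Nc c" using M00 cb unfolding Nc by (simp_all add: T_def)
  have "(nabla A g ^^ n) ?V 0 \<in> tangent A (\<gamma> 0 0)" by (rule C.vfieldD(1)[OF C.vfield_nabla_pow[OF V] T0(1)])
  then show "(nabla A g ^^ n) ?V 0 \<in> tangent A (jbase u)" by (simp add: b)
  interpret m: metric_curve "cimage c" "metric_in A g c" "C.Nc c" "\<lambda>t. cmap c (\<gamma> 0 t)" by (rule C.metric_curve[OF c])
  have M00c: "(0, 0) \<in> Md c" using M00 cb by (simp add: Md_def)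
  have X: "jetv (\<lambda>t. cmap c (\<gamma> 0 t)) 0 = cmap (JC c) u"
    using cmap_JC_jet[OF sn[OF M00] c cb] by (simp add: u0)
  \<comment> \<open>Slot by slot: the component of \<open>W\<close> is the
    \<open>s\<close>-derivative of an n-th \<open>t\<close>-derivative, and the order of
    differentiation is exchanged.\<close>
  have a: "jetv (\<lambda>t. tcoord c (?V t)) 0 = tcoord (JC c) W"
  proof (rule slot_eqI)
    fix n assume n: "n < CARD('k)"
    let ?S = "{s. (s, 0) \<in> Md c}"
    have S: "open ?S" using open_vimage[OF Md(1)[OF c], of "\<lambda>s. (s, 0)"] by (simp add: vimage_def continuous_intros)
    have S0: "0 \<in> ?S" using M00c by simp
    have JS: "cmap (JC c) (jet A k (\<gamma> s)) = jetv (\<lambda>t. f c (s, t)) 0" if "s \<in> ?S" for s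
      using cmap_JC_jet[OF sn c] that by (simp add: f_def Md_def)
    have "tcoord (JC c) W = vderiv 1 (\<lambda>s. cmap (JC c) (jet A k (\<gamma> s))) 0"
      unfolding r(1) using tcoord_jet[OF r(2) JC_in[OF c]] jetD(3)[OF mem JC_in[OF c], of 1] u r(3) by simp
    also have "\<dots> = vderiv 1 (\<lambda>s. jetv (\<lambda>t. f c (s, t)) 0 :: 'e ^ 'k) 0"
      by (rule vderiv_cong[OF S S0 JS])
    finally have tW: "tcoord (JC c) W = vderiv 1 (\<lambda>s. jetv (\<lambda>t. f c (s, t)) 0 :: 'e ^ 'k) 0" .
    have comp: "(jetv (\<lambda>t. f c (s, t)) 0 :: 'e ^ 'k) $ i = (D2 ^^ to_nat_on UNIV i) (f c) (s, 0)" if "s \<in> ?S" for s i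
      using vderiv_D2[OF Md[OF c], of s 0] that by (simp add: jetv_def)
    have smS: "smooth_on ?S (\<lambda>s. jetv (\<lambda>t. f c (s, t)) 0 :: 'e ^ 'k)"
    proof (rule smooth_on_vec[OF S])
      fix i :: 'k
      have "smooth_on ?S (\<lambda>s. (D2 ^^ to_nat_on UNIV i) (f c) (s, 0))"
        by (rule smooth_on_compose[OF S Md(1)[OF c] _ smooth_on_D2_pow[OF Md(2)[OF c]]])
           (auto intro!: smooth_on_Pair S smooth_on_const smooth_on_linear[OF bounded_linear_ident])
      then show "smooth_on ?S (\<lambda>s. (jetv (\<lambda>t. f c (s, t)) 0 :: 'e ^ 'k) $ i)"
        by (rule smooth_on_cong[OF S, rotated]) (simp add: comp)
    qed
    have "((\<lambda>s. slot (jetv (\<lambda>t. f c (s, t)) 0 :: 'e ^ 'k) n) has_vector_derivative slot (tcoord (JC c) W) n) (at 0)"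
      unfolding tW by (rule bounded_linear.has_vector_derivative[OF bounded_linear_slot has_vector_derivative_smooth[OF smS S0]])
    then have "((\<lambda>s. (D2 ^^ n) (f c) (s, 0)) has_vector_derivative slot (tcoord (JC c) W) n) (at 0)"
      by (rule has_vector_derivative_transform_within_open[OF _ S S0])
         (use vderiv_D2[OF Md[OF c]] in \<open>simp add: slot_jetv n\<close>)
    from vector_derivative_unique_at[OF this has_vector_derivative_D1[OF smooth_on_D2_pow[OF Md(2)[OF c]] M00c]]
    have "slot (tcoord (JC c) W) n = (D2 ^^ n) (D1 (f c)) (0, 0)"
      using D1_D2_pow[OF Md[OF c] M00c] by simp
    also have "\<dots> = vderiv n (\<lambda>t. D1 (f c) (0, t)) 0"
      by (rule vderiv_D2[OF Md(1)[OF c] smooth_on_FD[OF Md(2)[OF c]] M00c, symmetric])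
    also have "\<dots> = vderiv n (\<lambda>t. tcoord c (?V t)) 0"
      by (rule vderiv_cong[OF C.open_Nc[OF c] T0(2)]) (simp add: tV[OF c])
    finally show "slot (jetv (\<lambda>t. tcoord c (?V t)) 0 :: 'e ^ 'k) n = slot (tcoord (JC c) W) n"
      by (simp add: slot_jetv n)
  qed
  have "tcoord c ((nabla A g ^^ n) ?V 0) = (covd (levi_civita (metric_in A g c)) (\<lambda>t. cmap c (\<gamma> 0 t)) ^^ n) (\<lambda>t. tcoord c (?V t)) 0"
    by (rule C.tcoord_nabla_pow[OF V c T0(2)])
  also have "\<dots> = cov (levi_civita (metric_in A g c)) n (jetv (\<lambda>t. cmap c (\<gamma> 0 t)) 0 :: 'e ^ 'k, jetv (\<lambda>t. tcoord c (?V t)) 0)"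
    by (rule m.covd_pow_eq_cov[OF C.open_Nc[OF c] m.smooth_x C.vfieldD(2)[OF V c] m.x_in _ T0(2)]) (simp add: card_k n less_Suc_eq_le)
  finally show "tcoord c ((nabla A g ^^ n) ?V 0) = cov (levi_civita (metric_in A g c)) n (cmap (JC c) u, tcoord (JC c) W)"
    by (simp only: X a)
qed

text \<open>\<open>K_0\<close> is defined separately, by projecting a curve of jets. Slot 0 of a jet
  chart is the base point, so its components are slot 0 of those of \<open>W\<close>, that is
  \<open>cov\<close> of order 0, and \<open>fact 0 = 1\<close> fits the common formula.\<close>

lemma K_map_coords:
  assumes W: "W \<in> tangent JA u" and c: "c \<in> A" and u: "u \<in> cdom (JC c)" and n: "n \<le> k"
  shows "K_map A g k n W \<in> tangent A (jbase u) \<and>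
    tcoord c (K_map A g k n W) = (1 / fact n) *\<^sub>R cov (levi_civita (metric_in A g c)) n (cmap (JC c) u, tcoord (JC c) W)"
proof (cases "n = 0")
  case True
  obtain r where r: "W = jet JA 1 r" "smooth_near_0 JA r" "r 0 = u" using J.tangentD[OF W] .
  define R where "R = jrep W"
  have R: "R \<in> jet JA 1 r" using jrep_jet[OF r(2)] by (simp add: R_def r(1))
  have R0: "R 0 = u" using jetD(2)[OF R] r(3) by simp
  obtain N where N: "open N" "0 \<in> N" "R ` N \<subseteq> cdom (JC c)" "smooth_on N (\<lambda>s. cmap (JC c) (R s))"
    using J.smooth_near_0_chart[OF JC_in[OF c] jetD(1)[OF R]] R0 u by metis
  have tW: "tcoord (JC c) W = vderiv 1 (\<lambda>s. cmap (JC c) (R s)) 0"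
    unfolding r(1) using tcoord_jet[OF r(2) JC_in[OF c]] jetD(3)[OF R JC_in[OF c], of 1] u r(3) by simp
  have si: "smooth_into A N (\<lambda>s. jbase (R s))"
  proof (rule smooth_intoI_chart[OF c N(1)])
    show "(\<lambda>s. jbase (R s)) ` N \<subseteq> cdom c" using N(3) by (auto simp: cdom_JC)
    show "smooth_on N (\<lambda>s. cmap c (jbase (R s)))"
      using smooth_on_bounded_linear[OF N(1) bounded_linear_slot N(4), of 0] by (simp add: slot_cmap_JC_0)
  qed
  have "((\<lambda>s. slot (cmap (JC c) (R s)) 0) has_vector_derivative slot (tcoord (JC c) W) 0) (at 0)"
    unfolding tW by (rule bounded_linear.has_vector_derivative[OF bounded_linear_slot has_vector_derivative_smooth[OF N(4,2)]])
  then have v: "vderiv 1 (\<lambda>s. cmap c (jbase (R s))) 0 = slot (tcoord (JC c) W) 0"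
    by (simp add: slot_cmap_JC_0 vderiv_def One_nat_def vector_derivative_at)
  have K: "K_map A g k n W = velocity A (\<lambda>s. jbase (R s)) 0"
    using True by (simp add: K_map_def R_def o_def)
  have "jbase u \<in> cdom c" using u by (simp add: cdom_JC)
  then show ?thesis
    unfolding K using velocity_tangent[OF N(1) si N(2)] tcoord_velocity[OF N(1) si N(2) c] v True by (simp add: R0)
next
  case False
  define \<gamma> where "\<gamma> = (SOME \<gamma>. represents A k W \<gamma>)"
  have \<gamma>: "represents A k W \<gamma>"
    unfolding \<gamma>_def by (rule someI_ex[OF represents_exists[OF W c u]])
  have K: "K_map A g k n W = tscale A (1 / fact n) ((nabla A g ^^ n) (\<lambda>t. velocity A (\<lambda>s. \<gamma> s t) 0) 0)"
    using False by (simp add: K_map_def \<gamma>_def Let_def)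
  note rep = K_map_representative[OF W c u \<gamma> n]
  have "jbase u \<in> cdom c" using u by (simp add: cdom_JC)
  then show ?thesis
    unfolding K using tscale_tangent[OF rep(1) c] tcoord_tscale[OF rep(1) c] by (simp add: rep(2))
qed

lemma metric_in_sasaki:
  assumes c: "c \<in> A" and X: "X \<in> jdom (cimage c)"
  shows "metric_in JA (sasaki_metric A g k) (JC c) X a b = metric_coords.sasaki_coeff (metric_in A g c) X a b"
proof -
  interpret m: metric_coords "cimage c" "metric_in A g c" by (rule metric_coords[OF c])
  let ?u = "cinv (JC c) X" and ?h = "metric_in A g c"
  have X': "X \<in> cimage (JC c)" using X cimage_JC[OF c] by simp
  have u: "?u \<in> cdom (JC c)" "cmap (JC c) ?u = X" using J.cmap_cinv[OF X'] by auto
  have b: "jbase ?u \<in> cdom c" "cmap c (jbase ?u) = slot X 0"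
    using u slot_cmap_JC_0[of c ?u] by (simp_all add: cdom_JC)
  have ic: "inner_coeff (?h (slot X 0))" using m.inner_h X by (simp add: jdom_def)
  have K: "K_map A g k n (tvec JA (JC c) X a) \<in> tangent A (jbase ?u)"
    "tcoord c (K_map A g k n (tvec JA (JC c) X a)) = (1 / fact n) *\<^sub>R cov (levi_civita ?h) n (X, a)" if "n \<le> k" for n a
    using K_map_coords[OF J.tvec_tangent[OF JC_in[OF c] X'] c u(1) that] by (simp_all add: u(2) J.tcoord_tvec[OF JC_in[OF c] X'])
  have "g (K_map A g k n (tvec JA (JC c) X a)) (K_map A g k n (tvec JA (JC c) X b))
    = ?h (slot X 0) (cov (levi_civita ?h) n (X, a)) (cov (levi_civita ?h) n (X, b)) / (fact n)\<^sup>2" if "n \<le> k" for n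
    using metric_tangent[OF K(1)[OF that] K(1)[OF that] c b(1), of g]
    by (simp add: K(2)[OF that] b(2) inner_coeffD(6,7)[OF ic] power2_eq_square)
  then show ?thesis
    unfolding metric_in_def sasaki_metric_def m.sasaki_coeff_def card_k lessThan_Suc_atMost
    by (intro sum.cong) auto
qed

text \<open>The two coefficient functions agree only over the chart. Since that domain is open,
  their derivatives agree as well, so the same \<open>\<Gamma>\<close> satisfy the defining
  conditions.\<close>

lemma christoffel_sasaki:
  assumes c: "c \<in> A" and X: "X \<in> jdom (cimage c)"
  shows "christoffel JA (sasaki_metric A g k) (JC c) X = levi_civita (metric_coords.sasaki_coeff (metric_in A g c)) X"
  unfolding christoffel_eq levi_civita_def
  using is_lc_cong[OF open_jdom[OF open_cimage[OF c]] X metric_in_sasaki[OF c]] by simp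

end

section \<open>The lift of a curve to the jet manifold\<close>

locale jet_curve = jet_manifold A g k K + riem_curve A g N q
  for A :: "('p, 'e::euclidean_space) atlas" and g k and K :: "'k::finite itself" and N q
begin

abbreviation lift :: "real \<Rightarrow> 'p jet" where "lift \<equiv> jet_lift A k q"

lemma
  assumes "c \<in> A" "s \<in> Nc c"
  shows lift_in: "lift s \<in> cdom (JC c)"
    and cmap_lift: "cmap (JC c) (lift s) = jetv (\<lambda>s. cmap c (q s)) s"
proof -
  have s: "s \<in> N" "q (s + 0) \<in> cdom c" using assms(2) by (auto simp: Nc_def)
  note sn = smooth_near_0_shift[OF open_N s(1) smooth_q]
  show "lift s \<in> cdom (JC c)" unfolding jet_lift_def by (rule jet_in_JC[OF sn assms(1) s(2)])
  show "cmap (JC c) (lift s) = jetv (\<lambda>s. cmap c (q s)) s"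
    unfolding jet_lift_def cmap_JC_jet[OF sn assms(1) s(2)]
    using vderiv_shift[of _ "\<lambda>s. cmap c (q s)" s 0] by (simp add: jetv_def)
qed

lemma smooth_into_lift: "smooth_into JA N lift"
  unfolding smooth_into_def
proof
  fix t assume "t \<in> N"
  then obtain c where c: "c \<in> A" "t \<in> Nc c" using ex_chart by blast
  have "smooth_on (Nc c) (cmap (JC c) \<circ> lift)"
    unfolding o_def
    by (rule smooth_on_cong[OF open_Nc[OF c(1)] _ smooth_on_jetv[OF open_Nc[OF c(1)] smooth_Nc[OF c(1)]]])
       (simp add: cmap_lift[OF c(1)])
  then show "\<exists>C\<in>JA. \<exists>M. open M \<and> t \<in> M \<and> M \<subseteq> N \<and> lift ` M \<subseteq> cdom C \<and> smooth_on M (cmap C \<circ> lift)"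
    using c open_Nc[OF c(1)] lift_in[OF c(1)] by (intro bexI[OF _ JC_in[OF c(1)]] exI[of _ "Nc c"]) (auto simp: Nc_def)
qed

definition jacc :: "('p, 'e) chart \<Rightarrow> real \<Rightarrow> 'e ^ 'k" where
  "jacc c = covd (levi_civita (metric_coords.sasaki_coeff (metric_in A g c))) (jetv (\<lambda>s. cmap c (q s))) (vderiv 1 (jetv (\<lambda>s. cmap c (q s))))"

text \<open>The chart \<open>c\<close> is the one whose jet chart \<open>chart_at\<close> selects at
  \<open>lift t\<close>; it depends on \<open>t\<close>. The equation is thus available in one chart
  at a time, and the users of this lemma are arranged accordingly.\<close>

lemma nabla_lift_eq_tzero_iff:
  assumes t: "t \<in> N"
  shows "\<exists>c\<in>A. t \<in> Nc c \<and>
    (nabla JA (sasaki_metric A g k) (velocity JA lift) t = tzero JA (lift t) \<longleftrightarrow> jacc c t = 0)"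
proof -
  obtain c0 where c0: "c0 \<in> A" "t \<in> Nc c0" using ex_chart[OF t] by blast
  have ca: "chart_at JA (lift t) \<in> JA" "lift t \<in> cdom (chart_at JA (lift t))"
    using chart_atI[OF JC_in[OF c0(1)] lift_in[OF c0]] by auto
  then obtain c where c: "c \<in> A" "chart_at JA (lift t) = JC c" by (auto simp: jet_atlas_def)
  have lt: "lift t \<in> cdom (JC c)" using ca(2) c(2) by simp
  have "jbase (lift t) = q t"
    unfolding jet_lift_def using jbase_jet[OF smooth_near_0_shift[OF open_N t smooth_q]] by simp
  then have tc: "t \<in> Nc c" using lt t by (simp add: cdom_JC Nc_def)
  let ?x = "\<lambda>s. cmap c (q s)"
  let ?S = "sasaki_metric A g k"
  have "nabla JA ?S (velocity JA lift) t = tvec JA (JC c) (cmap (JC c) (lift t))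
     (covd (christoffel JA ?S (JC c)) (\<lambda>s. cmap (JC c) (lift s)) (\<lambda>s. tcoord (JC c) (velocity JA lift s)) t)"
    by (rule J.nabla_chart_at[where q=lift and c="JC c", OF open_N t J.velocity_tangent[OF open_N smooth_into_lift] c(2)[symmetric]])
  then have "nabla JA ?S (velocity JA lift) t = tzero JA (lift t) \<longleftrightarrow>
     covd (christoffel JA ?S (JC c)) (\<lambda>s. cmap (JC c) (lift s)) (\<lambda>s. tcoord (JC c) (velocity JA lift s)) t = 0"
    using J.tvec_eq_tzero_iff[OF JC_in[OF c(1)] lt] by simp
  also have "covd (christoffel JA ?S (JC c)) (\<lambda>s. cmap (JC c) (lift s)) (\<lambda>s. tcoord (JC c) (velocity JA lift s)) t
     = covd (christoffel JA ?S (JC c)) (jetv ?x) (vderiv 1 (jetv ?x)) t"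
  proof (rule covd_cong[OF open_Nc[OF c(1)] tc cmap_lift[OF c(1)]])
    fix s assume s: "s \<in> Nc c"
    have "tcoord (JC c) (velocity JA lift s) = vderiv 1 (\<lambda>s. cmap (JC c) (lift s)) s"
      using J.tcoord_velocity[OF open_N smooth_into_lift _ JC_in[OF c(1)] lift_in[OF c(1) s]] s by (simp add: Nc_def)
    also have "\<dots> = vderiv 1 (jetv ?x) s"
      by (rule vderiv_cong[OF open_Nc[OF c(1)] s cmap_lift[OF c(1)]])
    finally show "tcoord (JC c) (velocity JA lift s) = vderiv 1 (jetv ?x) s" .
  qed
  also have "\<dots> = jacc c t"
  proof -
    have "(jetv ?x t :: 'e ^ 'k) \<in> jdom (cimage c)" using tc by (auto simp: jdom_def slot_jetv Nc_def)
    then show ?thesis unfolding jacc_def covd_def by (simp add: christoffel_sasaki[OF c(1)])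
  qed
  finally show ?thesis using c(1) tc by blast
qed

lemma jet_acc_jacc:
  assumes "c \<in> A"
  shows "metric_curve.jet_acc (metric_in A g c) (\<lambda>s. cmap c (q s)) TYPE('k) = jacc c"
  using metric_curve.jet_acc_def[OF metric_curve[OF assms], where K="TYPE('k)"] by (simp add: jacc_def)

abbreviation acc_field :: "nat \<Rightarrow> real \<Rightarrow> 'p jet" where
  "acc_field n \<equiv> (nabla A g ^^ n) (velocity A q)"

lemma vfield_acc: "vfield (acc_field n)"
  by (rule vfield_nabla_pow[OF vfield_velocity])

lemma acc_tcoord:
  assumes c: "c \<in> A" "s \<in> Nc c"
  shows "metric_curve.acc (metric_in A g c) (\<lambda>s. cmap c (q s)) n s = tcoord c (acc_field n s)"
proof -
  have "tcoord c (acc_field n s) = (covd (levi_civita (metric_in A g c)) (\<lambda>s. cmap c (q s)) ^^ n) (\<lambda>s. tcoord c (velocity A q s)) s"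
    by (rule tcoord_nabla_pow[OF vfield_velocity c])
  also have "\<dots> = (covd (levi_civita (metric_in A g c)) (\<lambda>s. cmap c (q s)) ^^ n) (vderiv 1 (\<lambda>s. cmap c (q s))) s"
    by (rule covd_pow_cong[OF open_Nc[OF c(1)] c(2) refl]) (use tcoord_velocity[OF open_N smooth_q _ c(1)] in \<open>auto simp: Nc_def\<close>)
  finally show ?thesis by (simp add: metric_curve.acc_def[OF metric_curve[OF c(1)]])
qed

lemma acc_field_eq_tzero_iff:
  "c \<in> A \<Longrightarrow> s \<in> Nc c \<Longrightarrow> acc_field n s = tzero A (q s) \<longleftrightarrow> metric_curve.acc (metric_in A g c) (\<lambda>s. cmap c (q s)) n s = 0"
  using tangent_eq_tzero_iff[OF vfieldD(1)[OF vfield_acc]] by (simp add: acc_tcoord Nc_def)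

text \<open>Passes the vanishing of a covariant derivative on the whole interval on to all higher
  orders.\<close>

lemma nabla_tzero:
  assumes V: "vfield V" "\<And>s. s \<in> N \<Longrightarrow> V s = tzero A (q s)" and t: "t \<in> N"
  shows "nabla A g V t = tzero A (q t)"
proof -
  obtain c where c: "c \<in> A" "t \<in> Nc c" using ex_chart[OF t] by blast
  interpret m: metric_curve "cimage c" "metric_in A g c" "Nc c" "\<lambda>s. cmap c (q s)" by (rule metric_curve[OF c(1)])
  have z: "tcoord c (V s) = 0" if "s \<in> Nc c" for s
    using tangent_eq_tzero_iff[OF vfieldD(1)[OF V(1)] c(1)] V(2) that by (simp add: Nc_def)
  have "cmap c (q t) \<in> cimage c" using c(2) by (simp add: Nc_def)
  then have "levi_civita (metric_in A g c) (cmap c (q t)) v 0 = 0" for v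
    using linear_0[OF bilinearD(1)[OF m.bilinear_\<Gamma>]] by blast
  then have "covd (levi_civita (metric_in A g c)) (\<lambda>s. cmap c (q s)) (\<lambda>s. 0) t = 0"
    by (simp add: covd_def)
  then have "tcoord c (nabla A g V t) = 0"
    unfolding tcoord_nabla[OF V(1) c] using covd_cong[OF open_Nc[OF c(1)] c(2) refl z] by simp
  then show ?thesis
    using tangent_eq_tzero_iff[OF nabla_tangent[OF V(1) c] c(1)] c(2) by (simp add: Nc_def)
qed

section \<open>The two implications\<close>

lemma lift_geodesic_if:
  assumes "geodesic A g N q"
  shows "geodesic JA (sasaki_metric A g k) N lift"
  unfolding geodesic_def
proof (intro conjI ballI smooth_into_lift)
  fix t assume t: "t \<in> N"
  obtain c where c: "c \<in> A" "t \<in> Nc c"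
    "nabla JA (sasaki_metric A g k) (velocity JA lift) t = tzero JA (lift t) \<longleftrightarrow> jacc c t = 0"
    using nabla_lift_eq_tzero_iff[OF t] by blast
  interpret m: metric_curve "cimage c" "metric_in A g c" "Nc c" "\<lambda>s. cmap c (q s)" by (rule metric_curve[OF c(1)])
  have "m.jet_acc TYPE('k) t = 0"
  proof (rule m.jet_acc_eq_0[OF c(2)])
    show "m.acc 1 s = 0" if "s \<in> Nc c" for s
      using acc_field_eq_tzero_iff[OF c(1) that, of 1] assms that by (simp add: geodesic_def Nc_def One_nat_def)
  qed
  then show "nabla JA (sasaki_metric A g k) (velocity JA lift) t = tzero JA (lift t)"
    using c(3) by (simp add: jet_acc_jacc[OF c(1)])
qed

text \<open>At each \<open>t\<close> two consequences of the equation are extracted in the chart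
  that belongs to \<open>t\<close> and are restated without charts in \<open>loc\<close>. Being
  statements on all of \<open>N\<close>, they can be differentiated.\<close>

lemma geodesic_if_lift:
  assumes "geodesic JA (sasaki_metric A g k) N lift" "k \<ge> 1"
  shows "geodesic A g N q"
proof -
  define f where "f a b s = g (acc_field a s) (acc_field b s)" for a b s
  have loc: "acc_field (Suc k) t = tzero A (q t) \<and> ((\<lambda>s. \<Sum>n\<le>k. (1 / (fact n)\<^sup>2) * f n n s) has_real_derivative 0) (at t)"
    if t: "t \<in> N" for t
  proof -
    obtain c where c: "c \<in> A" "t \<in> Nc c"
      "nabla JA (sasaki_metric A g k) (velocity JA lift) t = tzero JA (lift t) \<longleftrightarrow> jacc c t = 0"
      using nabla_lift_eq_tzero_iff[OF t] by blast
    interpret m: metric_curve "cimage c" "metric_in A g c" "Nc c" "\<lambda>s. cmap c (q s)" by (rule metric_curve[OF c(1)])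
    have j: "m.jet_acc TYPE('k) t = 0"
      using assms(1) t c(3) by (simp add: jet_acc_jacc[OF c(1)] geodesic_def)
    have "acc_field (Suc k) t = tzero A (q t)"
      using m.acc_top_eq_0[OF c(2) j card_k assms(2)] acc_field_eq_tzero_iff[OF c(1,2), of "Suc k"] by simp
    moreover have "((\<lambda>s. \<Sum>n\<le>k. (1 / (fact n)\<^sup>2) * f n n s) has_real_derivative 0) (at t)"
      unfolding has_field_derivative_def
    proof (rule has_derivative_transform_within_open[OF m.has_derivative_speed[OF c(2) j, unfolded has_field_derivative_def] open_Nc[OF c(1)] c(2)])
      fix s assume s: "s \<in> Nc c"
      have "f n n s = metric_in A g c (cmap c (q s)) (m.acc n s) (m.acc n s)" for n
        unfolding f_def acc_tcoord[OF c(1) s]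
        by (rule metric_tangent[OF vfieldD(1)[OF vfield_acc] vfieldD(1)[OF vfield_acc] c(1)]) (use s in \<open>auto simp: Nc_def\<close>)
      then show "(\<Sum>n<CARD('k). metric_in A g c (cmap c (q s)) (m.acc n s) (m.acc n s) / (fact n)\<^sup>2) = (\<Sum>n\<le>k. (1 / (fact n)\<^sup>2) * f n n s)"
        by (simp add: card_k lessThan_Suc_atMost)
    qed
    ultimately show ?thesis ..
  qed
  \<comment> \<open>Descent in the degree bound \<open>d\<close>, from \<open>k\<close>, where
    \<open>loc\<close> provides the first vanishing derivative, down to 0.\<close>
  have vanish: "\<forall>a>d. \<forall>s\<in>N. acc_field a s = tzero A (q s)" if "d \<le> k" for d
    using that
  proof (induction d rule: inc_induct)
    case base
    show ?case
    proof (intro allI impI)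
      fix a assume "k < a"
      then have "Suc k \<le> a" by simp
      then show "\<forall>s\<in>N. acc_field a s = tzero A (q s)"
      proof (induction a rule: dec_induct)
        case base
        then show ?case using loc by blast
      next
        case (step a)
        then show ?case using nabla_tzero[OF vfield_acc[of a]] by simp
      qed
    qed
  next
    case (step d)
    have "f (Suc d) (Suc d) t = 0" if t: "t \<in> N" for t
    \<comment> \<open>By the induction hypothesis the degree is at most \<open>Suc d\<close>, which
      is positive. The weights are those of the Sasaki metric, and the one of order 0 equals
      1.\<close>
    proof (rule top_derivative_vanishes[OF open_N t, of "Suc d" k f "\<lambda>n. 1 / (fact n)\<^sup>2"])
      show "(f a b has_real_derivative f (Suc a) b s + f a (Suc b) s) (at s)" if "s \<in> N" for a b s
        using has_derivative_metric[OF vfield_acc[of a] vfield_acc[of b] that] by (simp add: f_def[abs_def])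
      show "f a b s = 0" if "s \<in> N" "Suc d < a \<or> Suc d < b" for a b s
        using that step.IH metric_tzero[OF vfield_acc[of a] that(1)] metric_tzero[OF vfield_acc[of b] that(1)] by (auto simp: f_def)
      show "((\<lambda>s. \<Sum>a\<le>k. (1 / (fact a)\<^sup>2) * f a a s) has_real_derivative 0) (at s)" if "s \<in> N" for s
        using loc[OF that] by blast
    qed (use step in auto)
    then have "acc_field (Suc d) s = tzero A (q s)" if "s \<in> N" for s
      using metric_eq_0D[OF vfield_acc[of "Suc d"] that] that by (simp add: f_def)
    then show ?case using step.IH by (metis Suc_lessI)
  qed
  \<comment> \<open>With \<open>d = 0\<close> the vanishing includes order 1, the acceleration of
    \<open>q\<close>.\<close>
  have "nabla A g (velocity A q) t = tzero A (q t)" if "t \<in> N" for t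
    using vanish[of 0] that by (force dest: spec[of _ "Suc 0"])
  then show ?thesis using smooth_q by (simp add: geodesic_def)
qed

end

theorem proposition35:
  fixes A :: "('p, 'e::euclidean_space) atlas"
    and g :: "'p metric"
    and k :: nat
    and I :: "real set"
    and q :: "real \<Rightarrow> 'p"
  assumes "riemannian_manifold A g"
    and "k \<ge> 1"
    and "CARD('k::finite) = k + 1"
    and "open I" and "is_interval I"
    and "smooth_into A I q"
  shows "geodesic (jet_atlas A k :: ('p jet, 'e ^ 'k) atlas) (sasaki_metric A g k) I (jet_lift A k q)
         \<longleftrightarrow> geodesic A g I q"
proof -
  interpret jet_curve A g k "TYPE('k)" I q
    by unfold_locales (use assms in \<open>auto simp: riemannian_manifold_def smooth_manifold_def\<close>)
  show ?thesis using lift_geodesic_if geodesic_if_lift assms(2) by blast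
qed

end
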